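(* There exist a degree bound $d\in\mathbb{N}$ and a property $\mathcal{P}\subseteq\mathcal{C}_d$ of graphs of maximum degree at most $d$ such that $\mathcal{P}$ is GSF-local and $\mathcal{P}$ is not testable in the bounded-degree graph model. Thus, not all GSF-local properties are non-propagating, i.e. there is a GSF-local property that is not non-propagating.
   Context: Graphs are finite, simple and undirected (possibly empty). For $d\in\mathbb{N}$, $\mathcal{C}_d$ is the class of all graphs of maximum degree at most $d$. A property $\mathcal{P}\subseteq\mathcal{C}_d$ is a subset closed under isomorphism; $\mathcal{P}_n=\{G\in\mathcal{P} : |V(G)|=n\}$, so $\mathcal{P}=\bigcup_{n\in\mathbb{N}}\mathcal{P}_n$. All graphs below are in $\mathcal{C}_d$ for the fixed $d$. For a graph $G$ and $v\in V(G)$, $N_1^G(v)$ is the closed neighbourhood of $v$, i.e. $v$ together with its neighbours. Bounded-degree model and testability. For $\epsilon\in(0,1)$, an $n$-vertex graph $G\in\mathcal{C}_d$ is $\epsilon$-close to a property if there is an $n$-vertex graph $G'$ in the property (on the same vertex set) such that $G$ and $G'$ differ in at most $\epsilon d n$ edges; otherwise $G$ is $\epsilon$-far from the property. An algorithm accesses $G$ (vertex set $\{1,\dots,n\}$) by queries $(v,i)$ with $v\in V(G)$, $i\in\{1,\dots,d\}$, answered by the $i$-th neighbour of $v$ if it exists and by a special symbol $\bot$ otherwise. An $\epsilon$-tester for $\mathcal{P}_n$ is a probabilistic algorithm which, given query access to an $n$-vertex graph $G\in\mathcal{C}_d$, accepts with probability at least $2/3$ if $G\in\mathcal{P}_n$,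 and rejects with probability at least $2/3$ if $G$ is $\epsilon$-far from $\mathcal{P}_n$. The property $\mathcal{P}$ is testable if there is a function $q=q(\epsilon,d)$ such that for every $n\in\mathbb{N}$ and $\epsilon\in(0,1)$ there is an $\epsilon$-tester for $\mathcal{P}_n$ making at most $q(\epsilon,d)$ queries (independent of $n$). Generalised subgraph freeness. A marked graph is a graph each of whose vertices is marked either `full', `semifull' or `partial'. An embedding of a marked graph $F$ into a graph $G$ is an injective map $f:V(F)\to V(G)$ such that for every $v\in V(F)$: (1) if $v$ is marked `full', then $N_1^G(f(v))=f(N_1^F(v))$; (2) if $v$ is marked `semifull', then $N_1^G(f(v))\cap f(V(F))=f(N_1^F(v))$; (3) if $v$ is marked `partial', then $N_1^G(f(v))\supseteq f(N_1^F(v))$. $G$ is $F$-free if there is no embedding of $F$ into $G$, and $\mathcal{F}$-free, for a set $\mathcal{F}$ of marked graphs, if it is $F$-free for every $F\in\mathcal{F}$. GSF-locality. Let $\overline{\mathcal{F}}=(\mathcal{F}_n)_{n\in\mathbb{N}}$ be a sequence of sets of marked graphs. $\mathcal{P}$ is $\overline{\mathcal{F}}$-local if there is an integer $s$ such that for every $n$ each marked graph in $\mathcal{F}_n$ has size at most $s$, and $\mathcal{P}_n$ equals the set of $n$-vertex graphs (in $\mathcal{C}_d$) that are $\mathcal{F}_n$-free. $\mathcal{P}$ is GSF-local if it is $\overline{\mathcal{F}}$-local for some such sequence $\overline{\mathcal{F}}$. Non-propagation. For an $n$-vertex graph $G$, a set $B\subset V(G)$ covers $\mathcal{F}_n$ in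 $G$ if for every $F\in\mathcal{F}_n$ and every embedding of $F$ into $G$, at least one vertex of $F$ is mapped to a vertex in $B$. The sequence $\overline{\mathcal{F}}$ is non-propagating if there is a monotonically non-decreasing function $\tau:(0,1]\to(0,1]$ such that (1) for every $\epsilon>0$ there is $\beta>0$ with $\tau(\beta)<\epsilon$; and (2) for every $n$, every $n$-vertex graph $G$ and every (nonempty) $B\subset V(G)$ that covers $\mathcal{F}_n$ in $G$, either $G$ is $\tau(|B|/n)$-close to being $\mathcal{F}_n$-free or there are no $n$-vertex graphs that are $\mathcal{F}_n$-free. (If $B=\emptyset$ covers $\mathcal{F}_n$ in $G$ then $G$ is already $\mathcal{F}_n$-free.) A GSF-local property $\mathcal{P}$ is non-propagating if there is a non-propagating sequence $\overline{\mathcal{F}}$ such that $\mathcal{P}$ is $\overline{\mathcal{F}}$-local. *)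

theory Defs
  imports "HOL-Probability.Probability_Mass_Function"
begin

section \<open>Graphs of bounded degree\<close>

record 'a ugraph =
  verts :: "'a set"
  edges :: "'a set set"

definition simple_graph :: "('a, 'm) ugraph_scheme \<Rightarrow> bool" where
  "simple_graph G \<longleftrightarrow> finite (verts G) \<and> (\<forall>e\<in>edges G. e \<subseteq> verts G \<and> card e = 2)"

definition neighbours :: "('a, 'm) ugraph_scheme \<Rightarrow> 'a \<Rightarrow> 'a set" where
  "neighbours G v = {w. {v, w} \<in> edges G}"

definition closed_nbhd :: "('a, 'm) ugraph_scheme \<Rightarrow> 'a \<Rightarrow> 'a set" where
  "closed_nbhd G v = insert v (neighbours G v)"

definition degree_at_most :: "nat \<Rightarrow> ('a, 'm) ugraph_scheme \<Rightarrow> bool" where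
  "degree_at_most d G \<longleftrightarrow> (\<forall>v\<in>verts G. card (neighbours G v) \<le> d)"

definition graph_iso :: "'a ugraph \<Rightarrow> 'b ugraph \<Rightarrow> bool" where
  "graph_iso G H \<longleftrightarrow>
    (\<exists>f. bij_betw f (verts G) (verts H) \<and> edges H = (\<lambda>e. f ` e) ` edges G)"

text \<open>
  The class \<open>C\<^sub>d\<close>.  Every finite graph is isomorphic to one whose vertices are natural
  numbers, so properties (being closed under isomorphism) are taken as sets of such graphs.
\<close>

definition bounded_degree_graphs :: "nat \<Rightarrow> nat ugraph set" where
  "bounded_degree_graphs d = {G. simple_graph G \<and> degree_at_most d G}"

definition graph_property :: "nat \<Rightarrow> nat ugraph set \<Rightarrow> bool" where
  "graph_property d P \<longleftrightarrow>
    P \<subseteq> bounded_degree_graphs d \<and> (\<forall>G\<in>P. \<forall>H. graph_iso G H \<longrightarrow> H \<in> P)"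

definition of_order :: "nat ugraph set \<Rightarrow> nat \<Rightarrow> nat ugraph set" where
  "of_order P n = {G \<in> P. card (verts G) = n}"


section \<open>The bounded-degree model and testability\<close>

definition eps_close :: "nat \<Rightarrow> real \<Rightarrow> nat ugraph \<Rightarrow> nat ugraph set \<Rightarrow> bool" where
  "eps_close d \<epsilon> G Q \<longleftrightarrow>
    (\<exists>G'\<in>Q. verts G' = verts G \<and>
      real (card ((edges G - edges G') \<union> (edges G' - edges G)))
        \<le> \<epsilon> * real d * real (card (verts G)))"

abbreviation eps_far :: "nat \<Rightarrow> real \<Rightarrow> nat ugraph \<Rightarrow> nat ugraph set \<Rightarrow> bool" where
  "eps_far d \<epsilon> G Q \<equiv> \<not> eps_close d \<epsilon> G Q"

text \<open>
  Query access to \<open>G\<close> is given by adjacency lists; the order of each list is arbitrary, and a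
  tester has to work for all orders.  The answer \<open>None\<close> stands for the symbol \<open>\<bottom>\<close>; queries
  outside the range of the model are also answered by \<open>None\<close>, which carries no information.
\<close>

definition adjacency_lists :: "nat ugraph \<Rightarrow> (nat \<Rightarrow> nat list) \<Rightarrow> bool" where
  "adjacency_lists G adj \<longleftrightarrow>
    (\<forall>v\<in>verts G. distinct (adj v) \<and> set (adj v) = neighbours G v)"

definition answer :: "nat ugraph \<Rightarrow> (nat \<Rightarrow> nat list) \<Rightarrow> nat \<Rightarrow> nat \<Rightarrow> nat option" where
  "answer G adj v i =
    (if v \<in> verts G \<and> 1 \<le> i \<and> i \<le> length (adj v) then Some (adj v ! (i - 1)) else None)"

text \<open>
  Adaptive probabilistic query algorithms: at each point the algorithm stops with a verdict
  (\<open>True\<close> for accept), queries the \<open>i\<close>-th neighbour of \<open>v\<close> and continues depending on the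
  answer, or makes a random choice of how to continue.
\<close>

datatype query_alg =
    Verdict bool
  | Query nat nat "nat option \<Rightarrow> query_alg"
  | Random "query_alg pmf"

text \<open>The joint distribution of the verdict and of the number of queries made.\<close>

primrec run :: "(nat \<Rightarrow> nat \<Rightarrow> nat option) \<Rightarrow> query_alg \<Rightarrow> (bool \<times> nat) pmf" where
  "run orc (Verdict b) = return_pmf (b, 0)"
| "run orc (Query v i c) = map_pmf (\<lambda>(b, k). (b, Suc k)) (run orc (c (orc v i)))"
| "run orc (Random p) = join_pmf (map_pmf (run orc) p)"

definition verdict_prob :: "(nat \<Rightarrow> nat \<Rightarrow> nat option) \<Rightarrow> query_alg \<Rightarrow> bool \<Rightarrow> real" where
  "verdict_prob orc A b = measure_pmf.prob (run orc A) {(b', k). b' = b}"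

definition tester :: "nat \<Rightarrow> real \<Rightarrow> nat \<Rightarrow> nat ugraph set \<Rightarrow> query_alg \<Rightarrow> bool" where
  "tester d \<epsilon> n Q A \<longleftrightarrow>
    (\<forall>G\<in>bounded_degree_graphs d. \<forall>adj.
      verts G = {1..n} \<and> adjacency_lists G adj \<longrightarrow>
        (G \<in> Q \<longrightarrow> verdict_prob (answer G adj) A True \<ge> 2 / 3) \<and>
        (eps_far d \<epsilon> G Q \<longrightarrow> verdict_prob (answer G adj) A False \<ge> 2 / 3))"

definition queries_at_most :: "nat \<Rightarrow> nat \<Rightarrow> query_alg \<Rightarrow> nat \<Rightarrow> bool" where
  "queries_at_most d n A q \<longleftrightarrow>
    (\<forall>G\<in>bounded_degree_graphs d. \<forall>adj.
      verts G = {1..n} \<and> adjacency_lists G adj \<longrightarrow>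
        (\<forall>(b, k)\<in>set_pmf (run (answer G adj) A). k \<le> q))"

definition testable :: "nat \<Rightarrow> nat ugraph set \<Rightarrow> bool" where
  "testable d P \<longleftrightarrow>
    (\<exists>q :: real \<Rightarrow> nat. \<forall>n. \<forall>\<epsilon>. 0 < \<epsilon> \<and> \<epsilon> < 1 \<longrightarrow>
      (\<exists>A. tester d \<epsilon> n (of_order P n) A \<and> queries_at_most d n A (q \<epsilon>)))"


section \<open>Generalised subgraph freeness\<close>

datatype mark = Full | Semifull | Partial

record 'a marked_graph = "'a ugraph" +
  marking :: "'a \<Rightarrow> mark"

definition marked_graphs :: "nat \<Rightarrow> nat marked_graph set" where
  "marked_graphs d = {F. simple_graph F \<and> degree_at_most d F}"

definition embedding :: "('a \<Rightarrow> 'b) \<Rightarrow> 'a marked_graph \<Rightarrow> 'b ugraph \<Rightarrow> bool" where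
  "embedding f F G \<longleftrightarrow>
    inj_on f (verts F) \<and> f ` verts F \<subseteq> verts G \<and>
    (\<forall>v\<in>verts F. case marking F v of
        Full \<Rightarrow> closed_nbhd G (f v) = f ` closed_nbhd F v
      | Semifull \<Rightarrow> closed_nbhd G (f v) \<inter> f ` verts F = f ` closed_nbhd F v
      | Partial \<Rightarrow> closed_nbhd G (f v) \<supseteq> f ` closed_nbhd F v)"

definition gsf_free :: "nat marked_graph set \<Rightarrow> nat ugraph \<Rightarrow> bool" where
  "gsf_free \<F> G \<longleftrightarrow> (\<forall>F\<in>\<F>. \<not> (\<exists>f. embedding f F G))"

definition free_graphs :: "nat \<Rightarrow> nat marked_graph set \<Rightarrow> nat \<Rightarrow> nat ugraph set" where
  "free_graphs d \<F> n = {G \<in> of_order (bounded_degree_graphs d) n. gsf_free \<F> G}"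

definition local_for ::
  "nat \<Rightarrow> (nat \<Rightarrow> nat marked_graph set) \<Rightarrow> nat ugraph set \<Rightarrow> bool" where
  "local_for d \<F> P \<longleftrightarrow>
    (\<exists>s. \<forall>n. \<F> n \<subseteq> marked_graphs d \<and> (\<forall>F\<in>\<F> n. card (verts F) \<le> s) \<and>
      of_order P n = free_graphs d (\<F> n) n)"

definition gsf_local :: "nat \<Rightarrow> nat ugraph set \<Rightarrow> bool" where
  "gsf_local d P \<longleftrightarrow> (\<exists>\<F>. local_for d \<F> P)"


section \<open>Non-propagation\<close>

definition covers :: "nat set \<Rightarrow> nat marked_graph set \<Rightarrow> nat ugraph \<Rightarrow> bool" where
  "covers B \<F> G \<longleftrightarrow> (\<forall>F\<in>\<F>. \<forall>f. embedding f F G \<longrightarrow> (\<exists>v\<in>verts F. f v \<in> B))"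

definition non_propagating_seq :: "nat \<Rightarrow> (nat \<Rightarrow> nat marked_graph set) \<Rightarrow> bool" where
  "non_propagating_seq d \<F> \<longleftrightarrow>
    (\<exists>\<tau> :: real \<Rightarrow> real.
      \<tau> ` {0<..1} \<subseteq> {0<..1} \<and> mono_on {0<..1} \<tau> \<and>
      (\<forall>\<epsilon>>0. \<exists>\<beta>\<in>{0<..1}. \<tau> \<beta> < \<epsilon>) \<and>
      (\<forall>n. \<forall>G\<in>of_order (bounded_degree_graphs d) n. \<forall>B.
        B \<subseteq> verts G \<and> B \<noteq> {} \<and> covers B (\<F> n) G \<longrightarrow>
          eps_close d (\<tau> (real (card B) / real n)) G (free_graphs d (\<F> n) n) \<or>
          free_graphs d (\<F> n) n = {}))"

definition non_propagating :: "nat \<Rightarrow> nat ugraph set \<Rightarrow> bool" where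
  "non_propagating d P \<longleftrightarrow> (\<exists>\<F>. non_propagating_seq d \<F> \<and> local_for d \<F> P)"

end

theory Submission
  imports Defs "HOL-Library.Numeral_Type" "HOL-Combinatorics.Permutations"
begin

text \<open>
  Let \<open>\<Gamma>\<close> be generated by three elements of order 5, any two of which commute up to an element
  commuting with both.  Any two generators have an angle with cosine at most \<open>1/\<surd>5 < 1/2\<close>
  in every unitary representation, and a trickling-down argument makes \<open>\<Gamma>\<close> a group with
  property (T); it also has arbitrarily large finite quotients.  Finite actions of \<open>\<Gamma>\<close> can be
  encoded as graphs of degree at most 9, and the property that every small configuration
  occurs in an encoded action is GSF-local.

  Delete one point from the regular action on a large quotient.  If the resulting graph \<open>H\<close> on
  \<open>10 N\<close> vertices were close to a graph with the property, that graph would decode to an action on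
  at most \<open>N\<close> points, and the identity would be an almost invariant partial bijection between it
  and the regular action on \<open>N + 1\<close> points; property (T) rounds it to an equivariant
  injection, which is impossible.  So \<open>H\<close> is far from the property.  On the other hand \<open>H\<close> looks
  locally like a disjoint union of copies of a smaller quotient with some fixed points, which has
  the property.  Hence boundedly many queries cannot tell the two apart, and the defects of \<open>H\<close>
  are covered by boundedly many vertices.
\<close>

section \<open>Actions of a Kac--Moody--Steinberg group\<close>

text \<open>The order 5 is chosen for the spectral step: with three generators the trickling-down
  estimate gives a gap only for cosines below 1/2, and 1/sqrt 2 and 1/sqrt 3 are too large. Actions
  are encoded, not groups, because relations can be verified in bounded balls whereas transitivity
  cannot; points fixed by all generators are therefore legal and serve to pad a smaller action to
  any number of points. The balls of a graph with the property may come from unrelated actions, so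
  the gadgets are made rigid: generators are read off from vertex degrees alone, and the local
  readings agree. The contradiction behind farness is a count: ten vertices per centre leave room
  for \<open>N\<close> points, while the rounded injection starts from \<open>N + 1\<close>. For
  testers the difficulty is adaptivity. Both graphs get a uniformly random labelling that is
  revealed lazily, and the two runs are compared as long as the explored points remain partially
  isomorphic; each query uses up a bounded part of the initial radius.\<close>

definition act :: "(nat \<Rightarrow> 'a \<Rightarrow> 'a) \<Rightarrow> nat list \<Rightarrow> 'a \<Rightarrow> 'a" where
  "act T w x = foldr T w x"

lemma act_Nil [simp]: "act T [] x = x"
  and act_Cons [simp]: "act T (i # w) x = T i (act T w x)"
  and act_append [simp]: "act T (v @ w) x = act T v (act T w x)"
  by (simp_all add: act_def)

lemma act_replicate: "act T (replicate n i) x = (T i ^^ n) x"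
  by (induction n) auto

lemma act_concat_replicate: "act T (concat (replicate n w)) x = (act T w ^^ n) x"
  by (induction n) auto

text \<open>The commutator i j i^(-1) j^(-1), each inverse written as a fourth power.
  \<open>act\<close> applies the last letter first.\<close>

definition comm_word :: "nat \<Rightarrow> nat \<Rightarrow> nat list" where
  "comm_word i j = [i, j] @ replicate 4 i @ replicate 4 j"

definition kms_rels :: "(nat list \<times> nat list) set" where
  "kms_rels = (\<Union>i<3. {(replicate 5 i, [])}) \<union>
    (\<Union>i<3. \<Union>j\<in>{..<3} - {i}.
      {(comm_word i j @ [i], i # comm_word i j), (comm_word i j @ [j], j # comm_word i j)})"

text \<open>
  The group has three generators of order 5, any two of which generate a quotient of the
  Heisenberg group over the field with five elements.  As inverses are fourth powers, positive
  words suffice.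
\<close>

definition kms_action :: "(nat \<Rightarrow> 'a \<Rightarrow> 'a) \<Rightarrow> 'a set \<Rightarrow> bool" where
  "kms_action T X \<longleftrightarrow> finite X \<and> (\<forall>i<3. \<forall>x\<in>X. T i x \<in> X) \<and>
    (\<forall>(w, w')\<in>kms_rels. \<forall>x\<in>X. act T w x = act T w' x)"

definition words :: "nat \<Rightarrow> nat list set" where
  "words n = {w. set w \<subseteq> {..<3} \<and> length w \<le> n}"

lemma finite_words [simp]: "finite (words n)"
  unfolding words_def by (rule finite_lists_length_le) simp

lemma kms_rels_words: "(w, w') \<in> kms_rels \<Longrightarrow> w \<in> words 11 \<and> w' \<in> words 11"
  by (auto simp: kms_rels_def words_def comm_word_def)

lemma act_equivariant:
  assumes "set w \<subseteq> {..<3}" "x \<in> X"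
    and "\<And>i x. i < 3 \<Longrightarrow> x \<in> X \<Longrightarrow> T i x \<in> X \<and> h (T i x) = T' i (h x)"
  shows "act T w x \<in> X \<and> h (act T w x) = act T' w (h x)"
  using assms(1) by (induction w) (use assms in auto)

lemma kms_action_equivariant:
  assumes "kms_action T X" "h ` X = Y"
    and "\<And>i x. i < 3 \<Longrightarrow> x \<in> X \<Longrightarrow> h (T i x) = T' i (h x)"
  shows "kms_action T' Y"
  unfolding kms_action_def
proof (intro conjI allI impI ballI, goal_cases)
  case 1 then show ?case using assms by (auto simp: kms_action_def)
next
  case (2 i y)
  then obtain x where "x \<in> X" "y = h x" using assms(2) by blast
  moreover have "T i x \<in> X" using \<open>x \<in> X\<close> \<open>i < 3\<close> assms(1) by (auto simp: kms_action_def)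
  ultimately show ?case using assms(2) assms(3)[OF \<open>i < 3\<close> \<open>x \<in> X\<close>] by (metis imageI)
next
  case (3 r)
  obtain w w' where r: "r = (w, w')" by (cases r)
  with 3 have s: "set w \<subseteq> {..<3}" "set w' \<subseteq> {..<3}" using kms_rels_words[of w w'] by (auto simp: words_def)
  have T: "\<And>i x. i < 3 \<Longrightarrow> x \<in> X \<Longrightarrow> T i x \<in> X \<and> h (T i x) = T' i (h x)"
    using assms(1,3) by (auto simp: kms_action_def)
  have "act T' w y = act T' w' y" if "y \<in> Y" for y
  proof -
    have "y \<in> h ` X" using assms(2) that by simp
    then obtain x where x: "x \<in> X" "y = h x" by (rule imageE)
    have "act T w x = act T w' x" using assms(1) 3 r x(1) by (auto simp: kms_action_def)
    moreover have "h (act T w x) = act T' w y" "h (act T w' x) = act T' w' y"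
      using act_equivariant[of _ x X T h T'] s x T by blast+
    ultimately show ?thesis by simp
  qed
  then show ?case by (simp add: r)
qed

locale kms =
  fixes T :: "nat \<Rightarrow> 'a \<Rightarrow> 'a" and X :: "'a set"
  assumes kms: "kms_action T X"
begin

lemma fin [simp]: "finite X"
  and T_in: "i < 3 \<Longrightarrow> x \<in> X \<Longrightarrow> T i x \<in> X"
  and rel: "(w, w') \<in> kms_rels \<Longrightarrow> x \<in> X \<Longrightarrow> act T w x = act T w' x"
  using kms by (auto simp: kms_action_def)

lemma act_in: "set w \<subseteq> {..<3} \<Longrightarrow> x \<in> X \<Longrightarrow> act T w x \<in> X"
  by (induction w) (auto simp: T_in)

lemma T5: "i < 3 \<Longrightarrow> x \<in> X \<Longrightarrow> (T i ^^ 5) x = x"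
  using rel[of "replicate 5 i" "[]" x] unfolding act_replicate by (auto simp: kms_rels_def)

lemma bij_T: assumes "i < 3" shows "bij_betw (T i) X X"
proof (rule bij_betwI[where g = "T i ^^ 4"])
  show "T i \<in> X \<rightarrow> X" using T_in assms by auto
  show "T i ^^ 4 \<in> X \<rightarrow> X" using act_in[of "replicate 4 i"] assms by (auto simp: act_replicate)
  show "(T i ^^ 4) (T i x) = x" "T i ((T i ^^ 4) x) = x" if "x \<in> X" for x
    using T5[OF assms that] by (simp_all add: eval_nat_numeral)
qed

lemma bij_act: "set w \<subseteq> {..<3} \<Longrightarrow> bij_betw (act T w) X X"
proof (induction w)
  case Nil then show ?case by (simp add: bij_betw_def inj_on_def)
next
  case (Cons i w)
  then show ?case using bij_betw_trans[of "act T w" X X "T i" X] bij_T[of i]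
    by (simp add: comp_def)
qed

end

lemma act_map_prod: "act (\<lambda>i. map_prod (T i) (T' i)) w (x, y) = (act T w x, act T' w y)"
  by (induction w) auto

lemma kms_action_Times:
  assumes "kms_action T X" "kms_action T' Y"
  shows "kms_action (\<lambda>i. map_prod (T i) (T' i)) (X \<times> Y)"
proof -
  interpret A: kms T X by unfold_locales fact
  interpret B: kms T' Y by unfold_locales fact
  show ?thesis unfolding kms_action_def
    by (auto simp: act_map_prod A.T_in B.T_in A.rel B.rel)
qed


section \<open>Spectral gap\<close>

definition ip :: "'a set \<Rightarrow> ('a \<Rightarrow> real) \<Rightarrow> ('a \<Rightarrow> real) \<Rightarrow> real" where
  "ip X f g = (\<Sum>x\<in>X. f x * g x)"

lemma ip_commute: "ip X f g = ip X g f" by (simp add: ip_def mult.commute)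
lemma ip_add_left: "ip X (\<lambda>x. f x + g x) h = ip X f h + ip X g h"
  by (simp add: ip_def algebra_simps sum.distrib)
lemma ip_diff_left: "ip X (\<lambda>x. f x - g x) h = ip X f h - ip X g h"
  by (simp add: ip_def algebra_simps sum_subtractf)
lemma ip_scale_left: "ip X (\<lambda>x. c * f x) h = c * ip X f h"
  by (simp add: ip_def algebra_simps sum_distrib_left)
lemma ip_div_left: "ip X (\<lambda>x. f x / c) h = ip X f h / c"
  by (simp add: ip_def algebra_simps sum_divide_distrib)
lemma ip_add_right: "ip X h (\<lambda>x. f x + g x) = ip X h f + ip X h g"
  by (simp add: ip_def algebra_simps sum.distrib)
lemma ip_diff_right: "ip X h (\<lambda>x. f x - g x) = ip X h f - ip X h g"
  by (simp add: ip_def algebra_simps sum_subtractf)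
lemma ip_scale_right: "ip X h (\<lambda>x. c * f x) = c * ip X h f"
  by (simp add: ip_def algebra_simps sum_distrib_left)
lemma ip_div_right: "ip X h (\<lambda>x. f x / c) = ip X h f / c"
  by (simp add: ip_def algebra_simps sum_divide_distrib)
lemmas ip_simps = ip_add_left ip_diff_left ip_scale_left ip_div_left
  ip_add_right ip_diff_right ip_scale_right ip_div_right

lemma ip_nonneg: "0 \<le> ip X f f" by (simp add: ip_def sum_nonneg)

lemma ip_cong: "(\<And>x. x \<in> X \<Longrightarrow> f x = f' x) \<Longrightarrow> (\<And>x. x \<in> X \<Longrightarrow> g x = g' x) \<Longrightarrow> ip X f g = ip X f' g'"
  by (simp add: ip_def)

text \<open>Five times the orthogonal projection onto the functions invariant under
  \<open>a\<close>, when the fifth power of \<open>a\<close> is trivial.\<close>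

definition orbit_sum :: "('a \<Rightarrow> 'a) \<Rightarrow> ('a \<Rightarrow> real) \<Rightarrow> 'a \<Rightarrow> real" where
  "orbit_sum a f x = (\<Sum>i<5. f ((a ^^ i) x))"

lemma sum_lessThan_5: "(\<Sum>i<5. h i) = h 0 + h 1 + h 2 + h 3 + h (4::nat)" for h :: "nat \<Rightarrow> real"
  by (simp add: eval_nat_numeral)

locale order5 =
  fixes X :: "'a set" and a :: "'a \<Rightarrow> 'a"
  assumes fin [simp]: "finite X" and into: "x \<in> X \<Longrightarrow> a x \<in> X" and five: "x \<in> X \<Longrightarrow> (a ^^ 5) x = x"
begin

lemma pow_in: "x \<in> X \<Longrightarrow> (a ^^ n) x \<in> X"
  by (induction n) (auto simp: into)

lemma pow_mod: assumes "x \<in> X" shows "(a ^^ n) x = (a ^^ (n mod 5)) x"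
proof -
  have "(a ^^ (5 * k)) x = x" for k
    by (induction k) (auto simp: funpow_add five assms pow_in algebra_simps)
  then have "(a ^^ (n mod 5 + 5 * (n div 5))) x = (a ^^ (n mod 5)) x"
    by (simp only: funpow_add comp_apply)
  then show ?thesis by simp
qed

lemma bij: "bij_betw a X X"
proof (rule bij_betwI[where g = "a ^^ 4"])
  show "a \<in> X \<rightarrow> X" using into by auto
  show "a ^^ 4 \<in> X \<rightarrow> X" using pow_in by auto
  show "(a ^^ 4) (a x) = x" "a ((a ^^ 4) x) = x" if "x \<in> X" for x
    using five[OF that] by (simp_all add: eval_nat_numeral)
qed

lemma orbit_sum_inv: assumes "x \<in> X" shows "orbit_sum a f (a x) = orbit_sum a f x"
  using five[OF assms] unfolding orbit_sum_def sum_lessThan_5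
  by (simp add: eval_nat_numeral)

lemma ip_shift: "ip X (\<lambda>x. f (a x)) (\<lambda>x. g (a x)) = ip X f g"
  unfolding ip_def using sum.reindex_bij_betw[OF bij, of "\<lambda>x. f x * g x"] by simp

lemma ip_pow:
  assumes "\<And>x. x \<in> X \<Longrightarrow> g (a x) = g x"
  shows "ip X (\<lambda>x. f ((a ^^ n) x)) g = ip X f g"
proof (induction n)
  case (Suc n)
  have "ip X (\<lambda>x. f ((a ^^ Suc n) x)) g = ip X (\<lambda>x. f ((a ^^ n) (a x))) (\<lambda>x. g (a x))"
    by (rule ip_cong) (auto simp: funpow_swap1 assms)
  then show ?case using ip_shift[of "\<lambda>x. f ((a ^^ n) x)" g] Suc by simp
qed simp

lemma ip_orbit_sum:
  assumes "\<And>x. x \<in> X \<Longrightarrow> g (a x) = g x"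
  shows "ip X (orbit_sum a f) g = 5 * ip X f g"
proof -
  have "ip X (orbit_sum a f) g = (\<Sum>i<5. ip X (\<lambda>x. f ((a ^^ i) x)) g)"
    unfolding ip_def orbit_sum_def sum_distrib_right by (rule sum.swap)
  then show ?thesis by (simp add: ip_pow assms)
qed

end

section \<open>Averaging over the Heisenberg group of order 125\<close>

locale heisenberg =
  A: order5 X a + B: order5 X b + Z: order5 X z
  for X :: "'a set" and a b z +
  assumes ab: "x \<in> X \<Longrightarrow> a (b x) = z (b (a x))"
    and za: "x \<in> X \<Longrightarrow> z (a x) = a (z x)" and zb: "x \<in> X \<Longrightarrow> z (b x) = b (z x)"
begin

lemmas ins = A.into B.into Z.into A.pow_in B.pow_in Z.pow_in

lemma z_pow_a: "x \<in> X \<Longrightarrow> (z ^^ m) (a x) = a ((z ^^ m) x)"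
  by (induction m) (auto simp: za ins)
lemma z_pow_b: "x \<in> X \<Longrightarrow> (z ^^ m) (b x) = b ((z ^^ m) x)"
  by (induction m) (auto simp: zb ins)
lemma z_pow_a_pow: "x \<in> X \<Longrightarrow> (z ^^ m) ((a ^^ i) x) = (a ^^ i) ((z ^^ m) x)"
  by (induction i) (auto simp: z_pow_a ins)
lemma z_pow_b_pow: "x \<in> X \<Longrightarrow> (z ^^ m) ((b ^^ i) x) = (b ^^ i) ((z ^^ m) x)"
  by (induction i) (auto simp: z_pow_b ins)

lemma a_b_pow: "x \<in> X \<Longrightarrow> a ((b ^^ j) x) = (z ^^ j) ((b ^^ j) (a x))"
proof (induction j)
  case (Suc j)
  have "a ((b ^^ Suc j) x) = z (b (a ((b ^^ j) x)))" by (simp add: ab ins Suc.prems)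
  also have "\<dots> = z (b ((z ^^ j) ((b ^^ j) (a x))))" by (simp add: Suc)
  also have "\<dots> = (z ^^ Suc j) ((b ^^ Suc j) (a x))" by (simp add: z_pow_b ins Suc.prems)
  finally show ?case .
qed simp

lemma a_pow_b_pow: "x \<in> X \<Longrightarrow> (a ^^ i) ((b ^^ j) x) = (z ^^ (i * j)) ((b ^^ j) ((a ^^ i) x))"
proof (induction i)
  case (Suc i)
  have "(a ^^ Suc i) ((b ^^ j) x) = a ((z ^^ (i * j)) ((b ^^ j) ((a ^^ i) x)))"
    using Suc by simp
  also have "\<dots> = (z ^^ (i * j)) (a ((b ^^ j) ((a ^^ i) x)))"
    by (simp add: z_pow_a ins Suc.prems)
  also have "\<dots> = (z ^^ (i * j)) ((z ^^ j) ((b ^^ j) ((a ^^ Suc i) x)))"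
    by (simp add: a_b_pow ins Suc.prems)
  also have "\<dots> = (z ^^ (i * j + j)) ((b ^^ j) ((a ^^ Suc i) x))"
    by (simp only: funpow_add comp_apply)
  also have "i * j + j = Suc i * j" by simp
  finally show ?case .
qed simp

definition fixed :: "('a \<Rightarrow> real) \<Rightarrow> bool" where
  "fixed g \<longleftrightarrow> (\<forall>x\<in>X. g (a x) = g x \<and> g (b x) = g x)"

text \<open>The average over the 125 normal forms z^m a^i b^j; \<open>fixed_proj\<close> and
  \<open>ip_proj\<close> identify it as the orthogonal projection onto the functions invariant under
  \<open>a\<close> and \<open>b\<close>.\<close>

definition proj :: "('a \<Rightarrow> real) \<Rightarrow> 'a \<Rightarrow> real" where
  "proj f x = orbit_sum b (orbit_sum a (orbit_sum z f)) x / 125"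

lemma fixed_z: assumes "fixed g" "x \<in> X" shows "g (z x) = g x"
proof -
  \<comment> \<open>Here \<open>y\<close> is a^(-1) b^(-1) x, so that x = b (a y) and z x = a (b
    y).\<close>
  define y where "y = (a ^^ 4) ((b ^^ 4) x)"
  have y: "y \<in> X" using assms by (simp add: y_def ins)
  have "b (a y) = b ((a ^^ 5) ((b ^^ 4) x))" by (simp add: y_def eval_nat_numeral)
  also have "\<dots> = (b ^^ 5) x" using assms(2) by (simp add: A.five ins) (simp add: eval_nat_numeral)
  finally have "b (a y) = x" using assms(2) B.five by simp
  then have "g (z x) = g (a (b y))" using ab[OF y] by simp
  also have "\<dots> = g (b (a y))" using assms(1) y by (simp add: fixed_def ins)
  finally show ?thesis using \<open>b (a y) = x\<close> by simp
qed

text \<open>The outer sum gives invariance under \<open>b\<close>. Moving \<open>a\<close> past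
  \<open>b ^^ j\<close> costs a power of \<open>z\<close>, which the inner sums absorb because
  \<open>z\<close> commutes with \<open>a\<close>.\<close>

lemma fixed_proj: "fixed (proj f)"
proof -
  define g where "g = orbit_sum a (orbit_sum z f)"
  have ga: "g (a x) = g x" if "x \<in> X" for x using that A.orbit_sum_inv by (simp add: g_def)
  have gz: "g (z x) = g x" if "x \<in> X" for x
    unfolding g_def orbit_sum_def[of a]
  proof (intro sum.cong refl)
    fix i
    have "(a ^^ i) (z x) = z ((a ^^ i) x)" using z_pow_a_pow[OF that, of 1 i] by simp
    then show "orbit_sum z f ((a ^^ i) (z x)) = orbit_sum z f ((a ^^ i) x)"
      using Z.orbit_sum_inv[of "(a ^^ i) x" f] that by (simp add: ins)
  qed
  have gzn: "g ((z ^^ n) x) = g x" if "x \<in> X" for x n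
    using that by (induction n) (auto simp: gz ins)
  have "orbit_sum b g (a x) = orbit_sum b g x" if "x \<in> X" for x
    unfolding orbit_sum_def
  proof (intro sum.cong refl)
    fix j
    have "g ((b ^^ j) (a x)) = g ((z ^^ j) ((b ^^ j) (a x)))" using that by (simp add: gzn ins)
    also have "\<dots> = g (a ((b ^^ j) x))" using that by (simp add: a_b_pow)
    also have "\<dots> = g ((b ^^ j) x)" using that by (simp add: ga ins)
    finally show "g ((b ^^ j) (a x)) = g ((b ^^ j) x)" .
  qed
  then show ?thesis
    using B.orbit_sum_inv[of _ g] by (auto simp: fixed_def proj_def g_def)
qed

lemma ip_proj: assumes "fixed g" shows "ip X (proj f) g = ip X f g"
proof -
  have "ip X (orbit_sum b (orbit_sum a (orbit_sum z f))) g = 125 * ip X f g"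
    using assms fixed_z[OF assms]
    by (simp add: B.ip_orbit_sum A.ip_orbit_sum Z.ip_orbit_sum fixed_def)
  moreover have "proj f = (\<lambda>x. orbit_sum b (orbit_sum a (orbit_sum z f)) x / 125)"
    by (simp add: fun_eq_iff proj_def)
  ultimately show ?thesis by (simp add: ip_div_left)
qed

text \<open>
  In the group algebra this reads
  \<open>E\<^sub>a E\<^sub>b E\<^sub>a = (E\<^sub>a - E\<^sub>a E\<^sub>z) / 5 + E\<^sub>a E\<^sub>b E\<^sub>z\<close>: for \<open>j \<noteq> 0\<close> the commutators of \<open>b\<^sup>j\<close> with the
  powers of \<open>a\<close> exhaust the powers of \<open>z\<close>.
\<close>

lemma orbit_sum_a_b:
  assumes f: "\<And>x. x \<in> X \<Longrightarrow> f (a x) = f x" and x: "x \<in> X"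
  shows "orbit_sum a (orbit_sum b f) x = 5 * f x - orbit_sum z f x + 25 * proj f x"
proof -
  have fa: "f ((a ^^ i) y) = f y" if "y \<in> X" for i y
    using that by (induction i) (auto simp: f ins)
  \<comment> \<open>Sliding \<open>a ^^ i\<close> through \<open>b ^^ j\<close> produces z^(ij),
    which is cancelled by starting from z^(4ij) x, since 4 is -1 modulo 5.\<close>
  have 1: "f ((b ^^ j) ((a ^^ i) x)) = f ((b ^^ j) ((z ^^ (4 * i * j mod 5)) x))" for i j
  proof -
    define y where "y = (z ^^ (4 * i * j)) x"
    have y: "y \<in> X" by (simp add: y_def x ins)
    have "f ((b ^^ j) y) = f ((a ^^ i) ((b ^^ j) y))" by (simp add: fa y ins)
    also have "\<dots> = f ((b ^^ j) ((a ^^ i) ((z ^^ (i * j)) y)))"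
      by (simp add: a_pow_b_pow y z_pow_b_pow z_pow_a_pow ins)
    also have "(z ^^ (i * j)) y = (z ^^ (i * j + 4 * i * j)) x"
      unfolding y_def by (simp only: funpow_add comp_apply)
    also have "\<dots> = (z ^^ (5 * (i * j))) x" by simp
    also have "\<dots> = x" using Z.pow_mod[OF x, of "5 * (i * j)"] by simp
    finally show ?thesis using Z.pow_mod[OF x, of "4 * i * j"] by (simp add: y_def)
  qed
  have interval: "{1..<5} = {1, 2, 3, 4 :: nat}" by auto
  have "orbit_sum a (orbit_sum b f) x = (\<Sum>j<5. \<Sum>i<5. f ((b ^^ j) ((z ^^ (4 * i * j mod 5)) x)))"
    unfolding orbit_sum_def 1 by (rule sum.swap)
  also have "\<dots> = 5 * f x + (\<Sum>j\<in>{1..<5}. \<Sum>m<5. f ((b ^^ j) ((z ^^ m) x)))"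
    unfolding sum_lessThan_5 interval by simp
  finally have L: "orbit_sum a (orbit_sum b f) x =
    5 * f x + (\<Sum>j\<in>{1..<5}. \<Sum>m<5. f ((b ^^ j) ((z ^^ m) x)))" .
  have "orbit_sum a (orbit_sum z f) y = 5 * orbit_sum z f y" if "y \<in> X" for y
    unfolding orbit_sum_def using that by (simp add: z_pow_a_pow fa ins)
  then have "25 * proj f x = orbit_sum b (orbit_sum z f) x"
    unfolding proj_def orbit_sum_def[of b] by (simp add: x ins sum_distrib_left[symmetric])
  also have "\<dots> = (\<Sum>j<5. \<Sum>m<5. f ((b ^^ j) ((z ^^ m) x)))"
    unfolding orbit_sum_def by (simp add: z_pow_b_pow x)
  also have "\<dots> = orbit_sum z f x + (\<Sum>j\<in>{1..<5}. \<Sum>m<5. f ((b ^^ j) ((z ^^ m) x)))"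
    unfolding orbit_sum_def sum_lessThan_5 interval by simp
  finally show ?thesis using L by simp
qed

lemma ip_residual: assumes "fixed g" shows "ip X (\<lambda>x. f x - proj f x) g = 0"
  by (simp add: ip_simps ip_proj assms)

text \<open>When \<open>orbit_sum_a_b\<close> is paired with \<open>u\<close>, which has no
  invariant component, its last term drops out and (1 - E_z)/5 remains, which is at most 1/5. Hence
  the projection of \<open>u\<close> to the functions invariant under \<open>b\<close> has at most
  1/5 of its squared norm: a cosine of 1/sqrt 5. The factor 9/40 is half of 9/20, a rational between
  1/sqrt 5 and 1/2.\<close>

lemma angle:
  assumes f: "\<And>x. x \<in> X \<Longrightarrow> f (a x) = f x" and g: "\<And>x. x \<in> X \<Longrightarrow> g (b x) = g x"
  defines "u \<equiv> \<lambda>x. f x - proj f x" and "v \<equiv> \<lambda>x. g x - proj g x"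
  shows "ip X u v \<le> 9 / 40 * (ip X u u + ip X v v)"
proof -
  have u: "u (a x) = u x" if "x \<in> X" for x using that f fixed_proj[of f] by (simp add: u_def fixed_def)
  have v: "v (b x) = v x" if "x \<in> X" for x using that g fixed_proj[of g] by (simp add: v_def fixed_def)
  define h where "h = orbit_sum b u"
  have h: "h (b x) = h x" if "x \<in> X" for x using that B.orbit_sum_inv by (simp add: h_def)
  have "5 * ip X h u = ip X (orbit_sum a h) u" by (simp add: A.ip_orbit_sum u)
  also have "\<dots> = ip X (\<lambda>x. (5 * u x - orbit_sum z u x) + 25 * proj u x) u"
    by (rule ip_cong) (simp_all add: h_def orbit_sum_a_b u)
  also have "\<dots> = 5 * ip X u u - ip X (orbit_sum z u) u + 25 * ip X (proj u) u"
    by (simp add: ip_simps)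
  also have "ip X (proj u) u = 0"
    using ip_residual[OF fixed_proj, of f u] ip_commute[of X u] by (simp add: u_def)
  also have "ip X (orbit_sum z u) u = ip X (orbit_sum z u) (orbit_sum z u) / 5"
    using Z.ip_orbit_sum[of "orbit_sum z u" u] Z.orbit_sum_inv ip_commute[of X u] by simp
  finally have "ip X h u \<le> ip X u u" using ip_nonneg[of X "orbit_sum z u"] by simp
  moreover have "ip X h h = 5 * ip X h u"
    using B.ip_orbit_sum[of h u] h ip_commute[of X h u] by (simp add: h_def)
  ultimately have hh: "ip X h h \<le> 5 * ip X u u" by simp
  \<comment> \<open>The weight 4/9 is a rational stand-in for the optimal 1/sqrt 5; it leads to 2/9
    and 9/40 on the two squared norms.\<close>
  have "0 \<le> ip X (\<lambda>x. 4 / 9 * h x - v x) (\<lambda>x. 4 / 9 * h x - v x)" by (rule ip_nonneg)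
  also have "\<dots> = 16 / 81 * ip X h h - 8 / 9 * ip X h v + ip X v v"
    unfolding ip_simps ip_commute[of X v h] by (simp add: algebra_simps)
  also have "ip X h v = 5 * ip X u v" by (simp add: h_def B.ip_orbit_sum v)
  finally have "40 / 9 * ip X u v \<le> 16 / 81 * (5 * ip X u u) + ip X v v" using hh by simp
  then show ?thesis using ip_nonneg[of X u] by simp
qed

end

section \<open>Trickling down from pairs of generators to the whole group\<close>

context kms
begin

lemma heisenberg_T:
  assumes ij: "i < 3" "j < 3" "i \<noteq> j"
  shows "heisenberg X (T i) (T j) (act T (comm_word i j))"
proof -
  define z where "z = act T (comm_word i j)"
  have w: "set (comm_word i j) \<subseteq> {..<3}" using ij by (auto simp: comm_word_def)
  have zin: "z x \<in> X" if "x \<in> X" for x using act_in[OF w that] by (simp add: z_def)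
  have zi: "z (T i x) = T i (z x)" and zj: "z (T j x) = T j (z x)" if "x \<in> X" for x
    using rel[of "comm_word i j @ [i]" "i # comm_word i j" x]
      rel[of "comm_word i j @ [j]" "j # comm_word i j" x] ij that
    by (auto simp: kms_rels_def z_def)
  have inv: "(T k ^^ 4) (T k x) = x" if "k < 3" "x \<in> X" for k x
    using T5[OF that] by (simp add: eval_nat_numeral)
  have ab: "T i (T j x) = z (T j (T i x))" if "x \<in> X" for x
    using that ij by (simp add: z_def comm_word_def act_replicate inv T_in)
  have ain: "(T i ^^ n) x \<in> X" if "x \<in> X" for n x using that ij by (induction n) (auto simp: T_in)
  have ziin: "(z ^^ n) x \<in> X" if "x \<in> X" for n x using that by (induction n) (auto simp: zin)
  have zni: "T i ((z ^^ n) x) = (z ^^ n) (T i x)" if "x \<in> X" for n x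
    using that by (induction n) (auto simp: zi[symmetric] ziin)
  \<comment> \<open>The order of the commutator is not among the relations. It follows from a^n b =
    z^n b a^n at n = 5, where both powers of a = \<open>T i\<close> are trivial.\<close>
  have abn: "(T i ^^ n) (T j x) = (z ^^ n) (T j ((T i ^^ n) x))" if x: "x \<in> X" for x n
  proof (induction n)
    case (Suc n)
    have "(T i ^^ Suc n) (T j x) = (z ^^ n) (T i (T j ((T i ^^ n) x)))"
      using Suc x ij by (simp add: zni T_in ain)
    also have "\<dots> = (z ^^ n) (z (T j ((T i ^^ Suc n) x)))" using x by (simp add: ab ain)
    also have "\<dots> = (z ^^ Suc n) (T j ((T i ^^ Suc n) x))" by (simp add: funpow_swap1)
    finally show ?case .
  qed simp
  have z5: "(z ^^ 5) y = y" if y: "y \<in> X" for y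
  proof -
    have j4: "(T j ^^ 4) y \<in> X" using act_in[of "replicate 4 j" y] y ij by (simp add: act_replicate)
    have jy: "T j ((T j ^^ 4) y) = y" using T5[OF \<open>j < 3\<close> y] by (simp add: eval_nat_numeral)
    have "T j ((T j ^^ 4) y) = (z ^^ 5) (T j ((T j ^^ 4) y))"
      using abn[OF j4, of 5] ij j4 by (simp add: T5 T_in)
    then show ?thesis using jy by simp
  qed
  show ?thesis unfolding z_def[symmetric]
    by unfold_locales (use ij in \<open>auto simp: T_in T5 zin z5 zi zj ab\<close>)
qed

text \<open>The projection onto the functions invariant under the two generators other than
  \<open>k\<close>.\<close>

definition P :: "nat \<Rightarrow> ('a \<Rightarrow> real) \<Rightarrow> 'a \<Rightarrow> real" where
  "P k = (let i = (if k = 0 then 1 else 0); j = (if k = 2 then 1 else 2) in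
     heisenberg.proj (T i) (T j) (act T (comm_word i j)))"

lemma P_cases:
  assumes "k < 3"
  obtains i j where "i < 3" "j < 3" "i \<noteq> j" "i \<noteq> k" "j \<noteq> k"
    "heisenberg X (T i) (T j) (act T (comm_word i j))"
    "P k = heisenberg.proj (T i) (T j) (act T (comm_word i j))"
    "\<And>l. l < 3 \<Longrightarrow> l \<noteq> k \<longleftrightarrow> l = i \<or> l = j"
proof -
  consider "k = 0" | "k = 1" | "k = 2" using assms by linarith
  then show ?thesis
  proof cases
    case 1
    then show ?thesis by (intro that[of 1 2] heisenberg_T) (auto simp: P_def)
  next
    case 2
    then show ?thesis by (intro that[of 0 2] heisenberg_T) (auto simp: P_def)
  next
    case 3
    then show ?thesis by (intro that[of 0 1] heisenberg_T) (auto simp: P_def)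
  qed
qed

lemma P_fixed:
  assumes "k < 3" "l < 3" "l \<noteq> k" "x \<in> X" shows "P k f (T l x) = P k f x"
proof -
  obtain i j where h: "heisenberg X (T i) (T j) (act T (comm_word i j))"
    and P: "P k = heisenberg.proj (T i) (T j) (act T (comm_word i j))" and l: "l = i \<or> l = j"
    using P_cases[OF assms(1)] assms by metis
  interpret heisenberg X "T i" "T j" "act T (comm_word i j)" by fact
  show ?thesis using fixed_proj[of f] l assms(4) by (auto simp: P fixed_def)
qed

lemma ip_P:
  assumes "k < 3" "\<And>l x. l < 3 \<Longrightarrow> l \<noteq> k \<Longrightarrow> x \<in> X \<Longrightarrow> g (T l x) = g x"
  shows "ip X (P k f) g = ip X f g"
proof -
  obtain i j where h: "heisenberg X (T i) (T j) (act T (comm_word i j))"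
    and P: "P k = heisenberg.proj (T i) (T j) (act T (comm_word i j))"
    and l: "i < 3" "j < 3" "i \<noteq> k" "j \<noteq> k"
    using P_cases[OF assms(1)] by metis
  interpret heisenberg X "T i" "T j" "act T (comm_word i j)" by fact
  have "fixed g" using assms(2) l by (simp add: fixed_def)
  then show ?thesis by (simp add: P ip_proj)
qed

lemma P_angle:
  assumes k: "k < 3" "i < 3" "j < 3" "i \<noteq> j" "i \<noteq> k" "j \<noteq> k"
    and f: "\<And>x. x \<in> X \<Longrightarrow> f (T i x) = f x" and g: "\<And>x. x \<in> X \<Longrightarrow> g (T j x) = g x"
  shows "ip X (\<lambda>x. f x - P k f x) (\<lambda>x. g x - P k g x) \<le> 9 / 40 *
    (ip X (\<lambda>x. f x - P k f x) (\<lambda>x. f x - P k f x) + ip X (\<lambda>x. g x - P k g x) (\<lambda>x. g x - P k g x))"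
proof -
  obtain i' j' where h: "heisenberg X (T i') (T j') (act T (comm_word i' j'))"
    and P: "P k = heisenberg.proj (T i') (T j') (act T (comm_word i' j'))"
    and l: "\<And>l. l < 3 \<Longrightarrow> l \<noteq> k \<longleftrightarrow> l = i' \<or> l = j'"
    using P_cases[OF assms(1)] by metis
  interpret heisenberg X "T i'" "T j'" "act T (comm_word i' j')" by fact
  consider "i = i'" "j = j'" | "i = j'" "j = i'" using l[of i] l[of j] k by blast
  then show ?thesis
  proof cases
    case 1 then show ?thesis using angle[of f g] f g by (simp add: P)
  next
    case 2 then show ?thesis using angle[of g f] f g by (simp add: P ip_commute add.commute)
  qed
qed

lemma P_add: "k < 3 \<Longrightarrow> P k (\<lambda>x. f x + g x) x = P k f x + P k g x"
proof (erule P_cases)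
  fix i j assume h: "heisenberg X (T i) (T j) (act T (comm_word i j))"
    and P: "P k = heisenberg.proj (T i) (T j) (act T (comm_word i j))"
  show ?thesis
    by (simp add: P heisenberg.proj_def[OF h] orbit_sum_def sum.distrib add_divide_distrib)
qed

lemma P_div: "k < 3 \<Longrightarrow> P k (\<lambda>x. f x / c) x = P k f x / c"
proof (erule P_cases)
  fix i j assume h: "heisenberg X (T i) (T j) (act T (comm_word i j))"
    and P: "P k = heisenberg.proj (T i) (T j) (act T (comm_word i j))"
  show ?thesis
    by (simp add: P heisenberg.proj_def[OF h] orbit_sum_def sum_divide_distrib[symmetric])
qed

lemma P_P: assumes "k < 3" "x \<in> X" shows "P k (P k f) x = P k f x"
proof -
  define r where "r x = P k (P k f) x - P k f x" for x
  have r: "r = (\<lambda>x. P k (P k f) x - P k f x)" by (simp add: r_def fun_eq_iff)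
  have "r (T l x) = r x" if "l < 3" "l \<noteq> k" "x \<in> X" for l x
    using that assms by (simp add: r_def P_fixed)
  then have "ip X (P k (P k f)) r = ip X (P k f) r" using assms by (intro ip_P) auto
  then have "ip X r r = 0" by (subst r) (simp add: ip_simps)
  then have "\<forall>x\<in>X. r x * r x = 0" unfolding ip_def by (subst (asm) sum_nonneg_eq_0_iff) auto
  then show ?thesis using assms by (simp add: r_def)
qed

text \<open>A self-adjoint averaging operator; its iterates will converge to an invariant
  function.\<close>

definition M :: "('a \<Rightarrow> real) \<Rightarrow> 'a \<Rightarrow> real" where
  "M f x = (P 0 f x + P 1 f x + P 2 f x) / 3"

lemma ip_M: "ip X (M f) g = (ip X (P 0 f) g + ip X (P 1 f) g + ip X (P 2 f) g) / 3"
proof -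
  have "M f = (\<lambda>x. (P 0 f x + P 1 f x + P 2 f x) / 3)" by (simp add: M_def fun_eq_iff)
  then show ?thesis by (simp add: ip_simps)
qed

lemma ip_P_P: "k < 3 \<Longrightarrow> ip X (P k f) (P k g) = ip X f (P k g)"
  by (rule ip_P) (auto simp: P_fixed)

lemma ip_P_sym: "k < 3 \<Longrightarrow> ip X (P k f) g = ip X f (P k g)"
  using ip_P_P[of k f g] ip_P_P[of k g f] by (simp add: ip_commute)

lemma ip_residual_P:
  assumes "k < 3"
  shows "ip X (\<lambda>x. f x - P k f x) (\<lambda>x. g x - P k g x) = ip X f g - ip X (P k f) (P k g)"
proof -
  have "ip X (P k f) g = ip X (P k f) (P k g)"
    using ip_P_sym[OF assms] ip_P_P[OF assms] by simp
  then show ?thesis by (simp add: ip_simps ip_P_P[OF assms])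
qed

text \<open>
  The trickling-down step: the components of \<open>P i g\<close> and \<open>P j g\<close> orthogonal to the range of \<open>P k\<close>
  are each invariant under one generator, so \<open>P_angle\<close> applies to them.  The constant \<open>29/33\<close> below is
  \<open>(1 + 2\<mu>) / 3\<close> for \<open>\<mu> = \<lambda> / (1 - \<lambda>)\<close> and \<open>\<lambda> = 9/20\<close>.
\<close>

lemma trickle_pair:
  assumes k: "k < 3" "i < 3" "j < 3" "i \<noteq> j" "i \<noteq> k" "j \<noteq> k"
    and M: "\<And>x. 3 * M g x = P i g x + P j g x + P k g x"
  shows "ip X (P i g) (P j g) \<le> 11 / 80 * (9 * ip X (P k (M g)) (M g) - 6 * ip X (P k g) (M g)
    + ip X (P k g) (P k g)) + 9 / 40 * (ip X (P i g) (P i g) + ip X (P j g) (P j g))"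
proof -
  define fi fj where f: "fi = P i g" "fj = P j g"
  have "ip X (\<lambda>x. fi x - P k fi x) (\<lambda>x. fj x - P k fj x) \<le> 9 / 40 *
    (ip X (\<lambda>x. fi x - P k fi x) (\<lambda>x. fi x - P k fi x) + ip X (\<lambda>x. fj x - P k fj x) (\<lambda>x. fj x - P k fj x))"
    using P_angle[of k j i fi fj] k by (simp add: f P_fixed)
  then have 1: "ip X fi fj - ip X (P k fi) (P k fj) \<le> 9 / 40 *
    (ip X fi fi - ip X (P k fi) (P k fi) + (ip X fj fj - ip X (P k fj) (P k fj)))"
    unfolding ip_residual_P[OF k(1)] .
  have "P k fi x + P k fj x = 3 * P k (M g) x - P k g x" if "x \<in> X" for x
  proof -
    have "P k (M g) x = P k (\<lambda>x. (fi x + fj x + P k g x) / 3) x"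
    proof -
      have "M g = (\<lambda>x. (fi x + fj x + P k g x) / 3)" using M by (simp add: fun_eq_iff f field_simps)
      then show ?thesis by simp
    qed
    then show ?thesis using k that by (simp add: P_div P_add P_P)
  qed
  then have *: "ip X (\<lambda>x. P k fi x + P k fj x) (\<lambda>x. P k fi x + P k fj x) =
    ip X (\<lambda>x. 3 * P k (M g) x - P k g x) (\<lambda>x. 3 * P k (M g) x - P k g x)"
    by (intro ip_cong) auto
  have 2: "ip X (P k fi) (P k fi) + ip X (P k fj) (P k fj) + 2 * ip X (P k fi) (P k fj) =
    9 * ip X (P k (M g)) (M g) - 6 * ip X (P k g) (M g) + ip X (P k g) (P k g)"
  proof -
    have c: "ip X (P k (M g)) (P k (M g)) = ip X (P k (M g)) (M g)"
      "ip X (P k (M g)) (P k g) = ip X (P k g) (M g)" "ip X (P k g) (P k (M g)) = ip X (P k g) (M g)"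
      using k(1) by (metis ip_P_P ip_commute)+
    from * show ?thesis
      unfolding ip_simps c ip_commute[of X "P k fj" "P k fi"] by simp
  qed
  \<comment> \<open>With \<lambda> = 9/20 the coefficient 11/80 is (1 - \<lambda>) / 4, exactly the
    value for which combining 1 and 2 comes down to this inequality.\<close>
  have 3: "2 * ip X (P k fi) (P k fj) \<le> ip X (P k fi) (P k fi) + ip X (P k fj) (P k fj)"
    using ip_nonneg[of X "\<lambda>x. P k fi x - P k fj x"]
    by (simp add: ip_simps ip_commute[of X "P k fj" "P k fi"])
  show ?thesis using 1 2 3 unfolding f[symmetric] by argo
qed

text \<open>Sum \<open>trickle_pair\<close> over the three pairs. Spectrally: the operator
  \<open>M\<close> has no eigenvalue strictly between 29/33 and 1, expressed here as a comparison of
  the quadratic forms of M^2 (1 - M) and M (1 - M).\<close>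

lemma trickle:
  "33 * (ip X (M g) (M g) - ip X (M (M g)) (M g)) \<le> 29 * (ip X (M g) g - ip X (M g) (M g))"
proof -
  have n: "ip X (P k g) (P k g) = ip X (P k g) g" if "k < 3" for k
    using ip_P_P[OF that, of g g] ip_commute[of X g "P k g"] by simp
  have mm: "9 * ip X (M g) (M g) = ip X (P 0 g) g + ip X (P 1 g) g + ip X (P 2 g) g
    + 2 * (ip X (P 0 g) (P 1 g) + ip X (P 0 g) (P 2 g) + ip X (P 1 g) (P 2 g))"
  proof -
    have "M g = (\<lambda>x. (P 0 g x + P 1 g x + P 2 g x) / 3)" by (simp add: M_def fun_eq_iff)
    then have "9 * ip X (M g) (M g) =
      ip X (\<lambda>x. P 0 g x + P 1 g x + P 2 g x) (\<lambda>x. P 0 g x + P 1 g x + P 2 g x)"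
      by (simp add: ip_div_left ip_div_right)
    then show ?thesis
      unfolding ip_simps ip_commute[of X "P 1 g" "P 0 g"] ip_commute[of X "P 2 g" "P 0 g"]
        ip_commute[of X "P 2 g" "P 1 g"] by (simp add: n)
  qed
  have "ip X (P 0 g) (P 1 g) \<le> 11 / 80 * (9 * ip X (P 2 (M g)) (M g) - 6 * ip X (P 2 g) (M g)
    + ip X (P 2 g) (P 2 g)) + 9 / 40 * (ip X (P 0 g) (P 0 g) + ip X (P 1 g) (P 1 g))"
    by (rule trickle_pair) (simp_all add: M_def)
  moreover have "ip X (P 0 g) (P 2 g) \<le> 11 / 80 * (9 * ip X (P 1 (M g)) (M g) - 6 * ip X (P 1 g) (M g)
    + ip X (P 1 g) (P 1 g)) + 9 / 40 * (ip X (P 0 g) (P 0 g) + ip X (P 2 g) (P 2 g))"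
    by (rule trickle_pair) (simp_all add: M_def)
  moreover have "ip X (P 1 g) (P 2 g) \<le> 11 / 80 * (9 * ip X (P 0 (M g)) (M g) - 6 * ip X (P 0 g) (M g)
    + ip X (P 0 g) (P 0 g)) + 9 / 40 * (ip X (P 1 g) (P 1 g) + ip X (P 2 g) (P 2 g))"
    by (rule trickle_pair) (simp_all add: M_def)
  moreover have "3 * ip X (M g) g = ip X (P 0 g) g + ip X (P 1 g) g + ip X (P 2 g) g"
    "3 * ip X (M g) (M g) = ip X (P 0 g) (M g) + ip X (P 1 g) (M g) + ip X (P 2 g) (M g)"
    "3 * ip X (M (M g)) (M g) = ip X (P 0 (M g)) (M g) + ip X (P 1 (M g)) (M g) + ip X (P 2 (M g)) (M g)"
    by (simp_all add: ip_M)
  moreover have "ip X (P 0 g) (P 0 g) = ip X (P 0 g) g" "ip X (P 1 g) (P 1 g) = ip X (P 1 g) g"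
    "ip X (P 2 g) (P 2 g) = ip X (P 2 g) g" by (simp_all add: n)
  moreover note mm
  ultimately show ?thesis by argo
qed

definition energy :: "('a \<Rightarrow> real) \<Rightarrow> real" where
  "energy g = ip X (M g) g - ip X (M g) (M g)"

text \<open>The energy is the variance of the three projections at \<open>g\<close>, so small energy
  forces every \<open>P k g\<close> to be close to \<open>M g\<close>.\<close>

lemma energy_eq:
  "3 * energy g = (\<Sum>k<3. ip X (\<lambda>x. P k g x - M g x) (\<lambda>x. P k g x - M g x))"
proof -
  have n: "ip X (P k g) (P k g) = ip X (P k g) g" if "k < 3" for k
    using ip_P_P[OF that, of g g] ip_commute[of X g "P k g"] by simp
  have "3 * ip X (M g) g = ip X (P 0 g) g + ip X (P 1 g) g + ip X (P 2 g) g"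
    "3 * ip X (M g) (M g) = ip X (P 0 g) (M g) + ip X (P 1 g) (M g) + ip X (P 2 g) (M g)"
    by (simp_all add: ip_M)
  moreover have "ip X (\<lambda>x. P k g x - M g x) (\<lambda>x. P k g x - M g x) =
      ip X (P k g) g - 2 * ip X (P k g) (M g) + ip X (M g) (M g)" if "k < 3" for k
    unfolding ip_simps n[OF that] ip_commute[of X "M g" "P k g"] by simp
  moreover have "{..<3} = {0, 1, 2 :: nat}" by auto
  ultimately show ?thesis unfolding energy_def by simp
qed

lemma energy_nonneg: "0 \<le> energy g"
proof -
  have "0 \<le> 3 * energy g" unfolding energy_eq by (intro sum_nonneg ip_nonneg)
  then show ?thesis by simp
qed

text \<open>The energy of \<open>M g\<close> and the squared step from \<open>M g\<close> to
  \<open>M (M g)\<close> are non-negative, and \<open>trickle\<close> bounds their sum.\<close>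

lemma energy_M: "energy (M g) \<le> 29 / 33 * energy g"
  and dist_M: "ip X (\<lambda>x. M g x - M (M g) x) (\<lambda>x. M g x - M (M g) x) \<le> 29 / 33 * energy g"
proof -
  have d: "ip X (\<lambda>x. M g x - M (M g) x) (\<lambda>x. M g x - M (M g) x) =
      (ip X (M g) (M g) - ip X (M (M g)) (M g)) - energy (M g)"
    unfolding ip_simps energy_def ip_commute[of X "M g" "M (M g)"] by simp
  show "energy (M g) \<le> 29 / 33 * energy g"
    using d ip_nonneg[of X "\<lambda>x. M g x - M (M g) x"] trickle[of g] by (simp add: energy_def[of g])
  show "ip X (\<lambda>x. M g x - M (M g) x) (\<lambda>x. M g x - M (M g) x) \<le> 29 / 33 * energy g"
    using d energy_nonneg[of "M g"] trickle[of g] by (simp add: energy_def[of g])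
qed

section \<open>Property (T) as approximation by invariant functions\<close>

abbreviation nrm :: "('a \<Rightarrow> real) \<Rightarrow> real" where "nrm f \<equiv> L2_set f X"

lemma nrm_comp: assumes "bij_betw h X X" shows "nrm (\<lambda>x. f (h x)) = nrm f"
  unfolding L2_set_def using sum.reindex_bij_betw[OF assms, of "\<lambda>x. (f x)\<^sup>2"] by simp

lemma nrm_add: "nrm (\<lambda>x. f x + g x) \<le> nrm f + nrm g"
  by (rule L2_set_triangle_ineq)

lemma nrm_sum: "finite I \<Longrightarrow> nrm (\<lambda>x. \<Sum>i\<in>I. f i x) \<le> (\<Sum>i\<in>I. nrm (f i))"
proof (induction I rule: finite_induct)
  case (insert i I)
  then show ?case using nrm_add[of "f i" "\<lambda>x. \<Sum>i\<in>I. f i x"] by simp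
qed (simp add: L2_set_def)

lemma nrm_ip: "nrm f = sqrt (ip X f f)"
  by (simp add: L2_set_def ip_def power2_eq_square)

lemma nrm_act:
  fixes \<delta> :: real
  assumes "\<And>i. i < 3 \<Longrightarrow> nrm (\<lambda>x. f x - f (T i x)) \<le> \<delta>" "set w \<subseteq> {..<3}"
  shows "nrm (\<lambda>x. f x - f (act T w x)) \<le> length w * \<delta>"
  using assms(2)
proof (induction w)
  case Nil then show ?case by (simp add: L2_set_def)
next
  case (Cons i w)
  have "nrm (\<lambda>x. f x - f (act T (i # w) x)) =
      nrm (\<lambda>x. (f x - f (act T w x)) + (f (act T w x) - f (T i (act T w x))))" by simp
  also have "\<dots> \<le> nrm (\<lambda>x. f x - f (act T w x)) + nrm (\<lambda>x. f (act T w x) - f (T i (act T w x)))"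
    by (rule nrm_add)
  also have "nrm (\<lambda>x. f (act T w x) - f (T i (act T w x))) = nrm (\<lambda>x. f x - f (T i x))"
    using Cons.prems by (intro nrm_comp[of "act T w" "\<lambda>x. f x - f (T i x)"] bij_act) auto
  finally show ?case using Cons assms(1)[of i] by (simp add: algebra_simps)
qed

lemma nrm_P:
  assumes d: "\<And>i. i < 3 \<Longrightarrow> nrm (\<lambda>x. f x - f (T i x)) \<le> \<delta>" and k: "k < 3"
  shows "nrm (\<lambda>x. f x - P k f x) \<le> 48 * \<delta>"
proof -
  obtain i j where ij: "i < 3" "j < 3" and h: "heisenberg X (T i) (T j) (act T (comm_word i j))"
    and P: "P k = heisenberg.proj (T i) (T j) (act T (comm_word i j))"
    using P_cases[OF k] by metis
  define wd where "wd q r m = concat (replicate m (comm_word i j)) @ replicate q i @ replicate r j"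
    for q r m
  have d0: "0 \<le> \<delta>" using d[of 0] order_trans[OF L2_set_nonneg] by simp
  have "nrm (\<lambda>x. f x - P k f x) = nrm (\<lambda>x. \<Sum>r<5. \<Sum>q<5. \<Sum>m<5. (f x - f (act T (wd q r m) x)) / 125)"
    by (rule arg_cong2[where f = L2_set])
      (simp_all add: fun_eq_iff P heisenberg.proj_def[OF h] orbit_sum_def sum_subtractf
        sum_divide_distrib diff_divide_distrib wd_def act_replicate act_concat_replicate)
  also have "\<dots> \<le> (\<Sum>r<5. \<Sum>q<5. \<Sum>m<5. nrm (\<lambda>x. (f x - f (act T (wd q r m) x)) / 125))"
    by (rule order_trans[OF nrm_sum] sum_mono finite_lessThan)+ simp
  also have "\<dots> \<le> (\<Sum>r<5::nat. \<Sum>q<5::nat. \<Sum>m<5::nat. 48 * \<delta> / 125)"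
  proof (intro sum_mono)
    fix r q m :: nat assume "r \<in> {..<5}" "q \<in> {..<5}" "m \<in> {..<5}"
    \<comment> \<open>At most 4 commutators of length 10 and 4 letters for each of the two
      generators: 40 + 4 + 4.\<close>
    then have l: "length (wd q r m) \<le> 48"
      by (simp add: wd_def length_concat sum_list_replicate comm_word_def)
    have "set (wd q r m) \<subseteq> {..<3}" using ij by (auto simp: wd_def comm_word_def)
    then have "nrm (\<lambda>x. f x - f (act T (wd q r m) x)) \<le> length (wd q r m) * \<delta>"
      by (intro nrm_act[OF d])
    also have "\<dots> \<le> 48 * \<delta>" using l d0 by (intro mult_right_mono) auto
    finally have "nrm (\<lambda>x. f x - f (act T (wd q r m) x)) / 125 \<le> 48 * \<delta> / 125" by simp
    moreover have "nrm (\<lambda>x. (f x - f (act T (wd q r m) x)) / 125) =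
        nrm (\<lambda>x. f x - f (act T (wd q r m) x)) / 125"
      using L2_set_left_distrib[of "1/125" "\<lambda>x. f x - f (act T (wd q r m) x)" X] by simp
    ultimately show "nrm (\<lambda>x. (f x - f (act T (wd q r m) x)) / 125) \<le> 48 * \<delta> / 125" by simp
  qed
  also have "\<dots> = 48 * \<delta>" by simp
  finally show ?thesis .
qed

text \<open>Property (T) in quantitative form, with a constant that does not depend on the action.
  Along the iterates of \<open>M\<close> the energy decays like (29/33)^n and controls the squared
  steps, so they converge at a distance from \<open>f\<close> proportional to \<delta>.\<close>

lemma invariant_approx:
  assumes d: "\<And>i. i < 3 \<Longrightarrow> nrm (\<lambda>x. f x - f (T i x)) \<le> \<delta>"
  shows "\<exists>g. (\<forall>i<3. \<forall>x\<in>X. g (T i x) = g x) \<and> nrm (\<lambda>x. f x - g x) \<le> 2000 * \<delta>"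
proof -
  have d0: "0 \<le> \<delta>" using d[of 0] order_trans[OF L2_set_nonneg] by simp
  define \<rho> :: real where "\<rho> = 29 / 33"
  define r where "r = sqrt \<rho>"
  \<comment> \<open>\<open>r\<close> is about 0.937; the bound 24/25 turns the geometric series into
    the factor 25.\<close>
  have r: "0 < r" "r \<le> 24 / 25" unfolding r_def \<rho>_def
    by (simp, rule real_le_lsqrt) (simp_all add: power2_eq_square)
  have r2: "r ^ n = sqrt (\<rho> ^ n)" for n by (simp add: r_def real_sqrt_power)
  define G where "G n = (M ^^ n) f" for n
  have G0: "G 0 = f" and GS: "G (Suc n) = M (G n)" for n by (simp_all add: G_def)
  have fP: "nrm (\<lambda>x. f x - P k f x) \<le> 48 * \<delta>" if "k < 3" for k by (rule nrm_P[OF d that])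
  have fM: "nrm (\<lambda>x. f x - M f x) \<le> 48 * \<delta>"
  proof -
    have "nrm (\<lambda>x. f x - M f x) = nrm (\<lambda>x. \<Sum>k<3. (f x - P k f x) / 3)"
      by (rule arg_cong2[where f = L2_set]) (auto simp: M_def fun_eq_iff lessThan_Suc eval_nat_numeral field_simps)
    also have "\<dots> \<le> (\<Sum>k<3. nrm (\<lambda>x. (f x - P k f x) / 3))" by (rule nrm_sum) simp
    also have "\<dots> \<le> (\<Sum>k<3::nat. 16 * \<delta>)"
    proof (intro sum_mono)
      fix k :: nat assume "k \<in> {..<3}"
      then show "nrm (\<lambda>x. (f x - P k f x) / 3) \<le> 16 * \<delta>"
        using L2_set_left_distrib[of "1/3" "\<lambda>x. f x - P k f x" X] fP[of k] by simp
    qed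
    finally show ?thesis by simp
  qed
  have en: "energy (G n) \<le> \<rho> ^ n * energy f" for n
  proof (induction n)
    case (Suc n)
    have "energy (G (Suc n)) \<le> \<rho> * energy (G n)" unfolding GS \<rho>_def by (rule energy_M)
    also have "\<dots> \<le> \<rho> * (\<rho> ^ n * energy f)" using Suc by (simp add: \<rho>_def)
    finally show ?case by simp
  qed (simp add: G0)
  have e0: "energy f \<le> (48 * \<delta>)\<^sup>2"
  proof -
    have "ip X (\<lambda>x. f x - M f x) (\<lambda>x. f x - M f x) = ip X f f - 2 * ip X (M f) f + ip X (M f) (M f)"
      unfolding ip_simps ip_commute[of X f "M f"] by simp
    then have "energy f = (ip X f f - ip X (M f) f) - ip X (\<lambda>x. f x - M f x) (\<lambda>x. f x - M f x)"
      unfolding energy_def by simp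
    also have "\<dots> \<le> ip X f f - ip X (M f) f" using ip_nonneg[of X "\<lambda>x. f x - M f x"] by simp
    also have "\<dots> = (\<Sum>k<3. ip X (\<lambda>x. f x - P k f x) (\<lambda>x. f x - P k f x)) / 3"
    proof -
      have "ip X (\<lambda>x. f x - P k f x) (\<lambda>x. f x - P k f x) = ip X f f - ip X (P k f) f" if "k < 3" for k
        unfolding ip_residual_P[OF that] ip_P_P[OF that] by (simp add: ip_commute)
      moreover have "{..<3} = {0, 1, 2 :: nat}" by auto
      ultimately show ?thesis by (simp add: ip_M) (simp add: field_simps)
    qed
    also have "\<dots> \<le> (\<Sum>k<3::nat. (48 * \<delta>)\<^sup>2) / 3"
    proof (intro divide_right_mono sum_mono)
      fix k :: nat assume "k \<in> {..<3}"
      then show "ip X (\<lambda>x. f x - P k f x) (\<lambda>x. f x - P k f x) \<le> (48 * \<delta>)\<^sup>2"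
        using fP[of k] unfolding nrm_ip by (intro sqrt_le_D) simp
    qed simp
    finally show ?thesis by simp
  qed
  have step: "nrm (\<lambda>x. G (Suc n) x - G (Suc (Suc n)) x) \<le> r ^ n * (48 * \<delta>)" for n
  proof -
    have "ip X (\<lambda>x. G (Suc n) x - G (Suc (Suc n)) x) (\<lambda>x. G (Suc n) x - G (Suc (Suc n)) x)
        \<le> \<rho> * energy (G n)" unfolding GS \<rho>_def by (rule dist_M)
    also have "\<dots> \<le> energy (G n)" using energy_nonneg[of "G n"] by (simp add: \<rho>_def)
    also have "\<dots> \<le> \<rho> ^ n * (48 * \<delta>)\<^sup>2"
      by (rule order_trans[OF en mult_left_mono[OF e0]]) (simp add: \<rho>_def)
    finally have "nrm (\<lambda>x. G (Suc n) x - G (Suc (Suc n)) x) \<le> sqrt (\<rho> ^ n * (48 * \<delta>)\<^sup>2)"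
      unfolding nrm_ip by (rule real_sqrt_le_mono)
    also have "\<dots> = r ^ n * (48 * \<delta>)" using d0 by (simp add: real_sqrt_mult r2)
    finally show ?thesis .
  qed
  have pt: "\<bar>h x\<bar> \<le> nrm h" if "x \<in> X" for h x
  proof -
    have "\<bar>h x\<bar> \<le> L2_set (\<lambda>x. \<bar>h x\<bar>) X" using that by (intro member_le_L2_set) auto
    then show ?thesis by (simp add: L2_set_def)
  qed
  have dist: "nrm (\<lambda>x. f x - G (Suc n) x) \<le> 48 * \<delta> + (\<Sum>i<n. r ^ i * (48 * \<delta>))" for n
  proof (induction n)
    case 0 then show ?case using fM by (simp add: GS G0)
  next
    case (Suc n)
    have "nrm (\<lambda>x. f x - G (Suc (Suc n)) x) =
        nrm (\<lambda>x. (f x - G (Suc n) x) + (G (Suc n) x - G (Suc (Suc n)) x))" by simp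
    also have "\<dots> \<le> nrm (\<lambda>x. f x - G (Suc n) x) + nrm (\<lambda>x. G (Suc n) x - G (Suc (Suc n)) x)"
      by (rule nrm_add)
    finally show ?case using Suc step[of n] by simp
  qed
  have geo: "(\<Sum>i<n. r ^ i * (48 * \<delta>)) \<le> 1200 * \<delta>" for n
  proof -
    have "(\<Sum>i<n. r ^ i) \<le> 25"
    proof -
      have "(1 - r) * (\<Sum>i<n. r ^ i) = 1 - r ^ n" by (rule one_diff_power_eq[symmetric])
      also have "\<dots> \<le> 1" using r by simp
      also have "1 \<le> (1 - r) * 25" using r by simp
      finally show ?thesis by (rule mult_left_le_imp_le) (use r in simp)
    qed
    then have "(\<Sum>i<n. r ^ i) * (48 * \<delta>) \<le> 25 * (48 * \<delta>)" using d0 by (intro mult_right_mono) auto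
    then show ?thesis by (simp add: sum_distrib_right)
  qed
  define g where "g x = lim (\<lambda>n. G (Suc n) x)" for x
  have lim: "(\<lambda>n. G (Suc n) x) \<longlonglongrightarrow> g x" if x: "x \<in> X" for x
  proof -
    have "summable (\<lambda>n. G (Suc (Suc n)) x - G (Suc n) x)"
    proof (rule summable_comparison_test')
      show "summable (\<lambda>n. r ^ n * (48 * \<delta>))" using r by (intro summable_mult2 summable_geometric) auto
      show "norm (G (Suc (Suc n)) x - G (Suc n) x) \<le> r ^ n * (48 * \<delta>)" for n
        using pt[OF x, of "\<lambda>x. G (Suc n) x - G (Suc (Suc n)) x"] step[of n] by (simp add: abs_minus_commute)
    qed
    then obtain l where "(\<lambda>n. \<Sum>m<n. G (Suc (Suc m)) x - G (Suc m) x) \<longlonglongrightarrow> l"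
      by (auto simp: summable_def sums_def)
    then have "(\<lambda>n. G (Suc n) x - G (Suc 0) x) \<longlonglongrightarrow> l"
      by (simp add: sum_lessThan_telescope[of "\<lambda>n. G (Suc n) x"])
    from tendsto_add[OF this tendsto_const[of "G (Suc 0) x"]]
    have "convergent (\<lambda>n. G (Suc n) x)" by (auto simp: convergent_def)
    then show ?thesis unfolding g_def by (simp add: convergent_LIMSEQ_iff)
  qed
  have inv: "g (T i x) = g x" if i: "i < 3" and x: "x \<in> X" for i x
  proof -
    \<comment> \<open>Any \<open>k\<close> other than \<open>i\<close> will do: \<open>P k\<close>
      takes values invariant under \<open>T i\<close>, and along the iteration its values have the
      same limit as those of \<open>M\<close> because the energy tends to 0.\<close>
    define k where "k = (if i = 0 then 1 else 0 :: nat)"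
    have k: "k < 3" "i \<noteq> k" by (auto simp: k_def)
    have conv: "(\<lambda>n. P k (G n) y - M (G n) y) \<longlonglongrightarrow> 0" if y: "y \<in> X" for y
    proof (rule Lim_null_comparison)
      show "\<forall>\<^sub>F n in sequentially. norm (P k (G n) y - M (G n) y) \<le> r ^ n * sqrt (3 * energy f)"
      proof (intro always_eventually allI)
        fix n
        have "ip X (\<lambda>x. P k (G n) x - M (G n) x) (\<lambda>x. P k (G n) x - M (G n) x) \<le> 3 * energy (G n)"
          unfolding energy_eq using k by (intro member_le_sum) (auto intro: ip_nonneg)
        also have "\<dots> \<le> \<rho> ^ n * (3 * energy f)" using en[of n] by simp
        finally have "nrm (\<lambda>x. P k (G n) x - M (G n) x) \<le> sqrt (\<rho> ^ n * (3 * energy f))"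
          unfolding nrm_ip by (rule real_sqrt_le_mono)
        then show "norm (P k (G n) y - M (G n) y) \<le> r ^ n * sqrt (3 * energy f)"
          using pt[OF y, of "\<lambda>x. P k (G n) x - M (G n) x"] by (simp add: r2 real_sqrt_mult)
      qed
      show "(\<lambda>n. r ^ n * sqrt (3 * energy f)) \<longlonglongrightarrow> 0"
        using r by (intro tendsto_mult_left_zero LIMSEQ_power_zero) auto
    qed
    have conv': "(\<lambda>n. P k (G n) y) \<longlonglongrightarrow> g y" if "y \<in> X" for y
      using tendsto_add[OF conv[OF that] lim[OF that, unfolded GS]] by simp
    have "(\<lambda>n. P k (G n) x) \<longlonglongrightarrow> g (T i x)"
      using conv'[OF T_in[OF i x]] k i x by (simp add: P_fixed)
    then show ?thesis using conv'[OF x] LIMSEQ_unique by blast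
  qed
  have "(\<lambda>n. nrm (\<lambda>x. f x - G (Suc n) x)) \<longlonglongrightarrow> nrm (\<lambda>x. f x - g x)"
    unfolding L2_set_def by (intro tendsto_intros lim)
  \<comment> \<open>48 for the first step from \<open>f\<close> to \<open>M f\<close>, and 25 * 48
    for all later ones.\<close>
  then have "nrm (\<lambda>x. f x - g x) \<le> 48 * \<delta> + 1200 * \<delta>"
    by (rule LIMSEQ_le_const2) (use dist geo in \<open>meson add_left_mono order_trans\<close>)
  also have "\<dots> \<le> 2000 * \<delta>" using d0 by simp
  finally show ?thesis using inv by blast
qed

end

section \<open>Encoding actions as graphs\<close>

text \<open>
  A point \<open>e\<close> becomes a gadget with ten vertices \<open>vtx e 0, \<dots>, vtx e 9\<close>.  Vertex 0 is the centre,
  adjacent to the other nine; 1, 2, 3 are the outgoing and 4, 5, 6 the incoming ports of the three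
  generators, and \<open>vtx e (i + 1)\<close> is joined to \<open>vtx (T i e) (i + 4)\<close>.  The vertices 7, 8, 9 only serve to
  give the ports 1, 2, 3 the degrees 3, 4, 5, while incoming ports have degree 2 and centres
  degree 9.  Edges to points outside \<open>{..<N}\<close> are dropped.
\<close>

definition vtx :: "nat \<Rightarrow> nat \<Rightarrow> nat" where "vtx e j = Suc (10 * e + j)"

definition gnb :: "nat \<Rightarrow> nat list" where
  "gnb j = [[1, 2, 3, 4, 5, 6, 7, 8, 9], [0, 7], [0, 7, 8], [0, 7, 8, 9], [0], [0], [0],
    [0, 1, 2, 3, 8, 9], [0, 2, 3, 7, 9], [0, 3, 7, 8]] ! j"

definition is_port :: "nat \<Rightarrow> bool" where "is_port j \<longleftrightarrow> 1 \<le> j \<and> j \<le> 6"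

text \<open>Leads from a point to the point at the other end of its port: incoming ports go
  backwards, by a fourth power. The empty word at the other vertices makes \<open>act\<close> stay
  at the point.\<close>

definition port_word :: "nat \<Rightarrow> nat list" where
  "port_word j = (if is_port j then if j \<le> 3 then [j - 1] else replicate 4 (j - 4) else [])"

definition port_opp :: "nat \<Rightarrow> nat" where
  "port_opp j = (if j \<le> 3 then j + 3 else j - 3)"

text \<open>The point \<open>e'\<close> across the port is a separate argument because it is all
  that a query can reveal about the action. A value \<open>e' \<ge> N\<close> stands for a deleted
  point and yields no edge.\<close>

definition adjl_of :: "nat \<Rightarrow> nat \<Rightarrow> nat \<Rightarrow> nat \<Rightarrow> nat list" where
  "adjl_of N e' e j = map (vtx e) (gnb j) @ (if is_port j \<and> e' < N then [vtx e' (port_opp j)] else [])"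

definition adjl :: "nat \<Rightarrow> (nat \<Rightarrow> nat \<Rightarrow> nat) \<Rightarrow> nat \<Rightarrow> nat list" where
  "adjl N T v = (let e = (v - 1) div 10; j = (v - 1) mod 10
     in adjl_of N (act T (port_word j) e) e j)"

definition enc :: "nat \<Rightarrow> (nat \<Rightarrow> nat \<Rightarrow> nat) \<Rightarrow> nat ugraph" where
  "enc N T = \<lparr>verts = {1..10 * N}, edges = {e. \<exists>v\<in>{1..10 * N}. \<exists>w\<in>set (adjl N T v). e = {v, w}}\<rparr>"

lemma vtx_inj [simp]: "j < 10 \<Longrightarrow> j' < 10 \<Longrightarrow> vtx e j = vtx e' j' \<longleftrightarrow> e = e' \<and> j = j'"
  unfolding vtx_def by presburger

lemma vtx_le [simp]: "j < 10 \<Longrightarrow> vtx e j \<le> 10 * N \<longleftrightarrow> e < N" "Suc 0 \<le> vtx e j"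
  unfolding vtx_def by presburger+

lemma vtx_in: "j < 10 \<Longrightarrow> vtx e j \<in> {1..10 * N} \<longleftrightarrow> e < N"
  by simp

lemma vtxE:
  assumes "v \<in> {1..10 * N}"
  obtains e j where "e < N" "j < 10" "v = vtx e j"
proof
  show "(v - 1) div 10 < N" "(v - 1) mod 10 < 10" "v = vtx ((v - 1) div 10) ((v - 1) mod 10)"
    using assms unfolding vtx_def by auto
qed

lemma less_10_cases: "j < 10 \<longleftrightarrow> j \<in> {0, 1, 2, 3, 4, 5, 6, 7, 8, 9 :: nat}"
  by auto

lemma gnb_simps [simp]:
  "gnb 0 = [1, 2, 3, 4, 5, 6, 7, 8, 9]" "gnb 1 = [0, 7]" "gnb (Suc 0) = [0, 7]" "gnb 2 = [0, 7, 8]"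
  "gnb 3 = [0, 7, 8, 9]" "gnb 4 = [0]" "gnb 5 = [0]" "gnb 6 = [0]"
  "gnb 7 = [0, 1, 2, 3, 8, 9]" "gnb 8 = [0, 2, 3, 7, 9]" "gnb 9 = [0, 3, 7, 8]"
  by (simp_all add: gnb_def nth_Cons')

lemma gnb_facts:
  assumes "j < 10"
  shows "distinct (gnb j)" "set (gnb j) \<subseteq> {..<10}" "j \<notin> set (gnb j)" "length (gnb j) \<le> 9"
    "is_port j \<Longrightarrow> length (gnb j) \<le> 4" "is_port j \<Longrightarrow> set (gnb j) \<subseteq> {0, 7, 8, 9}"
    "k \<in> set (gnb j) \<Longrightarrow> j \<in> set (gnb k)"
  using assms unfolding less_10_cases is_port_def by auto

lemma port_facts:
  assumes "is_port j"
  shows "j < 10" "is_port (port_opp j)" "port_opp (port_opp j) = j" "port_opp j \<noteq> j" "port_opp j < 10"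
    "set (port_word j) \<subseteq> {..<3}" "length (port_word j) \<le> 4"
  using assms unfolding is_port_def port_opp_def port_word_def by auto

lemma port_word_set: "set (port_word j) \<subseteq> {..<3}" "length (port_word j) \<le> 4"
  unfolding is_port_def port_opp_def port_word_def by auto

lemma adjl_vtx: "j < 10 \<Longrightarrow> adjl N T (vtx e j) = adjl_of N (act T (port_word j) e) e j"
  by (simp add: adjl_def vtx_def)

lemma distinct_adjl: assumes "j < 10" shows "distinct (adjl N T (vtx e j))"
proof -
  have "inj_on (vtx e) (set (gnb j))"
    using gnb_facts(2)[OF assms] by (intro inj_onI) (auto simp: subset_iff)
  moreover have "vtx e' (port_opp j) \<notin> vtx e ` set (gnb j)" if "is_port j" for e'
    using that gnb_facts(6)[OF assms that] port_facts(2,5)[OF that]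
    by (auto simp: is_port_def subset_iff image_iff)
  ultimately show ?thesis
    using gnb_facts(1)[OF assms] by (auto simp: adjl_vtx[OF assms] adjl_of_def distinct_map)
qed

lemma length_adjl:
  "j < 10 \<Longrightarrow> length (adjl N T (vtx e j)) =
     length (gnb j) + (if is_port j \<and> act T (port_word j) e < N then 1 else 0)"
  by (simp add: adjl_vtx adjl_of_def)

text \<open>The action has \<open>N'\<close> points and the first \<open>N\<close> are drawn:
  \<open>N' = N\<close> for a complete encoding, \<open>N' = Suc N\<close> for the punctured
  one.\<close>

locale enc_action = kms T "{..<N'}" for T :: "nat \<Rightarrow> nat \<Rightarrow> nat" and N' +
  fixes N :: nat assumes NN': "N \<le> N'"
begin

lemma port_inv: assumes "is_port j" "e < N'"
  shows "act T (port_word (port_opp j)) (act T (port_word j) e) = e"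
proof -
  define i where "i = (if j \<le> 3 then j - 1 else j - 4)"
  have i: "i < 3" using assms(1) by (auto simp: i_def is_port_def)
  have "port_word j = [i] \<and> port_word (port_opp j) = replicate 4 i \<or>
    port_word j = replicate 4 i \<and> port_word (port_opp j) = [i]"
    using assms(1) unfolding port_word_def port_opp_def is_port_def i_def by auto
  then have "act T (port_word (port_opp j)) (act T (port_word j) e) = (T i ^^ 5) e"
    by (elim disjE conjE) (simp_all add: act_replicate numeral_eq_Suc)
  then show ?thesis using T5[OF i] assms by simp
qed

lemma adjl_sym:
  assumes "v \<in> {1..10 * N}" "w \<in> set (adjl N T v)"
  shows "w \<in> {1..10 * N} \<and> v \<in> set (adjl N T w) \<and> w \<noteq> v"
proof -
  obtain e j where v: "v = vtx e j" "e < N" "j < 10" using assms(1) by (rule vtxE)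
  consider k where "k \<in> set (gnb j)" "w = vtx e k"
    | "is_port j" "act T (port_word j) e < N" "w = vtx (act T (port_word j) e) (port_opp j)"
    using assms(2) v by (auto simp: adjl_vtx adjl_of_def split: if_splits)
  then show ?thesis
  proof cases
    case 1
    then have "k < 10" "j \<in> set (gnb k)" "k \<noteq> j" using gnb_facts[OF v(3)] by auto
    then show ?thesis using 1 v vtx_in by (auto simp: adjl_vtx adjl_of_def)
  next
    case 2
    have "e < N'" using v NN' by simp
    from 2(1) port_inv[OF 2(1) this] port_facts[OF 2(1)] 2 v show ?thesis
      by (auto simp: adjl_vtx adjl_of_def vtx_in)
  qed
qed

lemma neighbours_enc:
  "neighbours (enc N T) v = (if v \<in> {1..10 * N} then set (adjl N T v) else {})"
proof -
  have "{v, w} \<in> edges (enc N T) \<longleftrightarrow> v \<in> {1..10 * N} \<and> w \<in> set (adjl N T v)" for w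
  proof
    assume "{v, w} \<in> edges (enc N T)"
    then obtain v' w' where "v' \<in> {1..10 * N}" "w' \<in> set (adjl N T v')" "{v, w} = {v', w'}"
      by (auto simp: enc_def)
    then show "v \<in> {1..10 * N} \<and> w \<in> set (adjl N T v)"
      using adjl_sym[of v' w'] unfolding doubleton_eq_iff by blast
  next
    assume "v \<in> {1..10 * N} \<and> w \<in> set (adjl N T v)"
    then show "{v, w} \<in> edges (enc N T)"
      unfolding enc_def ugraph.select_convs by (intro CollectI bexI[of _ v] bexI[of _ w]) auto
  qed
  then have "neighbours (enc N T) v = {w. v \<in> {1..10 * N} \<and> w \<in> set (adjl N T v)}"
    unfolding neighbours_def by (rule Collect_cong)
  then show ?thesis by auto
qed

lemma simple_enc: "simple_graph (enc N T)"
  unfolding simple_graph_def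
proof (intro conjI ballI)
  fix e assume "e \<in> edges (enc N T)"
  then obtain v w where "v \<in> {1..10 * N}" "w \<in> set (adjl N T v)" "e = {v, w}"
    by (auto simp: enc_def)
  with adjl_sym[of v w] show "e \<subseteq> verts (enc N T)" "card e = 2" by (auto simp: enc_def)
qed (simp add: enc_def)

lemma card_neighbours_enc:
  "e < N \<Longrightarrow> j < 10 \<Longrightarrow> card (neighbours (enc N T) (vtx e j)) =
    length (gnb j) + (if is_port j \<and> act T (port_word j) e < N then 1 else 0)"
  using distinct_card[OF distinct_adjl] by (simp add: neighbours_enc vtx_in length_adjl)

lemma enc_bounded: "enc N T \<in> bounded_degree_graphs 9"
  unfolding bounded_degree_graphs_def degree_at_most_def
proof (intro CollectI conjI simple_enc ballI)
  fix v assume "v \<in> verts (enc N T)"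
  then have "v \<in> {1..10 * N}" by (simp add: enc_def)
  then obtain e j where v: "v = vtx e j" "e < N" "j < 10" by (elim vtxE)
  then show "card (neighbours (enc N T) v) \<le> 9"
    using gnb_facts(4,5)[of j] by (auto simp: card_neighbours_enc)
qed

lemma adjacency_lists_enc: "adjacency_lists (enc N T) (adjl N T)"
  unfolding adjacency_lists_def
proof (intro ballI conjI)
  fix v assume "v \<in> verts (enc N T)"
  then have v: "v \<in> {1..10 * N}" by (simp add: enc_def)
  then show "set (adjl N T v) = neighbours (enc N T) v" by (simp add: neighbours_enc)
  from v obtain e j where "v = vtx e j" "j < 10" by (rule vtxE)
  then show "distinct (adjl N T v)" by (simp add: distinct_adjl)
qed

end

lemma verts_enc: "verts (enc N T) = {1..10 * N}" and card_verts_enc: "card (verts (enc N T)) = 10 * N"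
  by (simp_all add: enc_def)

definition centre :: "nat ugraph \<Rightarrow> nat \<Rightarrow> bool" where
  "centre G u \<longleftrightarrow> u \<in> verts G \<and> card (neighbours G u) = 9"

text \<open>Degree \<open>3 + i\<close> alone does not single out the outgoing port, as the vertices
  9 and 8 of a gadget have degrees 4 and 5. The neighbour \<open>p'\<close> of degree 2 does: in a
  complete encoding only incoming ports have that degree.\<close>

definition step :: "nat ugraph \<Rightarrow> nat \<Rightarrow> nat \<Rightarrow> nat \<Rightarrow> bool" where
  "step G i u u' \<longleftrightarrow> centre G u \<and> centre G u' \<and> (\<exists>p p'. p \<in> neighbours G u \<and> p' \<in> neighbours G p \<and>
     u' \<in> neighbours G p' \<and> card (neighbours G p) = 3 + i \<and> card (neighbours G p') = 2)"

context enc_action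
begin

lemma nb_vtx:
  "e < N \<Longrightarrow> j < 10 \<Longrightarrow> neighbours (enc N T) (vtx e j) = vtx e ` set (gnb j) \<union>
    (if is_port j \<and> act T (port_word j) e < N then {vtx (act T (port_word j) e) (port_opp j)} else {})"
  by (auto simp: neighbours_enc vtx_in adjl_vtx adjl_of_def)

lemma centre_enc: "centre (enc N T) v \<longleftrightarrow> (\<exists>e<N. v = vtx e 0)"
proof
  assume "centre (enc N T) v"
  then have *: "v \<in> {1..10 * N}" "card (neighbours (enc N T) v) = 9"
    by (auto simp: centre_def verts_enc)
  from *(1) obtain e j where v: "v = vtx e j" "e < N" "j < 10" by (rule vtxE)
  have "length (gnb j) + (if is_port j \<and> act T (port_word j) e < N then 1 else 0) = 9"
    using *(2) v by (simp add: card_neighbours_enc)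
  then have "j = 0" using v(3) unfolding less_10_cases by (auto split: if_splits)
  then show "\<exists>e<N. v = vtx e 0" using v by auto
next
  assume "\<exists>e<N. v = vtx e 0"
  then show "centre (enc N T) v"
    by (auto simp: centre_def verts_enc card_neighbours_enc is_port_def)
qed

lemma out_port: assumes "e < N" "i < 3" "T i e < N"
  shows "vtx e (Suc i) \<in> neighbours (enc N T) (vtx e 0)"
    "vtx (T i e) (i + 4) \<in> neighbours (enc N T) (vtx e (Suc i))"
    "vtx (T i e) 0 \<in> neighbours (enc N T) (vtx (T i e) (i + 4))"
    "card (neighbours (enc N T) (vtx e (Suc i))) = 3 + i"
    "card (neighbours (enc N T) (vtx (T i e) (i + 4))) = 2"
proof -
  have i: "i = 0 \<or> i = 1 \<or> i = 2" using assms(2) by auto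
  have e: "e < N'" using assms NN' by simp
  have "act T (port_word (i + 4)) (T i e) = e"
    using port_inv[of "Suc i" e] i e by (auto simp: is_port_def port_opp_def port_word_def numeral_eq_Suc)
  then show "card (neighbours (enc N T) (vtx (T i e) (i + 4))) = 2"
    using i assms by (auto simp: card_neighbours_enc is_port_def)
  show "vtx e (Suc i) \<in> neighbours (enc N T) (vtx e 0)"
    "vtx (T i e) (i + 4) \<in> neighbours (enc N T) (vtx e (Suc i))"
    "vtx (T i e) 0 \<in> neighbours (enc N T) (vtx (T i e) (i + 4))"
    using i assms by (auto simp: nb_vtx is_port_def port_word_def port_opp_def)
  show "card (neighbours (enc N T) (vtx e (Suc i))) = 3 + i"
    using i assms card_neighbours_enc[of e "Suc i"]
    by (auto simp: is_port_def port_word_def numeral_2_eq_2[symmetric] numeral_3_eq_3[symmetric])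
qed

text \<open>With \<open>N = N'\<close> no port has lost its edge, so all degrees are the intended
  ones. Then \<open>p'\<close> is an incoming port, whose neighbours are its centre and a single
  outgoing port, and the degree of the latter names the generator.\<close>

lemma step_enc:
  assumes "e < N" "i < 3" "N = N'"
  shows "step (enc N T) i (vtx e 0) v \<longleftrightarrow> v = vtx (T i e) 0"
proof
  have Te: "T i e < N" using T_in[OF assms(2), of e] assms by simp
  show "step (enc N T) i (vtx e 0) v" if "v = vtx (T i e) 0"
    using out_port[OF assms(1,2) Te] that assms Te unfolding step_def centre_enc by blast
  assume "step (enc N T) i (vtx e 0) v"
  then obtain p p' e' where p: "p \<in> neighbours (enc N T) (vtx e 0)" "p' \<in> neighbours (enc N T) p"
    "v \<in> neighbours (enc N T) p'" "card (neighbours (enc N T) p) = 3 + i"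
    "card (neighbours (enc N T) p') = 2" "e' < N" "v = vtx e' 0"
    unfolding step_def centre_enc by blast
  have act_N: "act T (port_word j) x < N" if "x < N" for j x
    using act_in[OF port_word_set(1), of x j] that assms by simp
  obtain j where j: "p = vtx e j" "j < 10" "j \<noteq> 0"
    using p(1) assms(1) by (auto simp: nb_vtx is_port_def)
  have deg: "card (neighbours (enc N T) (vtx x k)) = length (gnb k) + (if is_port k then 1 else 0)"
    if "x < N" "k < 10" for x k using that act_N by (simp add: card_neighbours_enc)
  obtain x k where k: "p' = vtx x k" "x < N" "k < 10" "k \<in> set (gnb j) \<and> x = e \<or> is_port j \<and> k = port_opp j \<and> x = act T (port_word j) e"
    using p(2) j assms(1) act_N[OF assms(1)] gnb_facts(2)[OF j(2)] port_facts(5)[of j]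
    by (auto simp: nb_vtx split: if_splits)
  have k2: "k \<in> {4, 5, 6}" using p(5) k(1-3) deg[OF k(2,3)] k(3) unfolding less_10_cases is_port_def by auto
  have j2: "j = Suc i" "k = i + 4 \<and> x = T i e"
    using p(4) j deg[OF assms(1) j(2)] k(4) k2 j(2) assms(2) unfolding less_10_cases is_port_def
    by (auto simp: port_opp_def port_word_def is_port_def)
  have "v \<in> vtx x ` set (gnb k) \<union> {vtx (act T (port_word k) x) (port_opp k)}"
    using p(3) k by (auto simp: nb_vtx split: if_splits)
  then show "v = vtx (T i e) 0" using p(7) k2 j2 by (auto simp: port_opp_def)
qed

lemma closed_nbhd_centre: "e < N \<Longrightarrow> closed_nbhd (enc N T) (vtx e 0) = vtx e ` {..<10}"
proof -
  have "{..<10} = {0, 1, 2, 3, 4, 5, 6, 7, 8, 9 :: nat}" by auto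
  then show "e < N \<Longrightarrow> closed_nbhd (enc N T) (vtx e 0) = vtx e ` {..<10}"
    by (simp add: closed_nbhd_def nb_vtx is_port_def)
qed

end

section \<open>The property\<close>

text \<open>
  Following a generator takes three edges and the relations have length at most 11, so balls of
  radius 40 suffice to verify them.
\<close>

definition forb_size :: nat where "forb_size = 10 ^ 40"

text \<open>Described by what it must avoid: encodings are free of it by construction, and
  conversely any small ball found in a graph with the property must occur in some encoding. The same
  set serves for every order.\<close>

definition forb :: "nat marked_graph set" where
  "forb = {F \<in> marked_graphs 9. card (verts F) \<le> forb_size \<and>
     (\<forall>N T f. kms_action T {..<N} \<longrightarrow> \<not> embedding f F (enc N T))}"

definition kms_property :: "nat ugraph set" where
  "kms_property = {G \<in> bounded_degree_graphs 9. gsf_free forb G}"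

lemma of_order_kms_property: "of_order kms_property n = free_graphs 9 forb n"
  by (auto simp: kms_property_def free_graphs_def of_order_def)

lemma gsf_local_kms_property: "gsf_local 9 kms_property"
proof -
  have "local_for 9 (\<lambda>_. forb) kms_property"
    unfolding local_for_def of_order_kms_property
    by (rule exI[of _ forb_size]) (simp add: forb_def subset_iff)
  then show ?thesis unfolding gsf_local_def by blast
qed

lemma neighbours_sub: "simple_graph G \<Longrightarrow> neighbours G v \<subseteq> verts G"
  by (auto simp: simple_graph_def neighbours_def)
lemma neighbours_not_self: "simple_graph G \<Longrightarrow> v \<notin> neighbours G v"
proof
  assume "simple_graph G" "v \<in> neighbours G v"
  then have "card {v, v} = 2" unfolding simple_graph_def neighbours_def by blast
  then show False by simp
qed
lemma neighbours_sym: "w \<in> neighbours G v \<Longrightarrow> v \<in> neighbours G w"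
  by (simp add: neighbours_def insert_commute)
lemma enc_in_kms_property:
  assumes "kms_action T {..<N}" shows "enc N T \<in> kms_property"
proof -
  interpret enc_action T N N by (simp add: enc_action_def enc_action_axioms_def kms_def assms)
  have "\<not> embedding f F (enc N T)" if "F \<in> forb" for f F
    using that assms by (simp add: forb_def)
  then have "gsf_free forb (enc N T)" by (simp add: gsf_free_def)
  then show ?thesis using enc_bounded by (simp add: kms_property_def)
qed

text \<open>All three marks are conditions on closed neighbourhoods of image vertices. Hence a map
  carrying these exactly onto closed neighbourhoods preserves embeddings, provided it is injective
  on a set \<open>Z\<close> containing them, so that it commutes with the intersection in the
  semifull case.\<close>

lemma embedding_comp:
  assumes emb: "embedding f F G" and inj: "inj_on g Z"
    and Z: "\<And>v. v \<in> verts F \<Longrightarrow> closed_nbhd G (f v) \<subseteq> Z"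
    and H: "\<And>v. v \<in> verts F \<Longrightarrow> g (f v) \<in> verts H"
    and nb: "\<And>v. v \<in> verts F \<Longrightarrow> closed_nbhd H (g (f v)) = g ` closed_nbhd G (f v)"
  shows "embedding (g \<circ> f) F H"
  unfolding embedding_def
proof (intro conjI ballI)
  have fZ: "f ` verts F \<subseteq> Z" using Z by (auto simp: closed_nbhd_def)
  show "inj_on (g \<circ> f) (verts F)"
    using emb inj fZ by (auto simp: embedding_def intro: comp_inj_on inj_on_subset)
  show "(g \<circ> f) ` verts F \<subseteq> verts H" using H by auto
  fix v assume v: "v \<in> verts F"
  have int: "g ` closed_nbhd G (f v) \<inter> g ` f ` verts F = g ` (closed_nbhd G (f v) \<inter> f ` verts F)"
    using inj_on_image_Int[OF inj Z[OF v] fZ] by simp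
  have "case marking F v of Full \<Rightarrow> closed_nbhd G (f v) = f ` closed_nbhd F v
      | Semifull \<Rightarrow> closed_nbhd G (f v) \<inter> f ` verts F = f ` closed_nbhd F v
      | Partial \<Rightarrow> f ` closed_nbhd F v \<subseteq> closed_nbhd G (f v)"
    using emb v by (simp add: embedding_def)
  then show "case marking F v of Full \<Rightarrow> closed_nbhd H ((g \<circ> f) v) = (g \<circ> f) ` closed_nbhd F v
      | Semifull \<Rightarrow> closed_nbhd H ((g \<circ> f) v) \<inter> (g \<circ> f) ` verts F = (g \<circ> f) ` closed_nbhd F v
      | Partial \<Rightarrow> (g \<circ> f) ` closed_nbhd F v \<subseteq> closed_nbhd H ((g \<circ> f) v)"
    using int unfolding image_comp[symmetric] comp_apply nb[OF v]
    by (cases "marking F v") (simp_all add: image_mono)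
qed

lemma graph_property_kms_property: "graph_property 9 kms_property"
  unfolding graph_property_def
proof (intro conjI ballI allI impI)
  show "kms_property \<subseteq> bounded_degree_graphs 9" by (auto simp: kms_property_def)
  fix G H :: "nat ugraph" assume G: "G \<in> kms_property" and "graph_iso G H"
  then obtain f where f: "bij_betw f (verts G) (verts H)" "edges H = (\<lambda>e. f ` e) ` edges G"
    by (auto simp: graph_iso_def)
  have sG: "simple_graph G" and dG: "degree_at_most 9 G" and fr: "gsf_free forb G"
    using G by (auto simp: kms_property_def bounded_degree_graphs_def)
  have inj: "inj_on f (verts G)" and im: "f ` verts G = verts H" using f by (auto simp: bij_betw_def)
  have sH: "simple_graph H" unfolding simple_graph_def
  proof (intro conjI ballI)
    show "finite (verts H)" using sG im by (metis finite_imageI simple_graph_def)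
    fix e assume "e \<in> edges H"
    then obtain e' where e': "e' \<in> edges G" "e = f ` e'" using f(2) by auto
    then have "e' \<subseteq> verts G" "card e' = 2" using sG by (auto simp: simple_graph_def)
    then show "e \<subseteq> verts H" "card e = 2"
      using e' im inj by (auto simp: card_image inj_on_subset)
  qed
  have nb: "neighbours H (f v) = f ` neighbours G v" if v: "v \<in> verts G" for v
  proof -
    have "{f v, w} \<in> edges H \<longleftrightarrow> w \<in> f ` neighbours G v" for w
    proof
      assume "{f v, w} \<in> edges H"
      then obtain e where e: "e \<in> edges G" "{f v, w} = f ` e" using f(2) by auto
      then obtain x y where xy: "e = {x, y}" "x \<in> verts G" "y \<in> verts G"
        using sG unfolding simple_graph_def card_2_iff by (metis insert_subset)
      have "f v = f x \<and> w = f y \<or> f v = f y \<and> w = f x" using e xy by (auto simp: doubleton_eq_iff)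
      then show "w \<in> f ` neighbours G v" using xy e v inj
        by (auto simp: neighbours_def inj_on_def insert_commute)
    next
      assume "w \<in> f ` neighbours G v"
      then obtain x where "{v, x} \<in> edges G" "w = f x" by (auto simp: neighbours_def)
      then show "{f v, w} \<in> edges H" using f(2) by (auto intro!: image_eqI[of _ _ "{v, x}"])
    qed
    then show ?thesis by (auto simp: neighbours_def)
  qed
  have cn: "closed_nbhd H (f v) = f ` closed_nbhd G v" if v: "v \<in> verts G" for v
    using nb[OF v] by (simp add: closed_nbhd_def)
  have "degree_at_most 9 H" unfolding degree_at_most_def
  proof
    fix w assume "w \<in> verts H"
    then obtain v where v: "v \<in> verts G" "w = f v" using im by auto
    have "card (neighbours H w) = card (neighbours G v)"
      using v nb inj neighbours_sub[OF sG, of v] by (simp add: card_image inj_on_subset)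
    then show "card (neighbours H w) \<le> 9" using dG v by (simp add: degree_at_most_def)
  qed
  moreover have "gsf_free forb H" unfolding gsf_free_def
  proof (intro ballI notI)
    fix F assume F: "F \<in> forb" and "\<exists>h. embedding h F H"
    then obtain h where h: "embedding h F H" by blast
    define g where "g = inv_into (verts G) f"
    have gH: "g w \<in> verts G" "f (g w) = w" if "w \<in> verts H" for w
      using that im by (auto simp: g_def inv_into_into f_inv_into_f)
    have gf: "g (f v) = v" if "v \<in> verts G" for v using that inj by (simp add: g_def)
    have hv: "h ` verts F \<subseteq> verts H" using h by (auto simp: embedding_def)
    have injg: "inj_on g (verts H)" using gH by (metis inj_on_inverseI)
    have cng: "closed_nbhd G (g w) = g ` closed_nbhd H w" if w: "w \<in> verts H" for w
    proof -
      have "closed_nbhd G (g w) \<subseteq> verts G"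
        using neighbours_sub[OF sG] gH[OF w] by (auto simp: closed_nbhd_def)
      then have "g ` f ` closed_nbhd G (g w) = closed_nbhd G (g w)"
        using gf by (force simp: image_image)
      then show ?thesis using cn[OF gH(1)[OF w]] gH(2)[OF w] by simp
    qed
    have "embedding (g \<circ> h) F G"
    proof (rule embedding_comp[OF h injg])
      fix v assume "v \<in> verts F"
      then have hvH: "h v \<in> verts H" using hv by auto
      show "closed_nbhd H (h v) \<subseteq> verts H"
        using neighbours_sub[OF sH, of "h v"] hvH by (auto simp: closed_nbhd_def)
      show "g (h v) \<in> verts G" "closed_nbhd G (g (h v)) = g ` closed_nbhd H (h v)"
        using gH(1)[OF hvH] cng[OF hvH] by auto
    qed
    then show False using fr F by (auto simp: gsf_free_def)
  qed
  ultimately show "H \<in> kms_property" using sH by (simp add: kms_property_def bounded_degree_graphs_def)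
qed

section \<open>Decoding graphs of the property\<close>

primrec nball :: "nat ugraph \<Rightarrow> nat \<Rightarrow> nat \<Rightarrow> nat set" where
  "nball G u 0 = {u}"
| "nball G u (Suc r) = (\<Union>v\<in>nball G u r. closed_nbhd G v)"

lemma nball_Suc: "v \<in> nball G u k \<Longrightarrow> w \<in> neighbours G v \<Longrightarrow> w \<in> nball G u (Suc k)"
  by (auto simp: closed_nbhd_def)

lemma nball_mono: "k \<le> k' \<Longrightarrow> nball G u k \<subseteq> nball G u k'"
  by (rule lift_Suc_mono_le) (auto simp: closed_nbhd_def)

lemma nball_verts: "simple_graph G \<Longrightarrow> u \<in> verts G \<Longrightarrow> nball G u k \<subseteq> verts G"
  by (induction k) (use neighbours_sub in \<open>fastforce simp: closed_nbhd_def\<close>)+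

lemma card_closed_nbhd:
  assumes "simple_graph G" shows "card (closed_nbhd G v) = Suc (card (neighbours G v))"
    and "finite (closed_nbhd G v)"
proof -
  have "finite (neighbours G v)"
    using neighbours_sub[OF assms, of v] assms finite_subset by (auto simp: simple_graph_def)
  then show "card (closed_nbhd G v) = Suc (card (neighbours G v))" "finite (closed_nbhd G v)"
    using neighbours_not_self[OF assms] by (auto simp: closed_nbhd_def)
qed

lemma card_nball:
  assumes "simple_graph G" "degree_at_most d G" "u \<in> verts G"
  shows "finite (nball G u k) \<and> card (nball G u k) \<le> Suc d ^ k"
proof (induction k)
  case (Suc k)
  have "card (closed_nbhd G v) \<le> Suc d" if "v \<in> nball G u k" for v
    using that nball_verts[OF assms(1,3), of k] assms(2) card_closed_nbhd[OF assms(1), of v]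
    by (auto simp: degree_at_most_def)
  then have "card (nball G u (Suc k)) \<le> card (nball G u k) * Suc d"
    using Suc unfolding nball.simps
    by (intro order_trans[OF card_UN_le] order_trans[OF sum_bounded_above]) auto
  also have "\<dots> \<le> Suc d ^ k * Suc d" using Suc by (intro mult_le_mono1) simp
  finally show ?case using Suc card_closed_nbhd(2)[OF assms(1)] by (auto simp: mult.commute)
qed simp

text \<open>Injectivity holds one step beyond the ball on which neighbourhoods are matched, so
  degrees agree on the inner ball; boundary vertices may have further neighbours in the
  encoding.\<close>

locale chart =
  fixes Y :: "nat ugraph" and r u N :: nat and T \<theta>
  assumes simple: "simple_graph Y" and base: "u \<in> verts Y"
    and T: "kms_action T {..<N}" and inj: "inj_on \<theta> (nball Y u (Suc r))"
    and into: "\<theta> ` nball Y u (Suc r) \<subseteq> verts (enc N T)"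
    and nb: "\<And>v. v \<in> nball Y u r \<Longrightarrow> neighbours (enc N T) (\<theta> v) = \<theta> ` neighbours Y v"

text \<open>
  The ball of radius \<open>r + 1\<close> around \<open>u\<close>, with its boundary marked partial and the rest marked full,
  embeds in \<open>Y\<close>; so it is not forbidden and embeds in some encoded action.
\<close>

lemma ex_chart:
  assumes Y: "Y \<in> kms_property" and u: "u \<in> verts Y" and r: "r < 40"
  obtains N T \<theta> where "chart Y r u N T \<theta>"
proof -
  have sY: "simple_graph Y" and dY: "degree_at_most 9 Y" and fr: "gsf_free forb Y"
    using Y by (auto simp: kms_property_def bounded_degree_graphs_def)
  define B where "B = nball Y u (Suc r)"
  define F :: "nat marked_graph" where
    "F = \<lparr>verts = B, edges = {e \<in> edges Y. e \<subseteq> B},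
      marking = (\<lambda>v. if v \<in> nball Y u r then Full else Partial)\<rparr>"
  have BY: "B \<subseteq> verts Y" unfolding B_def by (rule nball_verts[OF sY u])
  have "card B \<le> 10 ^ Suc r" "finite B" using card_nball[OF sY dY u, of "Suc r"] by (simp_all add: B_def)
  moreover have "(10 :: nat) ^ Suc r \<le> 10 ^ 40" using r by (intro power_increasing) auto
  ultimately have cB: "card B \<le> forb_size" unfolding forb_size_def by linarith
  have nF: "neighbours F v = neighbours Y v \<inter> B" if "v \<in> B" for v
    using that by (auto simp: F_def neighbours_def)
  have full: "neighbours Y v \<subseteq> B" if "v \<in> nball Y u r" for v
    using that by (auto simp: B_def closed_nbhd_def)
  have sub: "nball Y u r \<subseteq> B" unfolding B_def by (rule nball_mono) simp
  have "F \<in> marked_graphs 9"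
    unfolding marked_graphs_def
  proof (intro CollectI conjI)
    show "simple_graph F" using sY \<open>finite B\<close> by (auto simp: F_def simple_graph_def)
    show "degree_at_most 9 F" unfolding degree_at_most_def
    proof
      fix v assume "v \<in> verts F"
      then have v: "v \<in> B" by (simp add: F_def)
      have "finite (neighbours Y v)"
        using neighbours_sub[OF sY, of v] sY finite_subset by (auto simp: simple_graph_def)
      then have "card (neighbours F v) \<le> card (neighbours Y v)"
        unfolding nF[OF v] by (intro card_mono) auto
      also have "\<dots> \<le> 9" using dY v BY by (auto simp: degree_at_most_def)
      finally show "card (neighbours F v) \<le> 9" .
    qed
  qed
  moreover have "embedding id F Y" unfolding embedding_def
  proof (intro conjI ballI)
    fix v assume "v \<in> verts F"
    then have v: "v \<in> B" by (simp add: F_def)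
    show "case marking F v of Full \<Rightarrow> closed_nbhd Y (id v) = id ` closed_nbhd F v
      | Semifull \<Rightarrow> closed_nbhd Y (id v) \<inter> id ` verts F = id ` closed_nbhd F v
      | Partial \<Rightarrow> id ` closed_nbhd F v \<subseteq> closed_nbhd Y (id v)"
      using nF[OF v] full[of v] by (auto simp: F_def closed_nbhd_def)
  qed (use BY in \<open>auto simp: F_def\<close>)
  then have "F \<notin> forb" using fr by (auto simp: gsf_free_def)
  ultimately have "\<exists>N T f. kms_action T {..<N} \<and> embedding f F (enc N T)"
    using cB by (auto simp: forb_def F_def)
  then obtain N T \<theta> where T: "kms_action T {..<N}" and e: "embedding \<theta> F (enc N T)" by blast
  interpret E: enc_action T N N by (simp add: enc_action_def enc_action_axioms_def kms_def T)
  have inj: "inj_on \<theta> B" and into: "\<theta> ` B \<subseteq> verts (enc N T)" using e by (auto simp: embedding_def F_def)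
  have "neighbours (enc N T) (\<theta> v) = \<theta> ` neighbours Y v" if v: "v \<in> nball Y u r" for v
  proof -
    have vB: "v \<in> B" using v sub by auto
    have "closed_nbhd (enc N T) (\<theta> v) = \<theta> ` closed_nbhd F v"
      using e vB v by (auto simp: embedding_def F_def)
    moreover have "closed_nbhd F v = closed_nbhd Y v"
      using nF[OF vB] full[OF v] by (auto simp: closed_nbhd_def)
    moreover have "\<theta> v \<notin> \<theta> ` neighbours Y v"
      using inj vB full[OF v] neighbours_not_self[OF sY, of v] by (auto simp: inj_on_def)
    ultimately show ?thesis
      using neighbours_not_self[OF E.simple_enc, of "\<theta> v"] unfolding closed_nbhd_def
      by (metis image_insert insert_ident)
  qed
  then have "chart Y r u N T \<theta>" by unfold_locales (use sY u T inj into in \<open>simp_all add: B_def\<close>)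
  then show ?thesis by (rule that)
qed

text \<open>Radius 39 + 1 keeps the ball within 10^40 vertices, and 39 exceeds the 3 * 11 edges
  travelled along a relation.\<close>

lemma ex_chart_centre:
  assumes "Y \<in> kms_property" "centre Y u" shows "\<exists>N T \<theta>. chart Y 39 u N T \<theta>"
  by (rule ex_chart[OF assms(1), of u 39]) (use assms(2) in \<open>auto simp: centre_def\<close>)

context chart
begin

sublocale E: enc_action T N N by (simp add: enc_action_def enc_action_axioms_def kms_def T)

lemma mono: "v \<in> nball Y u k \<Longrightarrow> k \<le> k' \<Longrightarrow> v \<in> nball Y u k'"
  using nball_mono by blast

lemma deg: assumes "v \<in> nball Y u r" shows "card (neighbours (enc N T) (\<theta> v)) = card (neighbours Y v)"
proof -
  have "neighbours Y v \<subseteq> nball Y u (Suc r)" using assms by (auto simp: closed_nbhd_def)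
  then show ?thesis using nb[OF assms] inj by (metis card_image inj_on_subset)
qed

lemma centre_iff: assumes "v \<in> nball Y u r" shows "centre (enc N T) (\<theta> v) \<longleftrightarrow> centre Y v"
proof -
  have "v \<in> nball Y u (Suc r)" using assms by (rule mono) simp
  moreover have "v \<in> verts Y" using assms nball_verts[OF simple base] by auto
  ultimately show ?thesis using into deg[OF assms] by (auto simp: centre_def)
qed

lemma step_fwd:
  assumes "v \<in> nball Y u k" "k + 3 \<le> r" "step Y i v v'"
  shows "v' \<in> nball Y u (k + 3)" "step (enc N T) i (\<theta> v) (\<theta> v')"
proof -
  obtain p p' where p: "p \<in> neighbours Y v" "p' \<in> neighbours Y p" "v' \<in> neighbours Y p'"
    "card (neighbours Y p) = 3 + i" "card (neighbours Y p') = 2" "centre Y v" "centre Y v'"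
    using assms(3) unfolding step_def by blast
  have b: "p \<in> nball Y u (k + 1)" "p' \<in> nball Y u (k + 2)" "v' \<in> nball Y u (k + 3)"
    using nball_Suc assms(1) p by (metis add_Suc_right One_nat_def add.right_neutral numeral_2_eq_2 numeral_3_eq_3)+
  show "v' \<in> nball Y u (k + 3)" by fact
  have r: "v \<in> nball Y u r" "p \<in> nball Y u r" "p' \<in> nball Y u r" "v' \<in> nball Y u r"
    using assms(1,2) b by (auto intro: mono simp del: nball.simps)
  show "step (enc N T) i (\<theta> v) (\<theta> v')" unfolding step_def
    using p r nb deg centre_iff by (intro conjI exI[of _ "\<theta> p"] exI[of _ "\<theta> p'"]) auto
qed

lemma step_bwd:
  assumes "v \<in> nball Y u k" "k + 3 \<le> r" "step (enc N T) i (\<theta> v) y"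
  shows "\<exists>v'. step Y i v v' \<and> y = \<theta> v'"
proof -
  obtain q q' where q: "q \<in> neighbours (enc N T) (\<theta> v)" "q' \<in> neighbours (enc N T) q"
    "y \<in> neighbours (enc N T) q'" "card (neighbours (enc N T) q) = 3 + i"
    "card (neighbours (enc N T) q') = 2" "centre (enc N T) (\<theta> v)" "centre (enc N T) y"
    using assms(3) unfolding step_def by blast
  have v: "v \<in> nball Y u r" using assms(1,2) by (auto intro: mono simp del: nball.simps)
  obtain p where p: "p \<in> neighbours Y v" "q = \<theta> p" using q(1) nb[OF v] by auto
  have pk: "p \<in> nball Y u (Suc k)" using nball_Suc[OF assms(1) p(1)] .
  then have pr: "p \<in> nball Y u r" using assms(2) by (auto intro: mono simp del: nball.simps)
  obtain p' where p': "p' \<in> neighbours Y p" "q' = \<theta> p'" using q(2) nb[OF pr] p(2) by auto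
  have pk': "p' \<in> nball Y u (Suc (Suc k))" using nball_Suc[OF pk p'(1)] .
  then have pr': "p' \<in> nball Y u r" using assms(2) by (auto intro: mono simp del: nball.simps)
  obtain v' where v': "v' \<in> neighbours Y p'" "y = \<theta> v'" using q(3) nb[OF pr'] p'(2) by auto
  have "v' \<in> nball Y u (Suc (Suc (Suc k)))" using nball_Suc[OF pk' v'(1)] .
  then have vr': "v' \<in> nball Y u r" using assms(2) by (auto intro: mono simp del: nball.simps)
  have "step Y i v v'" unfolding step_def
    using q p p' v' deg[OF pr] deg[OF pr'] centre_iff[OF v] centre_iff[OF vr'] by auto
  then show ?thesis using v'(2) by blast
qed

lemma centre_image:
  assumes "v \<in> nball Y u r" "centre Y v" obtains e where "e < N" "\<theta> v = vtx e 0"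
  using assms centre_iff E.centre_enc by auto

end

definition decode :: "nat ugraph \<Rightarrow> nat \<Rightarrow> nat \<Rightarrow> nat" where
  "decode Y i v = (THE v'. step Y i v v')"

lemma decode_unique:
  assumes Y: "Y \<in> kms_property" and u: "centre Y u" and i: "i < 3"
  shows "step Y i u v \<longleftrightarrow> v = decode Y i u"
proof -
  obtain N T \<theta> where "chart Y 39 u N T \<theta>"
    using ex_chart_centre[OF Y u] by blast
  then interpret chart Y 39 u N T \<theta> .
  have u0: "u \<in> nball Y u 0" by simp
  have u39: "u \<in> nball Y u 39" using u0 by (rule mono) simp
  obtain e where e: "e < N" "\<theta> u = vtx e 0" using centre_image[OF u39 u] .
  have "step (enc N T) i (\<theta> u) (vtx (T i e) 0)" using E.step_enc[OF e(1) i] e by simp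
  then obtain v' where v': "step Y i u v'" using step_bwd[OF u0, of i] by auto
  have un: "x = y" if "step Y i u x" "step Y i u y" for x y
  proof -
    have "\<theta> x = vtx (T i e) 0" "\<theta> y = vtx (T i e) 0"
      using step_fwd(2)[OF u0 _ that(1)] step_fwd(2)[OF u0 _ that(2)] E.step_enc[OF e(1) i] e(2) by auto
    moreover have "x \<in> nball Y u (Suc 39)" "y \<in> nball Y u (Suc 39)"
      using mono[OF step_fwd(1)[OF u0 _ that(1)], of "Suc 39"]
        mono[OF step_fwd(1)[OF u0 _ that(2)], of "Suc 39"] by auto
    ultimately show ?thesis using inj by (metis inj_onD)
  qed
  have "decode Y i u = v'" unfolding decode_def using v' un by blast
  then show ?thesis using v' un by blast
qed

text \<open>Different centres may have charts into unrelated actions. Each relation is checked at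
  one centre at a time: inside its chart decoding follows a genuine action, and injectivity of the
  chart pulls the equation back.\<close>

lemma kms_action_decode:
  assumes Y: "Y \<in> kms_property"
  shows "kms_action (decode Y) {u. centre Y u}"
proof -
  have st: "step Y i u (decode Y i u)" if "centre Y u" "i < 3" for i u
    using decode_unique[OF Y that] by simp
  have cen: "centre Y (decode Y i u)" if "centre Y u" "i < 3" for i u
    using st[OF that] by (simp add: step_def)
  have eq: "act (decode Y) w u = act (decode Y) w' u"
    if ww: "(w, w') \<in> kms_rels" and u: "centre Y u" for w w' u
  proof -
    obtain N T \<theta> where "chart Y 39 u N T \<theta>"
      using ex_chart_centre[OF Y u] by blast
    then interpret chart Y 39 u N T \<theta> .
    have u39: "u \<in> nball Y u 39" by (rule mono[of _ 0]) auto
    obtain e where e: "e < N" "\<theta> u = vtx e 0" using centre_image[OF u39 u] .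
    have *: "centre Y (act (decode Y) w u) \<and> act (decode Y) w u \<in> nball Y u (3 * length w) \<and>
      \<theta> (act (decode Y) w u) = vtx (act T w e) 0 \<and> act T w e < N"
      if "set w \<subseteq> {..<3}" "3 * length w \<le> 39" for w
      using that
    proof (induction w)
      case Nil then show ?case using e u by simp
    next
      case (Cons i w)
      define x where "x = act (decode Y) w u"
      have i: "i < 3" and x: "centre Y x" "x \<in> nball Y u (3 * length w)" "\<theta> x = vtx (act T w e) 0"
        "act T w e < N" using Cons by (auto simp: x_def)
      have le: "3 * length w + 3 \<le> 39" using Cons.prems by simp
      have "vtx (T i (act T w e)) 0 = \<theta> (decode Y i x)"
        using step_fwd(2)[OF x(2) le st[OF x(1) i]] E.step_enc[OF x(4) i] x(3) by simp
      moreover have "decode Y i x \<in> nball Y u (3 * length (i # w))"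
        using step_fwd(1)[OF x(2) le st[OF x(1) i]] by (simp add: algebra_simps)
      ultimately show ?case using cen[OF x(1) i] E.T_in[OF i, of "act T w e"] x(4) by (simp add: x_def)
    qed
    have s: "set w \<subseteq> {..<3}" "3 * length w \<le> 39" "set w' \<subseteq> {..<3}" "3 * length w' \<le> 39"
      using kms_rels_words[OF ww] by (auto simp: words_def)
    have "act T w e = act T w' e" using E.rel[OF ww, of e] e by simp
    then have "\<theta> (act (decode Y) w u) = \<theta> (act (decode Y) w' u)" using *[OF s(1,2)] *[OF s(3,4)] by simp
    moreover have "act (decode Y) w u \<in> nball Y u (Suc 39)" "act (decode Y) w' u \<in> nball Y u (Suc 39)"
      using *[OF s(1,2)] *[OF s(3,4)] s mono[of _ "3 * length w" "Suc 39"] mono[of _ "3 * length w'" "Suc 39"]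
      by auto
    ultimately show ?thesis using inj by (metis inj_onD)
  qed
  have "finite {u. centre Y u}"
    by (rule finite_subset[of _ "verts Y"])
      (use Y in \<open>auto simp: centre_def kms_property_def bounded_degree_graphs_def simple_graph_def\<close>)
  then show ?thesis unfolding kms_action_def using cen eq by auto
qed

text \<open>Each centre owns its ten-vertex closed neighbourhood. Two of these that meet lie in a
  single chart, where distinct gadgets are disjoint.\<close>

lemma card_centres:
  assumes Y: "Y \<in> kms_property" shows "10 * card {u. centre Y u} \<le> card (verts Y)"
proof -
  have sY: "simple_graph Y" using Y by (auto simp: kms_property_def bounded_degree_graphs_def)
  have fin: "finite (verts Y)" using sY by (simp add: simple_graph_def)
  have C: "{u. centre Y u} \<subseteq> verts Y" by (auto simp: centre_def)
  have disj: "closed_nbhd Y u \<inter> closed_nbhd Y u' = {}" if c: "centre Y u" "centre Y u'" "u \<noteq> u'" for u u'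
  proof (rule ccontr)
    assume "closed_nbhd Y u \<inter> closed_nbhd Y u' \<noteq> {}"
    then obtain x where x: "x \<in> closed_nbhd Y u" "x \<in> closed_nbhd Y u'" by blast
    obtain N T \<theta> where "chart Y 39 u N T \<theta>"
      using ex_chart_centre[OF Y c(1)] by blast
    then interpret chart Y 39 u N T \<theta> .
    have x1: "x \<in> nball Y u (Suc 0)" using x(1) by simp
    have "u' \<in> closed_nbhd Y x" using x(2) neighbours_sym[of x Y u'] by (auto simp: closed_nbhd_def)
    then have u2: "u' \<in> nball Y u (Suc (Suc 0))" using x1 by auto
    have in39: "u \<in> nball Y u 39" "u' \<in> nball Y u 39" "x \<in> nball Y u 39"
      using mono[OF u2, of 39] mono[OF x1, of 39] mono[of u 0 39] by auto
    obtain e where e: "e < N" "\<theta> u = vtx e 0" using centre_image[OF in39(1) c(1)] .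
    obtain e' where e': "e' < N" "\<theta> u' = vtx e' 0" using centre_image[OF in39(2) c(2)] .
    have "closed_nbhd (enc N T) (\<theta> v) = \<theta> ` closed_nbhd Y v" if "v \<in> nball Y u 39" for v
      using nb[OF that] by (simp add: closed_nbhd_def)
    then have "\<theta> x \<in> closed_nbhd (enc N T) (vtx e 0)" "\<theta> x \<in> closed_nbhd (enc N T) (vtx e' 0)"
      using in39 x e e' by (metis imageI)+
    then have "e = e'" using E.closed_nbhd_centre e e' by auto
    then have "u = u'" using inj_onD[OF inj, of u u'] in39(1,2)[THEN mono, of "Suc 39"] e(2) e'(2) by simp
    then show False using c(3) by simp
  qed
  have "10 * card {u. centre Y u} = (\<Sum>u\<in>{u. centre Y u}. card (closed_nbhd Y u))"
    using card_closed_nbhd(1)[OF sY] by (simp add: centre_def)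
  also have "\<dots> = card (\<Union>u\<in>{u. centre Y u}. closed_nbhd Y u)"
    using finite_subset[OF C fin] disj card_closed_nbhd(2)[OF sY]
    by (intro card_UN_disjoint[symmetric]) auto
  also have "\<dots> \<le> card (verts Y)"
    using fin neighbours_sub[OF sY] C by (intro card_mono) (auto simp: closed_nbhd_def)
  finally show ?thesis .
qed

section \<open>Removing a point\<close>

definition transitive_on :: "(nat \<Rightarrow> 'a \<Rightarrow> 'a) \<Rightarrow> 'a set \<Rightarrow> bool" where
  "transitive_on T X \<longleftrightarrow> (\<forall>x\<in>X. \<forall>y\<in>X. \<exists>w. set w \<subseteq> {..<3} \<and> act T w x = y)"

text \<open>
  An almost invariant subset \<open>S\<close> of \<open>X \<times> C\<close> that is a partial injection defined on most of \<open>X\<close> forces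
  an equivariant injection \<open>X \<rightarrow> C\<close>: round the invariant function near the indicator of \<open>S\<close> at \<open>1/2\<close>.
\<close>

lemma card_le_of_almost_equivariant:
  fixes T :: "nat \<Rightarrow> 'a \<Rightarrow> 'a" and T' :: "nat \<Rightarrow> 'b \<Rightarrow> 'b"
  assumes X: "kms_action T X" "transitive_on T X" and C: "kms_action T' C"
    and S: "S \<subseteq> X \<times> C" "inj_on fst S" "inj_on snd S"
    and bad: "\<And>i. i < 3 \<Longrightarrow> card {z \<in> S. map_prod (T i) (T' i) z \<notin> S} \<le> m"
    and big: "card X \<le> card S + n" and small: "real n + 32000000 * real m < card X / 4"
  shows "card X \<le> card C"
proof -
  define TT where "TT i = map_prod (T i) (T' i)" for i
  define Z where "Z = X \<times> C"
  have kZ: "kms_action TT Z" unfolding TT_def Z_def by (rule kms_action_Times[OF X(1) C])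
  interpret A: kms T X by unfold_locales fact
  interpret B: kms T' C by unfold_locales fact
  interpret Z: kms TT Z by unfold_locales fact
  have SZ: "S \<subseteq> Z" using S by (simp add: Z_def)
  have finS: "finite S" by (rule finite_subset[OF SZ Z.fin])
  define f where "f z = (if z \<in> S then 1 else 0 :: real)" for z
  have nrm: "L2_set (\<lambda>z. f z - f (TT i z)) Z \<le> sqrt (2 * real m)" if i: "i < 3" for i
  proof -
    have bij: "bij_betw (TT i) Z Z" using Z.bij_T[OF i] .
    define U V W where "U = {z \<in> S. TT i z \<notin> S}" and "V = {z \<in> Z - S. TT i z \<in> S}"
      and "W = {z \<in> S. TT i z \<in> S}"
    have fin: "finite U" "finite V" "finite W" using finS by (auto simp: U_def V_def W_def)
    \<comment> \<open>As \<open>TT i\<close> permutes \<open>Z\<close>, the preimage of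
      \<open>S\<close> is as large as \<open>S\<close>; so as many points enter \<open>S\<close> as
      leave it, and the bound on the leaving ones covers both kinds.\<close>
    have "card (W \<union> V) = card S"
    proof -
      have "W \<union> V = {z \<in> Z. TT i z \<in> S}" using SZ by (auto simp: V_def W_def)
      moreover have "bij_betw (TT i) {z \<in> Z. TT i z \<in> S} S"
        unfolding bij_betw_def
      proof
        show "inj_on (TT i) {z \<in> Z. TT i z \<in> S}"
          using bij by (auto simp: bij_betw_def intro: inj_on_subset)
        have "S \<subseteq> TT i ` Z" using bij SZ by (simp add: bij_betw_def)
        then show "TT i ` {z \<in> Z. TT i z \<in> S} = S" by blast
      qed
      ultimately show ?thesis by (metis bij_betw_same_card)
    qed
    moreover have "card (W \<union> V) = card W + card V" using fin by (intro card_Un_disjoint) (auto simp: W_def V_def)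
    moreover have "card (W \<union> U) = card W + card U" using fin by (intro card_Un_disjoint) (auto simp: W_def U_def)
    moreover have "W \<union> U = S" by (auto simp: W_def U_def)
    ultimately have VU: "card V = card U" by simp
    have "(\<Sum>z\<in>Z. (f z - f (TT i z))\<^sup>2) = (\<Sum>z\<in>U \<union> V. 1)"
      by (rule sum.mono_neutral_cong_right) (use SZ in \<open>auto simp: U_def V_def f_def\<close>)
    also have "\<dots> = real (card (U \<union> V))" by simp
    also have "\<dots> \<le> real (card U + card V)" using card_Un_le by (metis of_nat_le_iff)
    also have "\<dots> \<le> 2 * real m" using VU bad[OF i] by (simp add: U_def TT_def)
    finally show ?thesis unfolding L2_set_def by (rule real_sqrt_le_mono)
  qed
  obtain g where g: "\<And>i z. i < 3 \<Longrightarrow> z \<in> Z \<Longrightarrow> g (TT i z) = g z"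
    and gn: "L2_set (\<lambda>z. f z - g z) Z \<le> 2000 * sqrt (2 * real m)"
    using Z.invariant_approx[OF nrm] by blast
  have g2: "(\<Sum>z\<in>Z. (f z - g z)\<^sup>2) \<le> 8000000 * real m"
  proof -
    have "(\<Sum>z\<in>Z. (f z - g z)\<^sup>2) \<le> (2000 * sqrt (2 * real m))\<^sup>2"
      using gn unfolding L2_set_def by (rule sqrt_le_D)
    then show ?thesis by (simp add: power_mult_distrib)
  qed
  define U where "U = {z \<in> Z. g z > 1 / 2}"
  define \<Delta> where "\<Delta> = (U - S) \<union> (S - U)"
  have finU: "finite U" by (simp add: U_def)
  have fin\<Delta>: "finite \<Delta>" "\<Delta> \<subseteq> Z" using finU finS SZ by (auto simp: \<Delta>_def U_def)
  \<comment> \<open>On \<open>\<Delta>\<close> the functions \<open>f\<close> and \<open>g\<close>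
    differ by at least 1/2, so 32000000 is 4 * 2 * 2000^2.\<close>
  have card\<Delta>: "real (card \<Delta>) \<le> 32000000 * real m"
  proof -
    have "(1 / 2)\<^sup>2 \<le> (f z - g z)\<^sup>2" if "z \<in> \<Delta>" for z
    proof -
      have "1 / 2 \<le> \<bar>f z - g z\<bar>" using that SZ by (auto simp: \<Delta>_def U_def f_def)
      then show ?thesis using power_mono[of "1 / 2" "\<bar>f z - g z\<bar>" 2] by simp
    qed
    then have "(\<Sum>z\<in>\<Delta>. (1 / 2 :: real)\<^sup>2) \<le> (\<Sum>z\<in>\<Delta>. (f z - g z)\<^sup>2)" by (rule sum_mono)
    also have "\<dots> \<le> (\<Sum>z\<in>Z. (f z - g z)\<^sup>2)" using fin\<Delta> by (intro sum_mono2) auto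
    finally show ?thesis using g2 by (simp add: power2_eq_square)
  qed
  have U_act: "(act T w x, act T' w y) \<in> U" if "(x, y) \<in> U" "set w \<subseteq> {..<3}" for w x y
    using that(2)
  proof (induction w)
    case Nil then show ?case using that by simp
  next
    case (Cons i w)
    then have z: "(act T w x, act T' w y) \<in> U" "i < 3" by auto
    then have "TT i (act T w x, act T' w y) \<in> U"
      using g[of i "(act T w x, act T' w y)"] Z.T_in[of i "(act T w x, act T' w y)"] by (auto simp: U_def)
    then show ?case by (simp add: TT_def)
  qed
  have SU: "card S \<le> card (S \<inter> U) + card \<Delta>" "card U \<le> card S + card \<Delta>"
  proof -
    have "card S \<le> card ((S \<inter> U) \<union> \<Delta>)" using finS fin\<Delta> by (intro card_mono) (auto simp: \<Delta>_def)
    then show "card S \<le> card (S \<inter> U) + card \<Delta>" using card_Un_le order_trans by blast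
    have "card U \<le> card (S \<union> \<Delta>)" using finS fin\<Delta> by (intro card_mono) (auto simp: \<Delta>_def)
    then show "card U \<le> card S + card \<Delta>" using card_Un_le order_trans by blast
  qed
  have cS: "card S \<le> card X"
    by (rule card_inj_on_le[OF S(2)]) (use S(1) in auto)
  have U0: "2 * card (S \<inter> U) > card X" using SU(1) big small card\<Delta> by linarith
  have U2: "card U < 2 * card X" using SU(2) cS small card\<Delta> by linarith
  define F where "F x = {y \<in> C. (x, y) \<in> U}" for x
  have finF: "finite (F x)" for x by (simp add: F_def)
  have F_le: "card (F x) \<le> card (F x')" if xx: "x \<in> X" "x' \<in> X" for x x'
  proof -
    obtain w where w: "set w \<subseteq> {..<3}" "act T w x = x'"
      using X(2) xx unfolding transitive_on_def by blast
    have "act T' w ` F x \<subseteq> F x'"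
      using U_act w B.act_in[OF w(1)] by (auto simp: F_def)
    moreover have "inj_on (act T' w) (F x)"
      using B.bij_act[OF w(1)] by (auto simp: bij_betw_def F_def inj_on_def)
    ultimately show ?thesis using finF by (metis card_inj_on_le)
  qed
  have cU: "card U = (\<Sum>x\<in>X. card (F x))"
  proof -
    have "U = Sigma X F" by (auto simp: U_def F_def Z_def)
    then show ?thesis by (simp add: card_SigmaI finF)
  qed
  \<comment> \<open>By transitivity all fibres of \<open>U\<close> have the same size, and the size
    of \<open>U\<close> is positive and below \<open>2 * card X\<close>.\<close>
  have F1: "card (F x) = 1" if x: "x \<in> X" for x
  proof -
    have "card (F x') = card (F x)" if "x' \<in> X" for x'
      using F_le[OF that x] F_le[OF x that] by simp
    then have c: "card U = card X * card (F x)" by (simp add: cU)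
    have "card (S \<inter> U) \<le> card U" using finU by (intro card_mono) auto
    then have "card (F x) \<noteq> 0" using U0 c by (intro notI) simp
    moreover have "card X * card (F x) < card X * 2" using U2 c by simp
    then have "card (F x) < 2" by simp
    ultimately show ?thesis by linarith
  qed
  define \<psi> where "\<psi> x = (THE y. y \<in> F x)" for x
  have \<psi>: "y \<in> F x \<longleftrightarrow> y = \<psi> x" if x: "x \<in> X" for x y
  proof -
    obtain a where "F x = {a}" using F1[OF x] card_1_singletonE by blast
    then show ?thesis by (simp add: \<psi>_def)
  qed
  have \<psi>_in: "\<psi> x \<in> C" "(x, \<psi> x) \<in> U" if "x \<in> X" for x using \<psi>[OF that, of "\<psi> x"] by (auto simp: F_def)
  have \<psi>_act: "\<psi> (act T w x) = act T' w (\<psi> x)" if "x \<in> X" "set w \<subseteq> {..<3}" for x w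
  proof -
    have "act T' w (\<psi> x) \<in> F (act T w x)"
      using U_act[OF \<psi>_in(2)[OF that(1)] that(2)] B.act_in[OF that(2) \<psi>_in(1)[OF that(1)]] by (simp add: F_def)
    then show ?thesis using \<psi>[OF A.act_in[OF that(2,1)]] by simp
  qed
  have "inj_on \<psi> X"
  proof (rule ccontr)
    assume "\<not> inj_on \<psi> X"
    then obtain a b where ab: "a \<in> X" "b \<in> X" "a \<noteq> b" "\<psi> a = \<psi> b" by (auto simp: inj_on_def)
    \<comment> \<open>Transitivity spreads one collision to every point. The partner map
      \<open>t\<close> then sends the set \<open>G\<close>, on which \<open>\<psi>\<close> agrees
      with the injection \<open>S\<close>, injectively into its complement; but \<open>G\<close> has
      more than half of the points.\<close>
    have "\<exists>y\<in>X. y \<noteq> x \<and> \<psi> y = \<psi> x" if x: "x \<in> X" for x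
    proof -
      obtain w where w: "set w \<subseteq> {..<3}" "act T w a = x"
        using X(2) ab(1) x unfolding transitive_on_def by blast
      have "act T w b \<noteq> x"
        using A.bij_act[OF w(1)] ab w(2) by (auto simp: bij_betw_def inj_on_def)
      moreover have "\<psi> (act T w b) = \<psi> x" using \<psi>_act[OF ab(1) w(1)] \<psi>_act[OF ab(2) w(1)] ab(4) w(2) by simp
      ultimately show ?thesis using A.act_in[OF w(1) ab(2)] by blast
    qed
    then obtain t where t: "t x \<in> X" "t x \<noteq> x" "\<psi> (t x) = \<psi> x" if "x \<in> X" for x by metis
    define G where "G = fst ` (S \<inter> U)"
    have GX: "G \<subseteq> X" using S(1) by (auto simp: G_def)
    have cG: "card G = card (S \<inter> U)"
      unfolding G_def using S(2) by (intro card_image) (auto simp: inj_on_def)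
    have G\<psi>: "(x, \<psi> x) \<in> S" if x: "x \<in> G" for x
    proof -
      obtain y where "(x, y) \<in> S" "(x, y) \<in> U" using x by (auto simp: G_def)
      moreover then have "y = \<psi> x" using \<psi>[of x y] S(1) by (auto simp: F_def)
      ultimately show ?thesis by simp
    qed
    have inj\<psi>: "x = y" if "x \<in> G" "y \<in> G" "\<psi> x = \<psi> y" for x y
      using inj_onD[OF S(3) _ G\<psi>[OF that(1)] G\<psi>[OF that(2)]] that(3) by simp
    have "inj_on t G" using inj\<psi> t GX by (metis inj_onI subsetD)
    moreover have "t ` G \<subseteq> X - G" 
    proof (intro image_subsetI DiffI notI)
      fix x assume x: "x \<in> G"
      then have xX: "x \<in> X" using GX by blast
      show "t x \<in> X" using t(1)[OF xX] .
      assume "t x \<in> G"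
      then have "t x = x" using inj\<psi>[of "t x" x] x t(3)[OF xX] by simp
      then show False using t(2)[OF xX] by simp
    qed
    ultimately have "card G \<le> card (X - G)" by (intro card_inj_on_le) auto
    then have "2 * card G \<le> card X" using GX by (simp add: card_Diff_subset finite_subset)
    then show False using U0 cG by simp
  qed
  then show ?thesis using \<psi>_in(1) by (intro card_inj_on_le[of \<psi>]) auto
qed

text \<open>At most \<open>N / 10 ^ 9\<close> edges may then be edited, which keeps 32000001 times
  the number of disturbed points below a quarter of all points, as
  \<open>card_le_of_almost_equivariant\<close> demands.\<close>

definition far_eps :: real where "far_eps = 1 / 10 ^ 11"

lemma punctured_far:
  assumes T: "kms_action T {..<Suc N}" "transitive_on T {..<Suc N}" and N: "10 ^ 9 \<le> N"
    and \<epsilon>: "\<epsilon> \<le> far_eps"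
  shows "eps_far 9 \<epsilon> (enc N T) (of_order kms_property (10 * N))"
proof
  assume "eps_close 9 \<epsilon> (enc N T) (of_order kms_property (10 * N))"
  then obtain Y where Y: "Y \<in> kms_property" and vY: "verts Y = {1..10 * N}"
    and dist: "real (card ((edges (enc N T) - edges Y) \<union> (edges Y - edges (enc N T)))) \<le> \<epsilon> * 9 * real (10 * N)"
    unfolding eps_close_def by (auto simp: of_order_def verts_enc)
  interpret E: enc_action T "Suc N" N by (simp add: enc_action_def enc_action_axioms_def kms_def T)
  define H where "H = enc N T"
  define D where "D = (edges H - edges Y) \<union> (edges Y - edges H)"
  have sY: "simple_graph Y" using Y by (auto simp: kms_property_def bounded_degree_graphs_def)
  have sH: "simple_graph H" using E.simple_enc by (simp add: H_def)
  have D: "real (card D) \<le> real N / 10 ^ 9"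
  proof -
    have "real (card D) \<le> \<epsilon> * 9 * real (10 * N)" using dist by (simp add: D_def H_def)
    also have "\<dots> \<le> far_eps * 9 * real (10 * N)" using \<epsilon> by (intro mult_right_mono) auto
    also have "\<dots> \<le> real N / 10 ^ 9" by (simp add: far_eps_def)
    finally show ?thesis .
  qed
  have D2: "e \<subseteq> {1..10 * N} \<and> card e = 2" if "e \<in> D" for e
    using that sY sH vY by (auto simp: D_def simple_graph_def H_def verts_enc)
  have finD: "finite D" by (rule finite_subset[of _ "Pow {1..10 * N}"]) (use D2 in auto)
  define BV where "BV = \<Union>D"
  have BV: "finite BV" "card BV \<le> 2 * card D"
  proof -
    show "finite BV" unfolding BV_def by (rule finite_subset[of _ "{1..10 * N}"]) (use D2 in auto)
    have "card BV \<le> (\<Sum>e\<in>D. card e)" unfolding BV_def by (rule card_Union_le_sum_card)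
    also have "\<dots> = 2 * card D" using D2 by simp
    finally show "card BV \<le> 2 * card D" .
  qed
  have same: "neighbours Y v = neighbours H v" if "v \<notin> BV" for v
    using that by (auto simp: neighbours_def BV_def D_def)
  define BE where "BE = {e. \<exists>j<10. vtx e j \<in> BV}"
  have BE: "finite BE" "card BE \<le> 2 * card D"
  proof -
    have sub: "BE \<subseteq> (\<lambda>v. (v - 1) div 10) ` BV" by (force simp: BE_def vtx_def image_iff)
    then show "finite BE" using BV(1) finite_surj by blast
    have "card BE \<le> card ((\<lambda>v. (v - 1) div 10) ` BV)" using sub BV(1) by (intro card_mono) auto
    also have "\<dots> \<le> card BV" using BV(1) by (rule card_image_le)
    finally show "card BE \<le> 2 * card D" using BV(2) by simp
  qed
  have nb: "neighbours Y (vtx e j) = neighbours H (vtx e j)" if "e \<notin> BE" "j < 10" for e j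
    using that same by (auto simp: BE_def)
  define C where "C = {u. centre Y u}"
  have cen: "vtx e 0 \<in> C" if "e < N" "e \<notin> BE" for e
    using that nb[of e 0] vtx_in[of 0 e N] E.card_neighbours_enc[of e 0]
    by (auto simp: C_def centre_def vY H_def is_port_def)
  define S where "S = (\<lambda>e. (e, vtx e 0)) ` ({..<N} - BE)"
  have st: "decode Y i (vtx e 0) = vtx (T i e) 0"
    if "e < N" "e \<notin> BE" "i < 3" "T i e < N" "T i e \<notin> BE" for i e
  proof -
    have "step Y i (vtx e 0) (vtx (T i e) 0)" unfolding step_def
      using cen[of e] cen[of "T i e"] that E.out_port[of e i] nb[of e 0] nb[of e "Suc i"] nb[of "T i e" "i + 4"]
      by (intro conjI exI[of _ "vtx e (Suc i)"] exI[of _ "vtx (T i e) (i + 4)"]) (auto simp: C_def H_def)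
    then show ?thesis using decode_unique[OF Y] cen[of e] that by (auto simp: C_def)
  qed
  have bad: "card {z \<in> S. map_prod (T i) (decode Y i) z \<notin> S} \<le> 2 * card D + 1" if i: "i < 3" for i
  proof -
    \<comment> \<open>Points sent by \<open>T i\<close> to the deleted point or to a disturbed
      gadget; as \<open>T i\<close> is injective, at most one more than there are disturbed
      gadgets.\<close>
    define b where "b = {e \<in> {..<Suc N}. T i e \<in> insert N BE}"
    have "inj_on (T i) b" using E.bij_T[OF i] by (auto simp: bij_betw_def b_def inj_on_def)
    then have "card b \<le> card (insert N BE)" using BE(1) by (intro card_inj_on_le) (auto simp: b_def)
    also have "\<dots> \<le> 2 * card D + 1" using BE by (simp add: card_insert_if)
    finally have cb: "card b \<le> 2 * card D + 1" .
    have "{z \<in> S. map_prod (T i) (decode Y i) z \<notin> S} \<subseteq> (\<lambda>e. (e, vtx e 0)) ` b"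
    proof
      fix z assume "z \<in> {z \<in> S. map_prod (T i) (decode Y i) z \<notin> S}"
      then obtain e where e: "z = (e, vtx e 0)" "e < N" "e \<notin> BE" "(T i e, decode Y i (vtx e 0)) \<notin> S"
        by (auto simp: S_def)
      have "T i e < Suc N" using E.T_in[OF i, of e] e by simp
      then have "T i e \<in> insert N BE" using e st[OF e(2,3) i] by (cases "T i e = N") (auto simp: S_def)
      then show "z \<in> (\<lambda>e. (e, vtx e 0)) ` b" using e by (auto simp: b_def)
    qed
    then have "card {z \<in> S. map_prod (T i) (decode Y i) z \<notin> S} \<le> card ((\<lambda>e. (e, vtx e 0)) ` b)"
      by (intro card_mono) (auto simp: b_def)
    also have "\<dots> \<le> card b" by (rule card_image_le) (simp add: b_def)
    finally show ?thesis using cb by simp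
  qed
  have "card {..<Suc N} \<le> card C"
  proof (rule card_le_of_almost_equivariant[OF T _ _ _ _ bad])
    show "kms_action (decode Y) C" unfolding C_def by (rule kms_action_decode[OF Y])
    show "S \<subseteq> {..<Suc N} \<times> C" using cen by (auto simp: S_def)
    show "inj_on fst S" "inj_on snd S" by (auto simp: S_def inj_on_def)
    have "N \<le> card ({..<N} - BE) + card BE"
      using card_mono[of "({..<N} - BE) \<union> BE" "{..<N}"] card_Un_le[of "{..<N} - BE" BE] BE(1) by auto
    moreover have "card S = card ({..<N} - BE)" unfolding S_def by (intro card_image) (auto simp: inj_on_def)
    ultimately show "card {..<Suc N} \<le> card S + (2 * card D + 1)" using BE by simp
    show "real (2 * card D + 1) + 32000000 * real (2 * card D + 1) < real (card {..<Suc N}) / 4"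
      using D N by simp
  qed
  moreover have "10 * card C \<le> 10 * N" using card_centres[OF Y] vY by (simp add: C_def)
  ultimately show False by simp
qed

section \<open>Large regular actions\<close>

definition winv :: "nat list \<Rightarrow> nat list" where
  "winv w = concat (map (replicate 4) (rev w))"

lemma winv_Nil [simp]: "winv [] = []" and winv_Cons: "winv (i # w) = winv w @ replicate 4 i"
  by (simp_all add: winv_def)

lemma set_winv [simp]: "set (winv w) = set w"
  by (auto simp: winv_def)

lemma length_winv [simp]: "length (winv w) = 4 * length w"
  by (induction w) (auto simp: winv_Cons)

lemma (in kms) act_winv:
  assumes "set w \<subseteq> {..<3}" "x \<in> X" shows "act T (winv w) (act T w x) = x"
  using assms
proof (induction w)
  case (Cons i w)
  have "(T i ^^ 4) (T i (act T w x)) = act T w x"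
    using T5[of i "act T w x"] Cons.prems act_in[of w x] by (simp add: numeral_eq_Suc)
  then show ?case using Cons by (simp add: winv_Cons act_replicate)
qed simp

text \<open>A word fixing one point fixes all. With transitivity this is regularity of the generated
  permutation group, and it makes all points look alike.\<close>

definition homogeneous :: "(nat \<Rightarrow> 'a \<Rightarrow> 'a) \<Rightarrow> 'a set \<Rightarrow> bool" where
  "homogeneous T X \<longleftrightarrow>
    (\<forall>w x y. set w \<subseteq> {..<3} \<longrightarrow> x \<in> X \<longrightarrow> y \<in> X \<longrightarrow> act T w x = x \<longrightarrow> act T w y = y)"

definition regular_action :: "(nat \<Rightarrow> 'a \<Rightarrow> 'a) \<Rightarrow> 'a set \<Rightarrow> bool" where
  "regular_action T X \<longleftrightarrow> kms_action T X \<and> transitive_on T X \<and> homogeneous T X"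

lemma regular_action_transport:
  assumes T: "regular_action T X" and h: "bij_betw h X Y"
    and eq: "\<And>i x. i < 3 \<Longrightarrow> x \<in> X \<Longrightarrow> h (T i x) = T' i (h x)"
  shows "regular_action T' Y"
proof -
  interpret kms T X using T by unfold_locales (simp add: regular_action_def)
  have hX: "h ` X = Y" and inj: "inj_on h X" using h by (auto simp: bij_betw_def)
  have a: "act T' w (h x) = h (act T w x)" if "set w \<subseteq> {..<3}" "x \<in> X" for w x
  proof -
    have "act T w x \<in> X \<and> h (act T w x) = act T' w (h x)"
      by (rule act_equivariant[OF that]) (simp_all add: T_in eq)
    then show ?thesis by simp
  qed
  have "kms_action T' Y" using kms_action_equivariant[OF kms hX] eq by blast
  moreover have "transitive_on T' Y"
    unfolding transitive_on_def
  proof (intro ballI)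
    fix y y' assume "y \<in> Y" "y' \<in> Y"
    then obtain x x' where x: "x \<in> X" "x' \<in> X" "y = h x" "y' = h x'" using hX by blast
    obtain w where "set w \<subseteq> {..<3}" "act T w x = x'"
      using T x unfolding regular_action_def transitive_on_def by blast
    then show "\<exists>w. set w \<subseteq> {..<3} \<and> act T' w y = y'" using a x by blast
  qed
  moreover have "homogeneous T' Y"
    unfolding homogeneous_def
  proof (intro allI impI)
    fix w y y' assume w: "set w \<subseteq> {..<3}" and "y \<in> Y" "y' \<in> Y" and *: "act T' w y = y"
    then obtain x x' where x: "x \<in> X" "x' \<in> X" "y = h x" "y' = h x'" using hX by blast
    have "h (act T w x) = h x" using * a[OF w x(1)] x by simp
    then have "act T w x = x" using inj act_in[OF w x(1)] x(1) by (auto dest: inj_onD)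
    then have "act T w x' = x'" using T w x(1,2) unfolding regular_action_def homogeneous_def by blast
    then show "act T' w y' = y'" using a[OF w x(2)] x by simp
  qed
  ultimately show ?thesis by (simp add: regular_action_def)
qed

text \<open>The permutation group generated by an action, acting on itself from the left.\<close>

lemma (in kms) ex_regular_action:
  assumes v: "v \<in> X"
  shows "\<exists>N T'. regular_action T' {..<N :: nat} \<and> card {act T w v | w. set w \<subseteq> {..<3}} \<le> N"
proof -
  define W where "W = {w :: nat list. set w \<subseteq> {..<3}}"
  define R where "R w = restrict (act T w) X" for w
  define G where "G = R ` W"
  define S where "S i F = restrict (\<lambda>x. T i (F x)) X" for i F
  have "G \<subseteq> X \<rightarrow>\<^sub>E X" using act_in by (auto simp: G_def R_def W_def)
  then have finG: "finite G" by (rule finite_subset) (simp add: finite_PiE)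
  have SR: "S i (R w) = R (i # w)" for i w by (auto simp: S_def R_def)
  have aR: "act S u (R w) = R (u @ w)" for u w by (induction u) (auto simp: SR)
  have R_eq: "R u = R u' \<longleftrightarrow> (\<forall>x\<in>X. act T u x = act T u' x)" for u u'
    by (auto simp: R_def restrict_def fun_eq_iff)
  have kG: "kms_action S G" unfolding kms_action_def
  proof (intro conjI allI impI ballI finG)
    fix i F assume "i < (3 :: nat)" "F \<in> G" then show "S i F \<in> G" by (auto simp: G_def SR W_def)
  next
    fix r assume r: "r \<in> kms_rels"
    obtain w w' where ww: "r = (w, w')" by (cases r)
    have "act S w (R u) = act S w' (R u)" if "u \<in> W" for u
      using rel[of w w'] r ww act_in[of u] that by (auto simp: aR R_eq W_def)
    then show "case r of (w, w') \<Rightarrow> \<forall>x\<in>G. act S w x = act S w' x" by (auto simp: ww G_def)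
  qed
  moreover have "transitive_on S G"
    unfolding transitive_on_def
  proof (intro ballI)
    fix F F' assume "F \<in> G" "F' \<in> G"
    then obtain u u' where u: "u \<in> W" "u' \<in> W" "F = R u" "F' = R u'" by (auto simp: G_def)
    have "act S (u' @ winv u) F = F'" using act_winv u by (auto simp: aR R_eq W_def)
    moreover have "set (u' @ winv u) \<subseteq> {..<3}" using u by (auto simp: W_def)
    ultimately show "\<exists>w. set w \<subseteq> {..<3} \<and> act S w F = F'" by blast
  qed
  moreover have "homogeneous S G"
    unfolding homogeneous_def
  proof (intro allI impI)
    fix w F F' assume w: "set w \<subseteq> {..<3}" and "F \<in> G" "F' \<in> G" and *: "act S w F = F"
    then obtain u u' where u: "u \<in> W" "u' \<in> W" "F = R u" "F' = R u'" by (auto simp: G_def)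
    have "act T w y = y" if "y \<in> X" for y
    proof -
      have "y \<in> act T u ` X" using bij_act[of u] u that by (auto simp: W_def bij_betw_def)
      then show ?thesis using * u by (auto simp: aR R_eq)
    qed
    then show "act S w F' = F'" using u act_in by (auto simp: aR R_eq W_def)
  qed
  ultimately have rG: "regular_action S G" by (simp add: regular_action_def)
  obtain h where h: "bij_betw h G {0..<card G}" using ex_bij_betw_finite_nat[OF finG] by blast
  define T' where "T' i n = h (S i (inv_into G h n))" for i n
  have "regular_action T' {..<card G}"
  proof (rule regular_action_transport[OF rG])
    show "bij_betw h G {..<card G}" using h by (simp add: atLeast0LessThan)
    show "h (S i F) = T' i (h F)" if "F \<in> G" for i F
      using that h by (simp add: T'_def bij_betw_def inv_into_f_f)
  qed
  moreover have "card {act T w v | w. set w \<subseteq> {..<3}} \<le> card G"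
  proof -
    have "{act T w v | w. set w \<subseteq> {..<3}} \<subseteq> (\<lambda>F. F v) ` G"
      using v by (force simp: G_def R_def W_def image_iff)
    then show ?thesis using finG by (meson card_image_le card_mono finite_imageI le_trans)
  qed
  ultimately show ?thesis by blast
qed

text \<open>
  The matrices \<open>E\<^sub>1\<^sub>2(1), E\<^sub>2\<^sub>3(1), E\<^sub>3\<^sub>1(t)\<close> over the field with five elements, with \<open>t\<^sup>m = 0\<close>, acting
  on triples of polynomials in \<open>t\<close> given by their coefficients.
\<close>

type_synonym poly_triple = "(nat \<Rightarrow> 5) \<times> (nat \<Rightarrow> 5) \<times> (nat \<Rightarrow> 5)"

text \<open>Multiplication by t modulo t^m.\<close>

definition shift :: "nat \<Rightarrow> (nat \<Rightarrow> 5) \<Rightarrow> nat \<Rightarrow> 5" where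
  "shift m p k = (if k = 0 \<or> m \<le> k then 0 else p (k - 1))"

definition elem_mat :: "nat \<Rightarrow> nat \<Rightarrow> poly_triple \<Rightarrow> poly_triple" where
  "elem_mat m i v = (case v of (p, q, r) \<Rightarrow>
     if i = 0 then (\<lambda>k. p k + q k, q, r) else if i = 1 then (p, \<lambda>k. q k + r k, r)
     else (p, q, \<lambda>k. r k + shift m p k))"

definition triples :: "nat \<Rightarrow> poly_triple set" where
  "triples m = {(p, q, r). \<forall>k\<ge>m. p k = 0 \<and> q k = 0 \<and> r k = 0}"

lemma elem_mat_simps [simp]:
  "elem_mat m 0 (p, q, r) = (\<lambda>k. p k + q k, q, r)"
  "elem_mat m (Suc 0) (p, q, r) = (p, \<lambda>k. q k + r k, r)"
  "elem_mat m 2 (p, q, r) = (p, q, \<lambda>k. r k + shift m p k)"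
  by (simp_all add: elem_mat_def)

lemma act_elem_mat_replicate:
  "act (elem_mat m) (replicate n 0) (p, q, r) = (\<lambda>k. p k + of_nat n * q k, q, r)"
  "act (elem_mat m) (replicate n (Suc 0)) (p, q, r) = (p, \<lambda>k. q k + of_nat n * r k, r)"
  "act (elem_mat m) (replicate n 2) (p, q, r) = (p, q, \<lambda>k. r k + of_nat n * shift m p k)"
  by (induction n) (auto simp: fun_eq_iff algebra_simps)

lemma of_nat_5: "(of_nat 5 :: 5) = 0" "(of_nat 4 :: 5) = - 1"
  by simp_all

text \<open>Commutators of elementary matrices are elementary: here E13(1), E21(t), E32(t) and their
  inverses, each commuting with the two generators involved.\<close>

lemma act_elem_mat_comm_word:
  "act (elem_mat m) (comm_word 0 (Suc 0)) (p, q, r) = (\<lambda>k. p k + r k, q, r)"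
  "act (elem_mat m) (comm_word (Suc 0) 0) (p, q, r) = (\<lambda>k. p k - r k, q, r)"
  "act (elem_mat m) (comm_word (Suc 0) 2) (p, q, r) = (p, \<lambda>k. q k + shift m p k, r)"
  "act (elem_mat m) (comm_word 2 (Suc 0)) (p, q, r) = (p, \<lambda>k. q k - shift m p k, r)"
  "act (elem_mat m) (comm_word 2 0) (p, q, r) = (p, q, \<lambda>k. r k + shift m q k)"
  "act (elem_mat m) (comm_word 0 2) (p, q, r) = (p, q, \<lambda>k. r k - shift m q k)"
  unfolding comm_word_def
  by (simp_all only: act_append act_Cons act_Nil act_elem_mat_replicate of_nat_5 elem_mat_simps)
    (auto simp: fun_eq_iff shift_def)

lemma finite_triples: "finite (triples m)"
proof -
  define S where "S = {p :: nat \<Rightarrow> 5. \<forall>k. (k \<in> {..<m} \<longrightarrow> p k \<in> UNIV) \<and> (k \<notin> {..<m} \<longrightarrow> p k = 0)}"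
  have "finite S" unfolding S_def by (rule finite_set_of_finite_funs) auto
  moreover have "triples m \<subseteq> S \<times> S \<times> S" by (auto simp: triples_def S_def)
  ultimately show ?thesis by (meson finite_SigmaI finite_subset)
qed

lemma kms_action_elem_mat: "kms_action (elem_mat m) (triples m)"
  unfolding kms_action_def
proof (intro conjI allI impI ballI finite_triples)
  fix i v assume "v \<in> triples m"
  then show "elem_mat m i v \<in> triples m"
    by (auto simp: triples_def elem_mat_def shift_def split: if_splits)
next
  fix r assume "r \<in> kms_rels"
  then consider i where "i < 3" "r = (replicate 5 i, [])"
    | i j where "i < 3" "j < 3" "i \<noteq> j"
      "r = (comm_word i j @ [i], i # comm_word i j) \<or> r = (comm_word i j @ [j], j # comm_word i j)"
    by (auto simp: kms_rels_def)
  moreover have lt3: "i = 0 \<or> i = Suc 0 \<or> i = 2" if "i < 3" for i :: nat using that by auto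
  ultimately have "act (elem_mat m) (fst r) (p, q, r') = act (elem_mat m) (snd r) (p, q, r')" for p q r'
  proof cases
    case 1
    then have *: "r = (replicate 5 i, [])" "i = 0 \<or> i = Suc 0 \<or> i = 2" using lt3 by auto
    from *(2) show ?thesis unfolding *(1)
      by (elim disjE) (simp_all only: fst_conv snd_conv act_elem_mat_replicate of_nat_5 act_Nil, simp_all)
  next
    case 2
    from lt3[OF 2(1)] lt3[OF 2(2)] 2(3,4) show ?thesis
      by - (elim disjE; simp add: act_elem_mat_comm_word; simp add: fun_eq_iff shift_def)
  qed
  then show "case r of (w, w') \<Rightarrow> \<forall>x\<in>triples m. act (elem_mat m) w x = act (elem_mat m) w' x"
    by (cases r) auto
qed

lemma ex_large_regular_action: "\<exists>N\<ge>m. \<exists>T. regular_action T {..<N :: nat}"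
proof -
  interpret kms "elem_mat m" "triples m" by unfold_locales (rule kms_action_elem_mat)
  \<comment> \<open>The constant polynomial 1 in the first slot; the guard \<open>0 < m\<close>
    keeps it in \<open>triples 0\<close>.\<close>
  define v :: poly_triple where "v = (\<lambda>k. if k = 0 \<and> 0 < m then 1 else 0, \<lambda>_. 0, \<lambda>_. 0)"
  have v: "v \<in> triples m" by (auto simp: v_def triples_def)
  \<comment> \<open>One round through the generators, E31(t) first, carries the leading term of the
    first slot one degree up, so \<open>m\<close> distinct points of the orbit are reached.\<close>
  define w where "w j = concat (replicate j [0, 1, 2 :: nat])" for j
  have w: "set (w j) \<subseteq> {..<3}" for j by (auto simp: w_def)
  define x where "x j = act (elem_mat m) (w j) v" for j
  have deg: "fst (x j) j = 1 \<and> (\<forall>k>j. fst (x j) k = 0 \<and> fst (snd (x j)) k = 0 \<and> snd (snd (x j)) k = 0)"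
    if "j < m" for j using that
  proof (induction j)
    case 0 then show ?case by (simp add: x_def w_def v_def)
  next
    case (Suc j)
    obtain p q r where pqr: "x j = (p, q, r)" by (cases "x j")
    have "x (Suc j) = elem_mat m 0 (elem_mat m 1 (elem_mat m 2 (p, q, r)))"
      using pqr by (simp add: x_def w_def)
    then show ?case using Suc pqr by (auto simp: elem_mat_def shift_def)
  qed
  have "inj_on x {..<m}"
  proof (rule linorder_inj_onI')
    fix i j assume "i \<in> {..<m}" "j \<in> {..<m}" "i < j"
    then have "fst (x i) j = 0" "fst (x j) j = 1" using deg[of i] deg[of j] by auto
    then show "x i \<noteq> x j" by auto
  qed
  then have "m = card (x ` {..<m})" by (simp add: card_image)
  also have "\<dots> \<le> card {act (elem_mat m) w v | w. set w \<subseteq> {..<3}}"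
    by (rule card_mono[OF finite_subset[OF _ fin]]) (use w act_in[OF _ v] in \<open>auto simp: x_def\<close>)
  finally show ?thesis using ex_regular_action[OF v] order_trans by blast
qed

text \<open>The short words that fix the base point; in a regular action they determine the local
  structure at every point.\<close>

definition pattern :: "nat \<Rightarrow> (nat \<Rightarrow> nat \<Rightarrow> nat) \<Rightarrow> nat list set" where
  "pattern \<rho> T = {w \<in> words \<rho>. act T w 0 = 0}"

text \<open>There are finitely many patterns and arbitrarily large regular actions, so one pattern
  recurs at unbounded sizes.\<close>

lemma ex_regular_actions_same_pattern:
  "\<exists>K T0. 0 < K \<and> regular_action T0 {..<K :: nat} \<and>
    (\<forall>m. \<exists>N\<ge>m. \<exists>T. regular_action T {..<Suc N} \<and> pattern \<rho> T = pattern \<rho> T0)"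
proof -
  obtain N T where NT: "\<And>m. m \<le> N m \<and> regular_action (T m) {..<N m :: nat}"
    using ex_large_regular_action by metis
  have "finite ((\<lambda>m. pattern \<rho> (T m)) ` {1..})"
    by (rule finite_subset[of _ "Pow (words \<rho>)"]) (auto simp: pattern_def)
  then obtain a where a: "a \<in> {1..}" "infinite {b \<in> {1..}. pattern \<rho> (T b) = pattern \<rho> (T a)}"
    using pigeonhole_infinite[of "{1 :: nat..}" "\<lambda>m. pattern \<rho> (T m)"] infinite_Ici by blast
  show ?thesis
  proof (rule exI[of _ "N a"], rule exI[of _ "T a"], intro conjI allI)
    show "0 < N a" using NT[of a] a(1) by simp
    show "regular_action (T a) {..<N a}" using NT by blast
    fix m
    obtain b where b: "b > m" "b \<in> {b \<in> {1..}. pattern \<rho> (T b) = pattern \<rho> (T a)}"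
      using a(2) by (meson infinite_nat_iff_unbounded)
    obtain n where n: "N b = Suc n" using NT[of b] b by (cases "N b") auto
    have "m \<le> n" using NT[of b] b n by simp
    then show "\<exists>N\<ge>m. \<exists>T'. regular_action T' {..<Suc N} \<and> pattern \<rho> T' = pattern \<rho> (T a)"
      using b n NT[of b] by (intro exI[of _ n] conjI exI[of _ "T b"]) auto
  qed
qed

section \<open>Locally indistinguishable actions\<close>

lemma words_append: "v \<in> words a \<Longrightarrow> w \<in> words b \<Longrightarrow> v @ w \<in> words (a + b)"
  and words_winv: "w \<in> words a \<Longrightarrow> winv w \<in> words (4 * a)"
  and words_mono: "w \<in> words a \<Longrightarrow> a \<le> b \<Longrightarrow> w \<in> words b"
  and Nil_words [simp]: "[] \<in> words a"
  and words_set: "w \<in> words a \<Longrightarrow> set w \<subseteq> {..<3}"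
  by (auto simp: words_def)

lemma (in kms) act_winv_eq_iff:
  assumes "set w \<subseteq> {..<3}" "z \<in> X" "x \<in> X"
  shows "act T (winv w) z = x \<longleftrightarrow> z = act T w x"
proof
  assume "act T (winv w) z = x"
  then have "act T (winv w) z = act T (winv w) (act T w x)" using act_winv assms by simp
  moreover have "inj_on (act T (winv w)) X" using bij_act[of "winv w"] assms by (simp add: bij_betw_def)
  ultimately show "z = act T w x" using assms act_in[of w x] by (auto dest: inj_onD)
next
  assume "z = act T w x"
  then show "act T (winv w) z = x" by (simp add: act_winv[OF assms(1,3)])
qed

text \<open>
  \<open>T1\<close> acts on \<open>N\<close> points, \<open>T2\<close> on \<open>N + 1\<close> points the last of which will be deleted; most orbits of
  \<open>T1\<close> (those of points of \<open>G\<close>) look like the orbits of \<open>T2\<close> up to radius \<open>R\<close>.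
\<close>

locale lookalike =
  A: kms T1 "{..<N}" + B: kms T2 "{..<Suc N}"
  for T1 T2 :: "nat \<Rightarrow> nat \<Rightarrow> nat" and N :: nat +
  fixes R :: nat and G :: "nat set"
  assumes G: "G \<subseteq> {..<N}"
    and same: "\<And>x y w. x \<in> G \<Longrightarrow> y < Suc N \<Longrightarrow> w \<in> words R \<Longrightarrow> act T1 w x = x \<longleftrightarrow> act T2 w y = y"
begin

text \<open>A partial isomorphism of local structure: matched points have the same incidences along
  words up to length \<rho>, and the second action does not meet the deleted point within that
  length. The empty word makes \<open>D\<close> a partial injection.\<close>

definition corr :: "nat \<Rightarrow> (nat \<times> nat) set \<Rightarrow> bool" where
  "corr \<rho> D \<longleftrightarrow> (\<forall>x y. (x, y) \<in> D \<longrightarrow> x < N \<and> y < N \<and> (\<forall>w\<in>words \<rho>. act T2 w y \<noteq> N) \<and>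
    (\<forall>x' y'. \<forall>w\<in>words \<rho>. (x', y') \<in> D \<longrightarrow> (act T1 w x = x' \<longleftrightarrow> act T2 w y = y')))"

lemma corr_empty [simp]: "corr \<rho> {}" by (simp add: corr_def)

lemma corrD:
  assumes "corr \<rho> D" "(x, y) \<in> D"
  shows "x < N" "y < N" "w \<in> words \<rho> \<Longrightarrow> act T2 w y \<noteq> N"
    "(x', y') \<in> D \<Longrightarrow> w \<in> words \<rho> \<Longrightarrow> act T1 w x = x' \<longleftrightarrow> act T2 w y = y'"
proof -
  note * = assms(1)[unfolded corr_def, THEN spec, THEN spec, THEN mp, OF assms(2)]
  show "x < N" "y < N" using * by blast+
  show "act T2 w y \<noteq> N" if "w \<in> words \<rho>" using * that by blast
  show "act T1 w x = x' \<longleftrightarrow> act T2 w y = y'" if "(x', y') \<in> D" "w \<in> words \<rho>"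
    using * that by blast
qed

lemma corrI:
  assumes "\<And>x y. (x, y) \<in> D \<Longrightarrow> x < N \<and> y < N"
    and "\<And>x y w. (x, y) \<in> D \<Longrightarrow> w \<in> words \<rho> \<Longrightarrow> act T2 w y \<noteq> N"
    and "\<And>x y x' y' w. (x, y) \<in> D \<Longrightarrow> (x', y') \<in> D \<Longrightarrow> w \<in> words \<rho> \<Longrightarrow>
      act T1 w x = x' \<longleftrightarrow> act T2 w y = y'"
  shows "corr \<rho> D"
  unfolding corr_def using assms by simp

lemma corr_mono: assumes "corr \<rho> D" "\<rho>' \<le> \<rho>" "D' \<subseteq> D" shows "corr \<rho>' D'"
proof (rule corrI)
  fix x y assume "(x, y) \<in> D'"
  then have xy: "(x, y) \<in> D" using assms(3) by blast
  show "x < N \<and> y < N" using corrD[OF assms(1) xy] by blast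
  fix w assume "w \<in> words \<rho>'"
  then have w: "w \<in> words \<rho>" using words_mono assms(2) by blast
  show "act T2 w y \<noteq> N" by (rule corrD(3)[OF assms(1) xy w])
  fix x' y' assume "(x', y') \<in> D'"
  then show "act T1 w x = x' \<longleftrightarrow> act T2 w y = y'"
    using corrD(4)[OF assms(1) xy _ w] assms(3) by blast
qed

lemma act1_less: "w \<in> words a \<Longrightarrow> x < N \<Longrightarrow> act T1 w x < N"
  using A.act_in[OF words_set, of w a x] by simp
lemma act2_less: "w \<in> words a \<Longrightarrow> x < Suc N \<Longrightarrow> act T2 w x < Suc N"
  using B.act_in[OF words_set, of w a x] by simp

definition spread :: "nat \<Rightarrow> (nat \<times> nat) set \<Rightarrow> (nat \<times> nat) set" where
  "spread \<kappa> D = {(act T1 w x, act T2 w y) | w x y. (x, y) \<in> D \<and> w \<in> words \<kappa>}"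

lemma subset_spread: "D \<subseteq> spread \<kappa> D"
proof
  fix z assume "z \<in> D"
  then show "z \<in> spread \<kappa> D" unfolding spread_def
    by (intro CollectI exI[of _ "[]"] exI[of _ "fst z"] exI[of _ "snd z"]) simp
qed

text \<open>An incidence by \<open>u\<close> between points reached by \<open>w\<close> and
  \<open>w'\<close> is one by \<open>winv w' @ u @ w\<close> between the old points. Inverse words
  are four times as long, hence the cost 4 \<kappa> + \<kappa>.\<close>

lemma corr_spread:
  assumes D: "corr \<rho> D" and le: "5 * \<kappa> + \<rho>' \<le> \<rho>"
  shows "corr \<rho>' (spread \<kappa> D)"
proof (rule corrI)
  fix p q assume "(p, q) \<in> spread \<kappa> D"
  then obtain w x y where z: "p = act T1 w x" "q = act T2 w y" "(x, y) \<in> D" "w \<in> words \<kappa>"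
    by (auto simp: spread_def)
  have xy: "x < N" "y < N" using corrD[OF D z(3)] by auto
  have good: "act T2 u q \<noteq> N" if "u \<in> words \<rho>'" for u
  proof -
    have "u @ w \<in> words \<rho>" using words_mono[OF words_append[OF that z(4)]] le by simp
    then show ?thesis using corrD(3)[OF D z(3), of "u @ w"] z(2) by simp
  qed
  have "q < Suc N" using act2_less[OF z(4), of y] xy z(2) by simp
  moreover have "q \<noteq> N" using good[of "[]"] by simp
  ultimately show "p < N \<and> q < N" using act1_less[OF z(4) xy(1)] z(1) by simp
  show "act T2 u q \<noteq> N" if "u \<in> words \<rho>'" for u using good that .
  fix p' q' u assume "(p', q') \<in> spread \<kappa> D" and u: "u \<in> words \<rho>'"
  then obtain w' x' y' where z': "p' = act T1 w' x'" "q' = act T2 w' y'" "(x', y') \<in> D" "w' \<in> words \<kappa>"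
    by (auto simp: spread_def)
  have xy': "x' < N" "y' < N" using corrD[OF D z'(3)] by auto
  have l: "act T1 u p < N" "act T2 u q < Suc N"
    using act1_less[OF u act1_less[OF z(4) xy(1)]] act2_less[OF u act2_less[OF z(4), of y]] xy z by auto
  have "winv w' @ u @ w \<in> words \<rho>"
    using words_mono[OF words_append[OF words_winv[OF z'(4)] words_append[OF u z(4)]]] le by simp
  then have "act T1 (winv w') (act T1 u p) = x' \<longleftrightarrow> act T2 (winv w') (act T2 u q) = y'"
    using corrD(4)[OF D z(3) z'(3), of "winv w' @ u @ w"] z by simp
  then show "act T1 u p = p' \<longleftrightarrow> act T2 u q = q'"
    using A.act_winv_eq_iff[OF words_set[OF z'(4)], of "act T1 u p" x']
      B.act_winv_eq_iff[OF words_set[OF z'(4)], of "act T2 u q" y'] l xy' z' by simp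
qed

text \<open>The factor 4 again accounts for \<open>winv\<close>: from outside this set no word up to
  length \<rho> leads into \<open>E\<close>, nor from \<open>E\<close> back.\<close>

definition near1 :: "nat \<Rightarrow> nat set \<Rightarrow> nat set" where
  "near1 \<rho> E = (\<lambda>(w, x). act T1 w x) ` (words (4 * \<rho>) \<times> E)"
definition near2 :: "nat \<Rightarrow> nat set \<Rightarrow> nat set" where
  "near2 \<rho> E = (\<lambda>(w, x). act T2 w x) ` (words (4 * \<rho>) \<times> E)"

lemma card_near:
  assumes "finite E"
  shows "finite (near1 \<rho> E)" "card (near1 \<rho> E) \<le> card (words (4 * \<rho>)) * card E"
    "finite (near2 \<rho> E)" "card (near2 \<rho> E) \<le> card (words (4 * \<rho>)) * card E"
  using assms card_image_le[of "words (4 * \<rho>) \<times> E"] unfolding near1_def near2_def card_cartesian_product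
  by simp_all

text \<open>The new points have no incidences with the old ones on either side, and their incidences
  with themselves agree by \<open>same\<close>. Distance from \<open>N\<close> keeps
  \<open>y\<close> clear of the deleted point.\<close>

lemma corr_far:
  assumes D: "corr \<rho> D" and \<rho>: "\<rho> \<le> R" and x: "x \<in> G" "x \<notin> near1 \<rho> (fst ` D)"
    and y: "y < N" "y \<notin> near2 \<rho> (insert N (snd ` D))"
  shows "corr \<rho> (insert (x, y) D)"
proof -
  have xN: "x < N" using G x by auto
  have n1: "act T1 w x' \<noteq> x" "act T1 w x \<noteq> x'" if "(x', y') \<in> D" "w \<in> words \<rho>" for x' y' w
  proof -
    have w4: "w \<in> words (4 * \<rho>)" "winv w \<in> words (4 * \<rho>)"
      using words_mono[OF that(2), of "4 * \<rho>"] words_winv[OF that(2)] by auto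
    show "act T1 w x' \<noteq> x" using x(2) w4(1) that(1) by (force simp: near1_def)
    have "act T1 (winv w) x' \<noteq> x" using x(2) w4(2) that(1) by (force simp: near1_def)
    then show "act T1 w x \<noteq> x'" using A.act_winv[OF words_set[OF that(2)]] xN by auto
  qed
  have n2: "act T2 w y' \<noteq> y" "act T2 w y \<noteq> y'" if "y' \<in> insert N (snd ` D)" "w \<in> words \<rho>" for y' w
  proof -
    have w4: "w \<in> words (4 * \<rho>)" "winv w \<in> words (4 * \<rho>)"
      using words_mono[OF that(2), of "4 * \<rho>"] words_winv[OF that(2)] by auto
    show "act T2 w y' \<noteq> y" using y(2) w4(1) that(1) by (auto simp: near2_def image_iff)
    have "act T2 (winv w) y' \<noteq> y" using y(2) w4(2) that(1) by (auto simp: near2_def image_iff)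
    then show "act T2 w y \<noteq> y'" using B.act_winv[OF words_set[OF that(2)], of y] y(1) by auto
  qed
  show ?thesis
  proof (rule corrI)
    fix p q assume z: "(p, q) \<in> insert (x, y) D"
    show "p < N \<and> q < N" using z xN y(1) corrD(1,2)[OF D] by auto
    show "act T2 w q \<noteq> N" if "w \<in> words \<rho>" for w
      using z n2(2)[of N w] corrD(3)[OF D, of p q w] that by auto
    fix p' q' w assume z': "(p', q') \<in> insert (x, y) D" and w: "w \<in> words \<rho>"
    consider "p = x" "q = y" "p' = x" "q' = y" | "p = x" "q = y" "(p', q') \<in> D"
      | "(p, q) \<in> D" "p' = x" "q' = y" | "(p, q) \<in> D" "(p', q') \<in> D" using z z' by blast
    then show "act T1 w p = p' \<longleftrightarrow> act T2 w q = q'"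
    proof cases
      case 1 then show ?thesis using same[OF x(1), of y w] words_mono[OF w \<rho>] y(1) by simp
    next
      case 2
      then have "q' \<in> insert N (snd ` D)" by force
      then show ?thesis using n1(2)[OF 2(3) w] n2(2)[OF _ w, of q'] 2 by simp
    next
      case 3
      then have "q \<in> insert N (snd ` D)" by force
      then show ?thesis using n1(1)[OF 3(1) w] n2(1)[OF _ w, of q] 3 by simp
    next
      case 4 then show ?thesis using corrD(4)[OF D 4 w] by simp
    qed
  qed
qed

text \<open>The points of \<open>E\<close> are matched one by one. If a point is near an earlier one
  its partner is forced, by spreading with \<kappa> = 4 \<rho>; otherwise any far point of
  \<open>G\<close> serves, and \<open>G\<close> is too large to be exhausted. The first case
  dictates the loss of radius by a factor 5 * 4 + 1 = 21.\<close>

lemma corr_cover: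
  assumes "finite E" "\<And>y w. y \<in> E \<Longrightarrow> w \<in> words (21 ^ card E * \<rho>) \<Longrightarrow> act T2 w y \<noteq> N"
    "E \<subseteq> {..<N}" "21 ^ card E * \<rho> \<le> R" "card (words (4 * R)) * card E < card G"
  shows "\<exists>D. finite D \<and> corr \<rho> D \<and> snd ` D = E \<and> card D \<le> card E"
  using assms
proof (induction E arbitrary: \<rho> rule: finite_induct)
  case empty
  then show ?case by (intro exI[of _ "{}"]) simp
next
  case (insert y E)
  have "\<exists>D. finite D \<and> corr (21 * \<rho>) D \<and> snd ` D = E \<and> card D \<le> card E"
  proof (rule insert.IH)
    show "E \<subseteq> {..<N}" "21 ^ card E * (21 * \<rho>) \<le> R" "card (words (4 * R)) * card E < card G"
      using insert.prems insert.hyps by auto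
    show "act T2 w y \<noteq> N" if "y \<in> E" "w \<in> words (21 ^ card E * (21 * \<rho>))" for y w
      using insert.prems(1)[of y w] that insert.hyps by (simp add: mult_ac)
  qed
  then obtain D where D: "finite D" "corr (21 * \<rho>) D" "snd ` D = E" "card D \<le> card E" by blast
  have y21: "act T2 w y \<noteq> N" if "w \<in> words (21 * \<rho>)" for w
  proof -
    have "21 * \<rho> \<le> 21 ^ card (insert y E) * \<rho>" using insert.hyps by simp
    then show ?thesis using insert.prems(1)[of y w] words_mono[OF that] by simp
  qed
  have "\<exists>x. corr \<rho> (insert (x, y) D)"
  proof (cases "y \<in> near2 \<rho> E")
    case True
    then obtain w x' y' where w: "w \<in> words (4 * \<rho>)" "(x', y') \<in> D" "y = act T2 w y'"
      using D(3) by (auto simp: near2_def)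
    have "corr \<rho> (spread (4 * \<rho>) D)" by (rule corr_spread[OF D(2)]) simp
    moreover have "insert (act T1 w x', y) D \<subseteq> spread (4 * \<rho>) D"
      using w subset_spread by (auto simp: spread_def)
    ultimately show ?thesis using corr_mono by blast
  next
    case False
    have "1 * \<rho> \<le> 21 ^ card (insert y E) * \<rho>" by (rule mult_le_mono1) simp
    then have \<rho>R: "\<rho> \<le> R" using insert.prems(3) by linarith
    have "card (near1 \<rho> (fst ` D)) \<le> card (words (4 * \<rho>)) * card (fst ` D)"
      using card_near(2) D(1) by blast
    also have "\<dots> \<le> card (words (4 * R)) * card (insert y E)"
    proof (rule mult_le_mono)
      show "card (words (4 * \<rho>)) \<le> card (words (4 * R))"
        by (rule card_mono) (use words_mono \<rho>R in auto)
      show "card (fst ` D) \<le> card (insert y E)"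
        using D(1,4) insert.hyps card_image_le[OF D(1), of fst] by simp
    qed
    also have "\<dots> < card G" by fact
    finally have "\<not> G \<subseteq> near1 \<rho> (fst ` D)"
      using card_mono[OF card_near(1)[of "fst ` D" \<rho>], of G] D(1) by auto
    then obtain x where x: "x \<in> G" "x \<notin> near1 \<rho> (fst ` D)" by blast
    have "y \<notin> near2 \<rho> {N}"
    proof
      assume "y \<in> near2 \<rho> {N}"
      then obtain w where w: "w \<in> words (4 * \<rho>)" "y = act T2 w N" by (auto simp: near2_def)
      have "act T2 (winv w) y = N" using B.act_winv[OF words_set[OF w(1)], of N] w(2) by simp
      moreover have "winv w \<in> words (21 * \<rho>)" using words_mono[OF words_winv[OF w(1)], of "21 * \<rho>"] by simp
      ultimately show False using y21 by blast
    qed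
    then have "y \<notin> near2 \<rho> (insert N (snd ` D))" using False D(3) by (auto simp: near2_def)
    then have "corr \<rho> (insert (x, y) D)"
      using corr_far[OF corr_mono[OF D(2)] \<rho>R x] insert.prems by auto
    then show ?thesis by blast
  qed
  then obtain x where "corr \<rho> (insert (x, y) D)" by blast
  then show ?case using D insert.hyps
    by (intro exI[of _ "insert (x, y) D"]) (auto simp: card_insert_if)
qed

end

section \<open>Random relabellings\<close>

text \<open>A permutation sends labels to points; these are the ones consistent with the labels
  \<open>L\<close> revealed so far.\<close>

definition perms_ext :: "nat \<Rightarrow> nat set \<Rightarrow> (nat \<Rightarrow> nat) \<Rightarrow> (nat \<Rightarrow> nat) set" where
  "perms_ext N L g = {\<pi>. \<pi> permutes {..<N} \<and> (\<forall>l\<in>L. \<pi> l = g l)}"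

lemma finite_perms_ext [simp]: "finite (perms_ext N L g)"
  by (rule finite_subset[OF _ finite_permutations[of "{..<N}"]]) (auto simp: perms_ext_def)

definition partial_inj :: "nat \<Rightarrow> nat set \<Rightarrow> (nat \<Rightarrow> nat) \<Rightarrow> bool" where
  "partial_inj N L g \<longleftrightarrow> L \<subseteq> {..<N} \<and> inj_on g L \<and> g ` L \<subseteq> {..<N}"

lemma partial_inj_insert:
  assumes "partial_inj N L g" "l \<in> {..<N} - L" "x \<in> {..<N} - g ` L"
  shows "partial_inj N (insert l L) (g(l := x))"
proof -
  have "inj_on (g(l := x)) L" using assms by (auto simp: partial_inj_def inj_on_def)
  then show ?thesis using assms by (auto simp: partial_inj_def)
qed

lemma partial_inj_finite: "partial_inj N L g \<Longrightarrow> finite L"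
  by (auto simp: partial_inj_def intro: finite_subset)

text \<open>Case split by the point behind a fresh label, as when an unexplored gadget is queried.
  Its counterpart \<open>sum_perms_ext_elem\<close> splits by the label of a fresh point, as when a
  port leads out of the explored part.\<close>

lemma sum_perms_ext_label:
  assumes g: "partial_inj N L g" and l: "l \<in> {..<N} - L"
  shows "sum \<phi> (perms_ext N L g) =
    (\<Sum>x\<in>{..<N} - g ` L. sum \<phi> (perms_ext N (insert l L) (g(l := x))))"
proof -
  have "perms_ext N L g = (\<Union>x\<in>{..<N} - g ` L. perms_ext N (insert l L) (g(l := x)))"
  proof (intro equalityI subsetI)
    fix \<pi> assume \<pi>: "\<pi> \<in> perms_ext N L g"
    have "\<pi> l \<in> {..<N}" using \<pi> l by (auto simp: perms_ext_def permutes_in_image dest: permutes_in_image)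
    moreover have "\<pi> l \<notin> g ` L"
    proof
      assume "\<pi> l \<in> g ` L"
      then obtain k where k: "k \<in> L" "\<pi> l = \<pi> k" using \<pi> by (auto simp: perms_ext_def)
      have "inj \<pi>" using \<pi> by (auto simp: perms_ext_def intro: permutes_inj)
      then have "l = k" using k(2) by (rule injD)
      then show False using k(1) l by simp
    qed
    ultimately show "\<pi> \<in> (\<Union>x\<in>{..<N} - g ` L. perms_ext N (insert l L) (g(l := x)))"
      using \<pi> by (auto simp: perms_ext_def)
  next
    fix \<pi> assume "\<pi> \<in> (\<Union>x\<in>{..<N} - g ` L. perms_ext N (insert l L) (g(l := x)))"
    then obtain x where "\<pi> \<in> perms_ext N (insert l L) (g(l := x))" by blast
    then have x: "\<pi> permutes {..<N}" "\<And>k. k \<in> insert l L \<Longrightarrow> \<pi> k = (g(l := x)) k"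
      by (auto simp: perms_ext_def)
    have "\<pi> k = g k" if "k \<in> L" for k using x(2)[of k] that l by auto
    then show "\<pi> \<in> perms_ext N L g" using x(1) by (simp add: perms_ext_def)
  qed
  moreover have "perms_ext N (insert l L) (g(l := x)) \<inter> perms_ext N (insert l L) (g(l := x')) = {}"
    if "x \<noteq> x'" for x x' using that by (auto simp: perms_ext_def)
  ultimately show ?thesis by (simp add: sum.UNION_disjoint)
qed

lemma sum_perms_ext_elem:
  assumes g: "partial_inj N L g" and x: "x \<in> {..<N} - g ` L"
  shows "sum \<phi> (perms_ext N L g) =
    (\<Sum>l\<in>{..<N} - L. sum \<phi> (perms_ext N (insert l L) (g(l := x))))"
proof -
  have "perms_ext N L g = (\<Union>l\<in>{..<N} - L. perms_ext N (insert l L) (g(l := x)))"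
  proof (intro equalityI subsetI)
    fix \<pi> assume \<pi>: "\<pi> \<in> perms_ext N L g"
    then have p: "\<pi> permutes {..<N}" by (simp add: perms_ext_def)
    define l where "l = inv \<pi> x"
    have l: "\<pi> l = x" using permutes_inverses(1)[OF p] by (simp add: l_def)
    have "l < N" using permutes_in_image[OF p, of l] l x by simp
    moreover have "l \<notin> L" using \<pi> l x by (auto simp: perms_ext_def)
    ultimately show "\<pi> \<in> (\<Union>l\<in>{..<N} - L. perms_ext N (insert l L) (g(l := x)))"
      using \<pi> l by (auto simp: perms_ext_def)
  next
    fix \<pi> assume "\<pi> \<in> (\<Union>l\<in>{..<N} - L. perms_ext N (insert l L) (g(l := x)))"
    then obtain l where "l \<in> {..<N} - L" "\<pi> \<in> perms_ext N (insert l L) (g(l := x))" by blast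
    then have l: "l \<in> {..<N} - L" "\<pi> permutes {..<N}" "\<And>k. k \<in> insert l L \<Longrightarrow> \<pi> k = (g(l := x)) k"
      by (auto simp: perms_ext_def)
    have "\<pi> k = g k" if "k \<in> L" for k using l(3)[of k] that l(1) by auto
    then show "\<pi> \<in> perms_ext N L g" using l(2) by (simp add: perms_ext_def)
  qed
  moreover have "perms_ext N (insert l L) (g(l := x)) \<inter> perms_ext N (insert l' L) (g(l' := x)) = {}"
    if "l \<noteq> l'" for l l' 
  proof (rule ccontr)
    assume "\<not> ?thesis"
    then obtain \<pi> where "\<pi> permutes {..<N}" "\<pi> l = x" "\<pi> l' = x" by (auto simp: perms_ext_def)
    then show False using that by (metis permutes_inverses(2))
  qed
  ultimately show ?thesis by (simp add: sum.UNION_disjoint)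
qed

lemma card_perms_ext:
  assumes "partial_inj N L g" shows "card (perms_ext N L g) = fact (N - card L)"
  using assms
proof (induction "N - card L" arbitrary: L g)
  case 0
  have L: "L \<subseteq> {..<N}" "inj_on g L" "g ` L \<subseteq> {..<N}" using 0 by (auto simp: partial_inj_def)
  then have "L = {..<N}" using 0 by (intro card_subset_eq) (auto dest: card_mono[rotated])
  define \<pi> where "\<pi> l = (if l < N then g l else l)" for l
  have "\<pi> permutes {..<N}"
    using L \<open>L = {..<N}\<close> by (intro inj_imp_permutes) (auto simp: \<pi>_def inj_on_def)
  then have "perms_ext N L g = {\<pi>}"
    using \<open>L = {..<N}\<close> by (auto simp: perms_ext_def \<pi>_def fun_eq_iff permutes_not_in)
  then show ?case using 0 by simp
next
  case (Suc n)
  have L: "L \<subseteq> {..<N}" "finite L" using Suc.prems partial_inj_finite by (auto simp: partial_inj_def)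
  then obtain l where l: "l \<in> {..<N} - L"
    using Suc.hyps(2) by (metis DiffI card_lessThan diff_self_eq_0 lessI not_less_zero subsetI subset_antisym)
  have cg: "card (g ` L) = card L" using Suc.prems by (auto simp: partial_inj_def card_image)
  have "card (perms_ext N L g) = (\<Sum>x\<in>{..<N} - g ` L. card (perms_ext N (insert l L) (g(l := x))))"
    using sum_perms_ext_label[OF Suc.prems l, of "\<lambda>_. 1 :: nat"] by simp
  also have "\<dots> = (\<Sum>x\<in>{..<N} - g ` L. fact n)"
  proof (rule sum.cong[OF refl])
    fix x assume x: "x \<in> {..<N} - g ` L"
    have "n = N - card (insert l L)" using Suc.hyps(2) l L by simp
    then show "card (perms_ext N (insert l L) (g(l := x))) = fact n"
      using Suc.hyps(1) partial_inj_insert[OF Suc.prems l x] by simp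
  qed
  also have "\<dots> = (N - card L) * fact n"
    using Suc.prems cg L by (simp add: partial_inj_def card_Diff_subset)
  also have "\<dots> = fact (N - card L)" using Suc.hyps(2) by (metis fact_Suc of_nat_id)
  finally show ?case .
qed

definition avg :: "nat \<Rightarrow> nat set \<Rightarrow> (nat \<Rightarrow> nat) \<Rightarrow> ((nat \<Rightarrow> nat) \<Rightarrow> real) \<Rightarrow> real" where
  "avg N L g \<phi> = sum \<phi> (perms_ext N L g) / card (perms_ext N L g)"

text \<open>By \<open>card_perms_ext\<close> all blocks have the same size, so the conditional
  averages enter with equal weight.\<close>

lemma avg_aux:
  assumes g: "partial_inj N L g" and "finite I" "card I = N - card L" "card L < N"
    and p: "\<And>i. i \<in> I \<Longrightarrow> partial_inj N (insert (a i) L) (g(a i := b i)) \<and> a i \<notin> L"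
    and s: "sum \<phi> (perms_ext N L g) = (\<Sum>i\<in>I. sum \<phi> (perms_ext N (insert (a i) L) (g(a i := b i))))"
  shows "avg N L g \<phi> = (\<Sum>i\<in>I. avg N (insert (a i) L) (g(a i := b i)) \<phi>) / (N - card L)"
proof -
  obtain n where n: "N - card L = Suc n" using assms(4) by (metis Suc_diff_Suc)
  have c: "card (perms_ext N (insert (a i) L) (g(a i := b i))) = fact n" if "i \<in> I" for i
  proof -
    have "N - card (insert (a i) L) = n" using n p[OF that] partial_inj_finite[OF g] by simp
    then show ?thesis using card_perms_ext p[OF that] by simp
  qed
  have "(\<Sum>i\<in>I. avg N (insert (a i) L) (g(a i := b i)) \<phi>) =
      (\<Sum>i\<in>I. sum \<phi> (perms_ext N (insert (a i) L) (g(a i := b i))) / fact n)"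
    by (rule sum.cong) (auto simp: avg_def c)
  also have "\<dots> = sum \<phi> (perms_ext N L g) / fact n" unfolding s sum_divide_distrib ..
  finally have *: "(\<Sum>i\<in>I. avg N (insert (a i) L) (g(a i := b i)) \<phi>) = sum \<phi> (perms_ext N L g) / fact n" .
  show ?thesis unfolding * avg_def[of N L] card_perms_ext[OF g] n by (simp add: field_simps)
qed

lemma avg_label:
  assumes g: "partial_inj N L g" and l: "l \<in> {..<N} - L"
  shows "avg N L g \<phi> = (\<Sum>x\<in>{..<N} - g ` L. avg N (insert l L) (g(l := x)) \<phi>) / (N - card L)"
    and "card ({..<N} - g ` L) = N - card L" "card L < N"
proof -
  have L: "L \<subseteq> {..<N}" "finite L" using g partial_inj_finite by (auto simp: partial_inj_def)
  show c: "card ({..<N} - g ` L) = N - card L"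
    using g L by (simp add: partial_inj_def card_Diff_subset card_image)
  show "card L < N" using l L by (metis DiffE card_lessThan finite_lessThan psubsetI psubset_card_mono)
  then show "avg N L g \<phi> = (\<Sum>x\<in>{..<N} - g ` L. avg N (insert l L) (g(l := x)) \<phi>) / (N - card L)"
    using avg_aux[OF g _ c, of "\<lambda>_. l" "\<lambda>x. x" \<phi>] sum_perms_ext_label[OF g l, of \<phi>] partial_inj_insert[OF g l] l
    by simp
qed

lemma avg_elem:
  assumes g: "partial_inj N L g" and x: "x \<in> {..<N} - g ` L"
  shows "avg N L g \<phi> = (\<Sum>l\<in>{..<N} - L. avg N (insert l L) (g(l := x)) \<phi>) / (N - card L)"
    and "card ({..<N} - L) = N - card L" "card L < N"
proof -
  have L: "L \<subseteq> {..<N}" "finite L" using g partial_inj_finite by (auto simp: partial_inj_def)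
  show c: "card ({..<N} - L) = N - card L" using L by (simp add: card_Diff_subset)
  have "card (g ` L) < N" using x g L
    by (metis DiffE card_lessThan finite_lessThan partial_inj_def psubsetI psubset_card_mono)
  then show "card L < N" using g by (simp add: partial_inj_def card_image)
  then show "avg N L g \<phi> = (\<Sum>l\<in>{..<N} - L. avg N (insert l L) (g(l := x)) \<phi>) / (N - card L)"
    using avg_aux[OF g _ c, of "\<lambda>l. l" "\<lambda>_. x" \<phi>] sum_perms_ext_elem[OF g x, of \<phi>] partial_inj_insert[OF g _ x]
    by simp
qed

lemma avg_bounds:
  assumes "\<And>\<pi>. 0 \<le> \<phi> \<pi> \<and> \<phi> \<pi> \<le> 1"
  shows "0 \<le> avg N L g \<phi> \<and> avg N L g \<phi> \<le> 1"
proof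
  show "0 \<le> avg N L g \<phi>" using assms by (simp add: avg_def sum_nonneg)
  have "sum \<phi> (perms_ext N L g) \<le> card (perms_ext N L g)"
    using sum_bounded_above[of "perms_ext N L g" \<phi> 1] assms by simp
  then show "avg N L g \<phi> \<le> 1" unfolding avg_def
    by (cases "perms_ext N L g = {}") (simp_all add: divide_le_eq_1_pos card_gt_0_iff)
qed

lemma avg_cong: "(\<And>\<pi>. \<pi> \<in> perms_ext N L g \<Longrightarrow> \<phi> \<pi> = \<psi> \<pi>) \<Longrightarrow> avg N L g \<phi> = avg N L g \<psi>"
  by (simp add: avg_def)

text \<open>Compare the averages over all pairs in \<open>X \<times> Y\<close>, that is, under the
  independent coupling. Pairs with a bad member contribute at most 1 each, and their proportion is
  at most \<beta>.\<close>

lemma diff_averages_le: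
  fixes F :: "'a \<Rightarrow> real" and H :: "'b \<Rightarrow> real" and \<beta> :: real
  assumes X: "finite X" "card X = n" and Y: "finite Y" "card Y = n" and n: "0 < n" and \<delta>: "0 \<le> \<delta>"
    and F: "\<And>x. x \<in> X \<Longrightarrow> 0 \<le> F x \<and> F x \<le> 1" and H: "\<And>y. y \<in> Y \<Longrightarrow> 0 \<le> H y \<and> H y \<le> 1"
    and d: "\<And>x y. x \<in> X - Bx \<Longrightarrow> y \<in> Y - By \<Longrightarrow> \<bar>F x - H y\<bar> \<le> \<delta>"
    and b: "finite Bx" "finite By" "real (card Bx + card By) \<le> \<beta> * n"
  shows "\<bar>sum F X / n - sum H Y / n\<bar> \<le> \<delta> + \<beta>"
proof -
  have "(\<Sum>x\<in>X. \<Sum>y\<in>Y. F x - H y) = n * sum F X - n * sum H Y"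
    using X Y by (simp add: sum_subtractf sum_distrib_left)
  also have "\<dots> = real n * (real n * (sum F X / n - sum H Y / n))" using n by (simp add: field_simps)
  finally have "n * (n * \<bar>sum F X / n - sum H Y / n\<bar>) = \<bar>\<Sum>x\<in>X. \<Sum>y\<in>Y. F x - H y\<bar>"
    by (simp add: abs_mult)
  also have "\<dots> \<le> (\<Sum>x\<in>X. \<Sum>y\<in>Y. \<bar>F x - H y\<bar>)"
    by (rule order_trans[OF sum_abs]) (intro sum_mono sum_abs)
  also have "\<dots> \<le> (\<Sum>x\<in>X. \<Sum>y\<in>Y. \<delta> + indicator Bx x + indicator By y)"
  proof (intro sum_mono)
    fix x y assume xy: "x \<in> X" "y \<in> Y"
    have "\<bar>F x - H y\<bar> \<le> 1" using F[OF xy(1)] H[OF xy(2)] by (auto simp: abs_le_iff)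
    then show "\<bar>F x - H y\<bar> \<le> \<delta> + indicator Bx x + indicator By y"
      using d[of x y] xy \<delta> by (auto simp: indicator_def)
  qed
  also have "\<dots> = n * (n * \<delta> + sum (indicator Bx) X + sum (indicator By) Y)"
    using X Y by (simp add: sum.distrib sum_distrib_left algebra_simps)
  also have "\<dots> \<le> n * (n * \<delta> + real (card Bx) + real (card By))"
  proof -
    have "sum (indicator Bx) X = real (card (X \<inter> Bx))" "sum (indicator By) Y = real (card (Y \<inter> By))"
      using X Y by (simp_all add: sum.If_cases indicator_def)
    moreover have "card (X \<inter> Bx) \<le> card Bx" "card (Y \<inter> By) \<le> card By" using b by (auto intro: card_mono)
    ultimately show ?thesis by (intro mult_left_mono) auto
  qed
  finally have "n * \<bar>sum F X / n - sum H Y / n\<bar> \<le> n * \<delta> + real (card Bx) + real (card By)"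
    using n by simp
  also have "\<dots> \<le> n * (\<delta> + \<beta>)" using b(3) by (simp add: algebra_simps)
  finally show ?thesis using n by simp
qed

definition relabel :: "(nat \<Rightarrow> nat) \<Rightarrow> (nat \<Rightarrow> nat \<Rightarrow> nat) \<Rightarrow> nat \<Rightarrow> nat \<Rightarrow> nat" where
  "relabel \<pi> T i l = inv \<pi> (T i (\<pi> l))"

lemma act_relabel:
  assumes "\<pi> permutes S" shows "act (relabel \<pi> T) w l = inv \<pi> (act T w (\<pi> l))"
  by (induction w) (simp_all add: relabel_def permutes_inverses[OF assms])

lemma relabel_bij:
  assumes "\<pi> permutes {..<N :: nat}" "N \<le> N'" shows "bij_betw (inv \<pi>) {..<N'} {..<N'}"
proof -
  have "\<pi> permutes {..<N'}" using assms by (intro permutes_subset[OF assms(1)]) auto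
  then show ?thesis by (rule permutes_imp_bij[OF permutes_inv])
qed

lemma kms_action_relabel:
  assumes "\<pi> permutes {..<N :: nat}" "N \<le> N'" "kms_action T {..<N'}"
  shows "kms_action (relabel \<pi> T) {..<N'}"
proof (rule kms_action_equivariant[OF assms(3)])
  show "inv \<pi> ` {..<N'} = {..<N'}" using relabel_bij[OF assms(1,2)] by (simp add: bij_betw_def)
  show "inv \<pi> (T i x) = relabel \<pi> T i (inv \<pi> x)" for i x
    by (simp add: relabel_def permutes_inverses[OF assms(1)])
qed

lemma regular_action_relabel:
  assumes "\<pi> permutes {..<N :: nat}" "N \<le> N'" "regular_action T {..<N'}"
  shows "regular_action (relabel \<pi> T) {..<N'}"
proof (rule regular_action_transport[OF assms(3) relabel_bij[OF assms(1,2)]])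
  show "inv \<pi> (T i x) = relabel \<pi> T i (inv \<pi> x)" for i x
    by (simp add: relabel_def permutes_inverses[OF assms(1)])
qed

section \<open>Query algorithms cannot distinguish lookalike actions\<close>

definition orc :: "nat \<Rightarrow> (nat \<Rightarrow> nat \<Rightarrow> nat) \<Rightarrow> (nat \<Rightarrow> nat) \<Rightarrow> nat \<Rightarrow> nat \<Rightarrow> nat option" where
  "orc N T \<pi> = answer (enc N (relabel \<pi> T)) (adjl N (relabel \<pi> T))"

text \<open>What one query reveals: the gadget is known in advance, so the answer depends only on
  the label \<open>e'\<close> across the port.\<close>

definition ans :: "nat \<Rightarrow> nat \<Rightarrow> nat \<Rightarrow> nat \<Rightarrow> nat \<Rightarrow> nat option" where
  "ans N e j i e' = (if 1 \<le> i \<and> i \<le> length (adjl_of N e' e j) then Some (adjl_of N e' e j ! (i - 1)) else None)"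

lemma orc_vtx:
  assumes "\<pi> permutes {..<N}" "e < N" "j < 10"
  shows "orc N T \<pi> (vtx e j) i = ans N e j i (inv \<pi> (act T (port_word j) (\<pi> e)))"
  using assms by (simp add: orc_def answer_def ans_def verts_enc adjl_vtx act_relabel)

lemma orc_outside: "v \<notin> {1..10 * N} \<Longrightarrow> orc N T \<pi> v i = None"
  by (auto simp: orc_def answer_def verts_enc)

lemma verdict_prob_Verdict: "verdict_prob ora (Verdict b) c = (if b = c then 1 else 0)"
  by (simp add: verdict_prob_def indicator_def)

lemma verdict_prob_Query: "verdict_prob ora (Query v i c) b = verdict_prob ora (c (ora v i)) b"
proof -
  have "(\<lambda>(b, k). (b, Suc k)) -` {(b', k). b' = b} = {(b', k :: nat). b' = b}" by auto
  then show ?thesis by (simp add: verdict_prob_def)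
qed

lemma verdict_prob_bounds: "0 \<le> verdict_prob ora A b \<and> verdict_prob ora A b \<le> 1"
  by (simp add: verdict_prob_def)

lemma verdict_prob_Random:
  "verdict_prob ora (Random p) b = measure_pmf.expectation p (\<lambda>A. verdict_prob ora A b)"
proof -
  define S where "S = {(b', k :: nat). b' = b}"
  have "ennreal (verdict_prob ora (Random p) b) = (\<integral>\<^sup>+ A. ennreal (verdict_prob ora A b) \<partial>measure_pmf p)"
    using emeasure_bind_pmf[of p "run ora" S]
    by (simp add: verdict_prob_def S_def[symmetric] bind_eq_join_pmf measure_pmf.emeasure_eq_measure)
  also have "\<dots> = ennreal (measure_pmf.expectation p (\<lambda>A. verdict_prob ora A b))"
    using verdict_prob_bounds
    by (intro nn_integral_eq_integral measure_pmf.integrable_const_bound[where B = 1]) auto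
  finally show ?thesis
    using verdict_prob_bounds by (subst (asm) ennreal_inj) (auto intro!: integral_nonneg_AE)
qed

lemma verdict_prob_False: "verdict_prob ora A False = 1 - verdict_prob ora A True"
proof -
  have "{(b', k :: nat). b' = False} = UNIV - {(b', k). b' = True}" by auto
  then show ?thesis unfolding verdict_prob_def
    using measure_pmf.prob_compl[of "{(b', k :: nat). b' = True}" "run ora A"] by simp
qed

lemma partial_inj_perms_ext_nonempty: "partial_inj N L g \<Longrightarrow> perms_ext N L g \<noteq> {}"
  using card_perms_ext[of N L g] by fastforce

lemma avg_const: "partial_inj N L g \<Longrightarrow> avg N L g (\<lambda>_. c) = c"
  using partial_inj_perms_ext_nonempty by (simp add: avg_def card_gt_0_iff)

lemma avg_expectation:
  assumes "\<And>\<pi> x. \<bar>f \<pi> x\<bar> \<le> (1 :: real)"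
  shows "avg N L g (\<lambda>\<pi>. measure_pmf.expectation p (f \<pi>)) = measure_pmf.expectation p (\<lambda>x. avg N L g (\<lambda>\<pi>. f \<pi> x))"
proof -
  have "integrable (measure_pmf p) (f \<pi>)" for \<pi>
    using assms by (intro measure_pmf.integrable_const_bound[where B = 1]) auto
  then show ?thesis unfolding avg_def by simp
qed

locale game = lookalike T1 T2 N R G for T1 T2 :: "nat \<Rightarrow> nat \<Rightarrow> nat" and N R G +
  fixes Q :: nat
  assumes QR: "20 * Q \<le> R" and QN: "2 * Q < N"
begin

text \<open>
  \<open>\<eta>\<close> bounds the probability that a fresh vertex lands at an atypical point or near an explored one.
\<close>

definition \<eta> :: real where
  "\<eta> = (real (N - card G) + real (card (words (80 * Q))) * (4 * Q + 1)) / (N - 2 * Q)"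

lemma \<eta>_nonneg: "0 \<le> \<eta>" using QN by (simp add: \<eta>_def)

definition pairs :: "nat set \<Rightarrow> (nat \<Rightarrow> nat) \<Rightarrow> (nat \<Rightarrow> nat) \<Rightarrow> (nat \<times> nat) set" where
  "pairs L g h = (\<lambda>l. (g l, h l)) ` L"

definition inj2 :: "nat set \<Rightarrow> (nat \<Rightarrow> nat) \<Rightarrow> (nat \<Rightarrow> nat) \<Rightarrow> bool" where
  "inj2 L g h \<longleftrightarrow> partial_inj N L g \<and> partial_inj N L h"

text \<open>The invariant with \<open>q\<close> queries left. Each query reveals at most two labels,
  of the gadget and of the neighbour, and uses up radius 20 = 5 * 4 because port words have length
  at most 4.\<close>

definition state :: "nat \<Rightarrow> nat set \<Rightarrow> (nat \<Rightarrow> nat) \<Rightarrow> (nat \<Rightarrow> nat) \<Rightarrow> bool" where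
  "state q L g h \<longleftrightarrow> inj2 L g h \<and> card L + 2 * q \<le> 2 * Q \<and> corr (20 * q) (pairs L g h)"

definition bounded :: "nat \<Rightarrow> query_alg \<Rightarrow> nat set \<Rightarrow> (nat \<Rightarrow> nat) \<Rightarrow> (nat \<Rightarrow> nat) \<Rightarrow> bool" where
  "bounded q A L g h \<longleftrightarrow>
    (\<forall>\<pi>\<in>perms_ext N L g. \<forall>z\<in>set_pmf (run (orc N T1 \<pi>) A). snd z \<le> q) \<and>
    (\<forall>\<pi>\<in>perms_ext N L h. \<forall>z\<in>set_pmf (run (orc N T2 \<pi>) A). snd z \<le> q)"

definition gap :: "query_alg \<Rightarrow> nat set \<Rightarrow> (nat \<Rightarrow> nat) \<Rightarrow> (nat \<Rightarrow> nat) \<Rightarrow> real" where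
  "gap A L g h = \<bar>avg N L g (\<lambda>\<pi>. verdict_prob (orc N T1 \<pi>) A True) -
    avg N L h (\<lambda>\<pi>. verdict_prob (orc N T2 \<pi>) A True)\<bar>"

lemma Query_same_answer:
  assumes "\<And>\<pi>. \<pi> \<in> perms_ext N L g \<Longrightarrow> orc N T1 \<pi> v i = a"
    "\<And>\<pi>. \<pi> \<in> perms_ext N L h \<Longrightarrow> orc N T2 \<pi> v i = a"
  shows "gap (Query v i c) L g h = gap (c a) L g h"
    "bounded (Suc q) (Query v i c) L g h \<Longrightarrow> bounded q (c a) L g h"
proof -
  show "gap (Query v i c) L g h = gap (c a) L g h"
    unfolding gap_def verdict_prob_Query using assms by (simp cong: avg_cong)
  assume b: "bounded (Suc q) (Query v i c) L g h"
  have "snd z \<le> q" if "\<pi> \<in> perms_ext N L g" "z \<in> set_pmf (run (orc N T1 \<pi>) (c a))" for \<pi> z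
  proof -
    have "(fst z, Suc (snd z)) \<in> set_pmf (run (orc N T1 \<pi>) (Query v i c))"
      using that assms(1)[OF that(1)] by (force simp: case_prod_beta)
    then show ?thesis using b that(1) unfolding bounded_def by fastforce
  qed
  moreover have "snd z \<le> q" if "\<pi> \<in> perms_ext N L h" "z \<in> set_pmf (run (orc N T2 \<pi>) (c a))" for \<pi> z
  proof -
    have "(fst z, Suc (snd z)) \<in> set_pmf (run (orc N T2 \<pi>) (Query v i c))"
      using that assms(2)[OF that(1)] by (force simp: case_prod_beta)
    then show ?thesis using b that(1) unfolding bounded_def by fastforce
  qed
  ultimately show "bounded q (c a) L g h" unfolding bounded_def by blast
qed

lemma perms_ext_insert_subset: "l \<notin> L \<Longrightarrow> perms_ext N (insert l L) (g(l := x)) \<subseteq> perms_ext N L g"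
  by (auto simp: perms_ext_def)

lemma bounded_insert:
  assumes "bounded q A L g h" "l \<notin> L" shows "bounded q A (insert l L) (g(l := x)) (h(l := y))"
  using assms(1) perms_ext_insert_subset[OF assms(2)] unfolding bounded_def by blast

lemma pairs_insert: "l \<notin> L \<Longrightarrow> pairs (insert l L) (g(l := x)) (h(l := y)) = insert (x, y) (pairs L g h)"
  by (auto simp: pairs_def)

lemma orc_known:
  assumes "e \<in> L" "l \<in> L" "partial_inj N L g" "act T (port_word j) (g e) = g l" "j < 10"
    and \<pi>: "\<pi> \<in> perms_ext N L g"
  shows "orc N T \<pi> (vtx e j) i = ans N e j i l"
proof -
  have p: "\<pi> permutes {..<N}" "\<pi> e = g e" "\<pi> l = g l" using \<pi> assms by (auto simp: perms_ext_def)
  have "inv \<pi> (g l) = l" using permutes_inverses(2)[OF p(1), of l] p(3) by simp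
  moreover have "e < N" using assms by (auto simp: partial_inj_def)
  ultimately show ?thesis using orc_vtx[OF p(1) _ assms(5)] p(2) assms(4) by simp
qed

lemma gap_known:
  assumes s: "inj2 L g h" "card L + 1 + 2 * q \<le> 2 * Q" "corr (20 * Suc q) (pairs L g h)"
    and e: "e \<in> L" and j: "j < 10" and b: "bounded (Suc q) (Query (vtx e j) i c) L g h"
    and IH: "\<And>a L g h. state q L g h \<Longrightarrow> bounded q (c a) L g h \<Longrightarrow> gap (c a) L g h \<le> q * \<eta>"
  shows "gap (Query (vtx e j) i c) L g h \<le> q * \<eta>"
proof -
  have g: "partial_inj N L g" and h: "partial_inj N L h" using s(1) by (auto simp: inj2_def)
  define w where "w = port_word j"
  have w: "w \<in> words 4" using port_word_set by (simp add: w_def words_def)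
  have w20: "w \<in> words (20 * Suc q)" using words_mono[OF w] by simp
  have closed: "gap (Query (vtx e j) i c) L g h \<le> q * \<eta>"
    if "inj2 L g h" "card L + 2 * q \<le> 2 * Q" "corr (20 * q) (pairs L g h)" "e \<in> L" "l \<in> L"
      "act T1 w (g e) = g l" "act T2 w (h e) = h l" "bounded (Suc q) (Query (vtx e j) i c) L g h" for L g h l
  proof -
    have p: "partial_inj N L g" "partial_inj N L h" using that(1) by (auto simp: inj2_def)
    note * = orc_known[OF that(4,5) p(1) that(6)[unfolded w_def] j]
      orc_known[OF that(4,5) p(2) that(7)[unfolded w_def] j]
    have "gap (Query (vtx e j) i c) L g h = gap (c (ans N e j i l)) L g h"
      by (rule Query_same_answer(1)) (fact *)+
    moreover have "bounded q (c (ans N e j i l)) L g h"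
      by (rule Query_same_answer(2)[OF _ _ that(8)]) (fact *)+
    ultimately show ?thesis using IH[of L g h "ans N e j i l"] that by (simp add: state_def)
  qed
  have eD: "(g e, h e) \<in> pairs L g h" using e by (auto simp: pairs_def)
  define x y where "x = act T1 w (g e)" and "y = act T2 w (h e)"
  have xN: "x < N" using act1_less[OF w, of "g e"] corrD(1)[OF s(3) eD] by (simp add: x_def)
  have "y \<noteq> N" using corrD(3)[OF s(3) eD w20] by (simp add: y_def)
  then have yN: "y < N" using act2_less[OF w, of "h e"] corrD(2)[OF s(3) eD] by (simp add: y_def)
  have xy: "x = g l \<longleftrightarrow> y = h l" if "l \<in> L" for l
  proof -
    have "(g l, h l) \<in> pairs L g h" using that by (auto simp: pairs_def)
    then show ?thesis using corrD(4)[OF s(3) eD _ w20] by (simp add: x_def y_def)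
  qed
  show ?thesis
  proof (cases "x \<in> g ` L")
    case True
    then obtain l where l: "l \<in> L" "x = g l" by blast
    show ?thesis
      by (rule closed[OF s(1) _ _ e l(1) _ _ b])
        (use s(2) corr_mono[OF s(3)] l xy in \<open>auto simp: x_def[symmetric] y_def[symmetric]\<close>)
  next
    case False
    then have x: "x \<in> {..<N} - g ` L" and y: "y \<in> {..<N} - h ` L" using xN yN xy by auto
    define A where "A = Query (vtx e j) i c"
    define F where "F l = avg N (insert l L) (g(l := x)) (\<lambda>\<pi>. verdict_prob (orc N T1 \<pi>) A True)" for l
    define H where "H l = avg N (insert l L) (h(l := y)) (\<lambda>\<pi>. verdict_prob (orc N T2 \<pi>) A True)" for l
    have FH: "\<bar>F l - H l\<bar> \<le> q * \<eta>" if l: "l \<in> {..<N} - L" for l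
    proof -
      have lL: "l \<notin> L" "l \<noteq> e" using l e by auto
      have "gap A (insert l L) (g(l := x)) (h(l := y)) \<le> q * \<eta>"
        unfolding A_def
      proof (rule closed)
        show "inj2 (insert l L) (g(l := x)) (h(l := y))"
          using partial_inj_insert[OF g l x] partial_inj_insert[OF h l y] by (simp add: inj2_def)
        show "card (insert l L) + 2 * q \<le> 2 * Q" using s(2) lL partial_inj_finite[OF g] by simp
        have "corr (20 * q) (spread 4 (pairs L g h))" by (rule corr_spread[OF s(3)]) simp
        moreover have "insert (x, y) (pairs L g h) \<subseteq> spread 4 (pairs L g h)"
          using subset_spread[of "pairs L g h" 4] eD w by (auto simp: spread_def x_def y_def)
        ultimately show "corr (20 * q) (pairs (insert l L) (g(l := x)) (h(l := y)))"
          unfolding pairs_insert[OF lL(1)] using corr_mono by blast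
        show "bounded (Suc q) (Query (vtx e j) i c) (insert l L) (g(l := x)) (h(l := y))"
          by (rule bounded_insert[OF b lL(1)])
      qed (use e lL in \<open>auto simp: x_def y_def\<close>)
      then show ?thesis by (simp add: gap_def F_def H_def)
    qed
    have c: "card ({..<N} - L) = N - card L" "card L < N" using avg_elem[OF g x] by auto
    have "gap A L g h = \<bar>(\<Sum>l\<in>{..<N} - L. F l) / (N - card L) - (\<Sum>l\<in>{..<N} - L. H l) / (N - card L)\<bar>"
      unfolding gap_def F_def H_def avg_elem(1)[OF g x] avg_elem(1)[OF h y] ..
    also have "\<dots> = \<bar>\<Sum>l\<in>{..<N} - L. F l - H l\<bar> / (N - card L)"
      by (simp add: sum_subtractf diff_divide_distrib[symmetric])
    also have "\<dots> \<le> (\<Sum>l\<in>{..<N} - L. \<bar>F l - H l\<bar>) / (N - card L)"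
      by (intro divide_right_mono sum_abs) simp
    also have "\<dots> \<le> (\<Sum>l\<in>{..<N} - L. q * \<eta>) / (N - card L)"
      by (intro divide_right_mono sum_mono FH) auto
    also have "\<dots> = q * \<eta>" using c by simp
    finally show ?thesis by (simp add: A_def)
  qed
qed

text \<open>At most 2 Q explored points on the first side, and 2 Q + 1 with the deleted point on the
  second, make 4 Q + 1; radius 20 Q becomes 80 Q in \<open>near1\<close> and
  \<open>near2\<close>.\<close>

lemma card_bad:
  assumes "inj2 L g h" "card L \<le> 2 * Q" "\<rho> \<le> 20 * Q"
  defines "Bx \<equiv> ({..<N} - G) \<union> near1 \<rho> (fst ` pairs L g h)"
    and "By \<equiv> near2 \<rho> (insert N (snd ` pairs L g h))"
  shows "finite Bx" "finite By" "real (card Bx + card By) \<le> \<eta> * (N - card L)"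
proof -
  have finL: "finite L" using assms(1) partial_inj_finite by (auto simp: inj2_def)
  have f: "finite (pairs L g h)" by (simp add: pairs_def finL)
  then have f1: "finite (fst ` pairs L g h)" and f2: "finite (insert N (snd ` pairs L g h))" by auto
  show "finite Bx" "finite By" using card_near(1)[OF f1] card_near(3)[OF f2] by (auto simp: Bx_def By_def)
  have W: "card (words (4 * \<rho>)) \<le> card (words (80 * Q))"
    by (rule card_mono) (use words_mono assms(3) in auto)
  have cp: "card (pairs L g h) \<le> 2 * Q" using card_image_le[OF finL] assms(2) unfolding pairs_def by (meson le_trans)
  have "card (fst ` pairs L g h) \<le> 2 * Q" using card_image_le[OF f, of fst] cp by simp
  then have b1: "card (near1 \<rho> (fst ` pairs L g h)) \<le> card (words (80 * Q)) * (2 * Q)"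
    using card_near(2)[OF f1, of \<rho>] mult_le_mono[OF W] by (meson le_trans)
  have "card (insert N (snd ` pairs L g h)) \<le> 2 * Q + 1"
    using card_image_le[OF f, of snd] cp f by (simp add: card_insert_if)
  then have b2: "card By \<le> card (words (80 * Q)) * (2 * Q + 1)"
    using card_near(4)[OF f2, of \<rho>] mult_le_mono[OF W] unfolding By_def by (meson le_trans)
  have "card Bx \<le> card ({..<N} - G) + card (near1 \<rho> (fst ` pairs L g h))" unfolding Bx_def by (rule card_Un_le)
  also have "card ({..<N} - G) = N - card G" using G by (simp add: card_Diff_subset finite_subset)
  finally have "card Bx + card By \<le> (N - card G) + card (words (80 * Q)) * (4 * Q + 1)"
    using b1 b2 by (simp add: algebra_simps)
  then have "real (card Bx + card By) \<le> real ((N - card G) + card (words (80 * Q)) * (4 * Q + 1))"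
    by (simp only: of_nat_le_iff)
  also have "\<dots> = \<eta> * (N - 2 * Q)" using QN by (simp add: \<eta>_def distrib_left)
  also have "\<dots> \<le> \<eta> * (N - card L)" using assms(2) QN by (intro mult_left_mono \<eta>_nonneg) simp
  finally show "real (card Bx + card By) \<le> \<eta> * (N - card L)" .
qed

text \<open>Only a query to an unexplored gadget loses anything. Both points behind its label are
  uniform; outside the bad sets \<open>corr_far\<close> extends the matching and
  \<open>gap_known\<close> applies, so such a query costs \<eta>.\<close>

theorem gap_le: "state q L g h \<Longrightarrow> bounded q A L g h \<Longrightarrow> gap A L g h \<le> q * \<eta>"
proof (induction A arbitrary: q L g h)
  case (Verdict b)
  then have "partial_inj N L g" "partial_inj N L h" by (auto simp: state_def inj2_def)
  then have "gap (Verdict b) L g h = 0" by (simp add: gap_def verdict_prob_Verdict avg_const)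
  then show ?case using \<eta>_nonneg by simp
next
  case (Query v i c)
  have s: "inj2 L g h" "card L + 2 * q \<le> 2 * Q" "corr (20 * q) (pairs L g h)"
    using Query.prems(1) by (auto simp: state_def)
  have g: "partial_inj N L g" and h: "partial_inj N L h" using s(1) by (auto simp: inj2_def)
  obtain q' where q: "q = Suc q'"
  proof -
    obtain \<pi> where \<pi>: "\<pi> \<in> perms_ext N L g" using partial_inj_perms_ext_nonempty[OF g] by blast
    obtain z where "z \<in> set_pmf (run (orc N T1 \<pi>) (c (orc N T1 \<pi> v i)))" 
      using set_pmf_not_empty[of "run (orc N T1 \<pi>) (c (orc N T1 \<pi> v i))"] by blast
    then have "(fst z, Suc (snd z)) \<in> set_pmf (run (orc N T1 \<pi>) (Query v i c))"
      by (force simp: case_prod_beta)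
    then have "Suc (snd z) \<le> q" using Query.prems(2) \<pi> unfolding bounded_def by fastforce
    then show ?thesis using that by (cases q) auto
  qed
  have IH: "gap (c a) L g h \<le> q' * \<eta>" if "state q' L g h" "bounded q' (c a) L g h" for a L g h
    using Query.IH that by blast
  have "gap (Query v i c) L g h \<le> q' * \<eta> + \<eta>"
  proof (cases "v \<in> {1..10 * N}")
    case False
    note * = orc_outside[OF False]
    have "gap (c None) L g h \<le> q' * \<eta>"
    proof (rule IH)
      show "state q' L g h" using s corr_mono[OF s(3)] by (simp add: state_def q)
      show "bounded q' (c None) L g h"
        by (rule Query_same_answer(2)[of L g v i None h]) (use * Query.prems(2) q in auto)
    qed
    moreover have "gap (Query v i c) L g h = gap (c None) L g h"
      by (rule Query_same_answer(1)) (use * in auto)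
    ultimately show ?thesis using \<eta>_nonneg by simp
  next
    case True
    then obtain e j where v: "e < N" "j < 10" "v = vtx e j" by (rule vtxE)
    show ?thesis
    proof (cases "e \<in> L")
      case True
      have "gap (Query v i c) L g h \<le> q' * \<eta>"
        unfolding v(3) by (rule gap_known[OF s(1) _ _ True v(2)]) (use s Query.prems(2) IH v q in auto)
      then show ?thesis using \<eta>_nonneg by simp
    next
      case False
      then have e: "e \<in> {..<N} - L" using v by simp
      define F where "F x = avg N (insert e L) (g(e := x)) (\<lambda>\<pi>. verdict_prob (orc N T1 \<pi>) (Query v i c) True)" for x
      define H where "H y = avg N (insert e L) (h(e := y)) (\<lambda>\<pi>. verdict_prob (orc N T2 \<pi>) (Query v i c) True)" for y
      define Bx By where "Bx = ({..<N} - G) \<union> near1 (20 * q) (fst ` pairs L g h)"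
        and "By = near2 (20 * q) (insert N (snd ` pairs L g h))"
      have \<rho>: "20 * q \<le> 20 * Q" using s(2) by simp
      have "\<bar>sum F ({..<N} - g ` L) / (N - card L) - sum H ({..<N} - h ` L) / (N - card L)\<bar> \<le> q' * \<eta> + \<eta>"
      proof (rule diff_averages_le)
        show "finite Bx" "finite By" "real (card Bx + card By) \<le> \<eta> * real (N - card L)"
          unfolding Bx_def By_def using card_bad[OF s(1) _ \<rho>] s(2) by auto
        show "card ({..<N} - g ` L) = N - card L" "card ({..<N} - h ` L) = N - card L" "0 < N - card L"
          using avg_label(2,3)[OF g e] avg_label(2)[OF h e] by auto
        show "0 \<le> F x \<and> F x \<le> 1" "0 \<le> H x \<and> H x \<le> 1" for x
          unfolding F_def H_def by (intro avg_bounds verdict_prob_bounds)+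
        show "0 \<le> q' * \<eta>" using \<eta>_nonneg by simp
        fix x y assume x: "x \<in> {..<N} - g ` L - Bx" and y: "y \<in> {..<N} - h ` L - By"
        have "gap (Query (vtx e j) i c) (insert e L) (g(e := x)) (h(e := y)) \<le> q' * \<eta>"
        proof (rule gap_known)
          show "inj2 (insert e L) (g(e := x)) (h(e := y))"
            using partial_inj_insert[OF g e] partial_inj_insert[OF h e] x y by (simp add: inj2_def)
          show "card (insert e L) + 1 + 2 * q' \<le> 2 * Q" using s(2) e q partial_inj_finite[OF g] by simp
          show "corr (20 * Suc q') (pairs (insert e L) (g(e := x)) (h(e := y)))"
            unfolding pairs_insert[OF False]
            by (rule corr_far) (use s(3) q \<rho> QR x y in \<open>auto simp: Bx_def By_def\<close>)
          show "bounded (Suc q') (Query (vtx e j) i c) (insert e L) (g(e := x)) (h(e := y))"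
            using bounded_insert[OF Query.prems(2) False] q v by simp
        qed (use v IH in auto)
        then show "\<bar>F x - H y\<bar> \<le> q' * \<eta>" by (simp add: gap_def F_def H_def v)
      qed auto
      then show ?thesis unfolding gap_def F_def H_def avg_label(1)[OF g e] avg_label(1)[OF h e] .
    qed
  qed
  then show ?case by (simp add: q algebra_simps)
next
  case (Random p)
  have g: "partial_inj N L g" and h: "partial_inj N L h"
    using Random.prems(1) by (auto simp: state_def inj2_def)
  define a1 where "a1 A = avg N L g (\<lambda>\<pi>. verdict_prob (orc N T1 \<pi>) A True)" for A
  define a2 where "a2 A = avg N L h (\<lambda>\<pi>. verdict_prob (orc N T2 \<pi>) A True)" for A
  have ab: "0 \<le> a1 A \<and> a1 A \<le> 1" "0 \<le> a2 A \<and> a2 A \<le> 1" for A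
    unfolding a1_def a2_def by (intro avg_bounds verdict_prob_bounds)+
  have vb: "\<bar>verdict_prob ora A True\<bar> \<le> 1" for ora A using verdict_prob_bounds[of ora A True] by simp
  have i1: "integrable (measure_pmf p) a1" and i2: "integrable (measure_pmf p) a2"
    using ab by (auto intro!: measure_pmf.integrable_const_bound[where B = 1])
  have d: "\<bar>a1 A - a2 A\<bar> \<le> q * \<eta>" if "A \<in> set_pmf p" for A
  proof -
    have "bounded q A L g h" using Random.prems(2) that unfolding bounded_def by fastforce
    then have "gap A L g h \<le> q * \<eta>" using Random.IH[OF that] Random.prems(1) by blast
    then show ?thesis by (simp add: gap_def a1_def a2_def)
  qed
  \<comment> \<open>Averaging over labellings commutes with the expectation over the random choice,
    so the gap is at most the mean of the gaps of the branches.\<close>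
  have "gap (Random p) L g h = \<bar>measure_pmf.expectation p a1 - measure_pmf.expectation p a2\<bar>"
    unfolding gap_def verdict_prob_Random a1_def a2_def
    by (simp add: avg_expectation[of "\<lambda>\<pi> A. verdict_prob (orc N _ \<pi>) A True"] vb)
  also have "\<dots> = \<bar>measure_pmf.expectation p (\<lambda>A. a1 A - a2 A)\<bar>" using i1 i2 by simp
  also have "\<dots> \<le> measure_pmf.expectation p (\<lambda>A. \<bar>a1 A - a2 A\<bar>)" by (rule integral_abs_bound)
  also have "\<dots> \<le> q * \<eta>"
    using i1 i2 d by (intro measure_pmf.integral_le_const) (auto simp: AE_measure_pmf_iff)
  finally show ?case .
qed

text \<open>Every labelling of the first encoding has the property and every labelling of the second
  is far, so the averaged acceptance probabilities differ by at least 1/3.\<close>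

lemma no_tester:
  assumes T2: "regular_action T2 {..<Suc N}" and N: "10 ^ 9 \<le> N" and small: "Q * \<eta> < 1 / 3"
    and A: "tester 9 far_eps (10 * N) (of_order kms_property (10 * N)) A"
    and q: "queries_at_most 9 (10 * N) A Q"
  shows False
proof -
  define p where "p T \<pi> = verdict_prob (orc N T \<pi>) A True" for T \<pi>
  have 1: "2 / 3 \<le> p T1 \<pi> \<and> (\<forall>z\<in>set_pmf (run (orc N T1 \<pi>) A). snd z \<le> Q)" if \<pi>: "\<pi> permutes {..<N}" for \<pi>
  proof -
    have k: "kms_action (relabel \<pi> T1) {..<N}" by (rule kms_action_relabel[OF \<pi> order_refl A.kms])
    interpret E: enc_action "relabel \<pi> T1" N N by (simp add: enc_action_def enc_action_axioms_def kms_def k)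
    have "enc N (relabel \<pi> T1) \<in> of_order kms_property (10 * N)"
      using enc_in_kms_property[OF k] by (simp add: of_order_def card_verts_enc)
    then show ?thesis
      using A q E.enc_bounded E.adjacency_lists_enc unfolding tester_def queries_at_most_def p_def orc_def
      by (fastforce simp: verts_enc)
  qed
  have 2: "p T2 \<pi> \<le> 1 / 3 \<and> (\<forall>z\<in>set_pmf (run (orc N T2 \<pi>) A). snd z \<le> Q)" if \<pi>: "\<pi> permutes {..<N}" for \<pi>
  proof -
    have r: "regular_action (relabel \<pi> T2) {..<Suc N}" by (rule regular_action_relabel[OF \<pi> _ T2]) simp
    then have k: "kms_action (relabel \<pi> T2) {..<Suc N}" and t: "transitive_on (relabel \<pi> T2) {..<Suc N}"
      by (auto simp: regular_action_def)
    interpret E: enc_action "relabel \<pi> T2" "Suc N" N by (simp add: enc_action_def enc_action_axioms_def kms_def k)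
    have far: "eps_far 9 far_eps (enc N (relabel \<pi> T2)) (of_order kms_property (10 * N))"
      by (rule punctured_far[OF k t N]) simp
    have "2 / 3 \<le> verdict_prob (orc N T2 \<pi>) A False \<and> (\<forall>z\<in>set_pmf (run (orc N T2 \<pi>) A). snd z \<le> Q)"
      using A q E.enc_bounded E.adjacency_lists_enc far unfolding tester_def queries_at_most_def orc_def
      by (fastforce simp: verts_enc)
    then show ?thesis by (simp add: p_def verdict_prob_False)
  qed
  have pi: "partial_inj N {} id" by (simp add: partial_inj_def)
  have "gap A {} id id \<le> Q * \<eta>"
  proof (rule gap_le)
    show "state Q {} id id" using pi by (simp add: state_def inj2_def pairs_def)
    show "bounded Q A {} id id" unfolding bounded_def using 1 2 by (auto simp: perms_ext_def)
  qed
  moreover have "2 / 3 \<le> avg N {} id (p T1)"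
  proof -
    have "(\<Sum>\<pi>\<in>perms_ext N {} id. 2 / 3) \<le> sum (p T1) (perms_ext N {} id)"
      using 1 by (intro sum_mono) (auto simp: perms_ext_def)
    then show ?thesis using partial_inj_perms_ext_nonempty[OF pi]
      by (simp add: avg_def le_divide_eq card_gt_0_iff mult.commute)
  qed
  moreover have "avg N {} id (p T2) \<le> 1 / 3"
  proof -
    have "sum (p T2) (perms_ext N {} id) \<le> (\<Sum>\<pi>\<in>perms_ext N {} id. 1 / 3)"
      using 2 by (intro sum_mono) (auto simp: perms_ext_def)
    then show ?thesis using partial_inj_perms_ext_nonempty[OF pi]
      by (simp add: avg_def divide_le_eq card_gt_0_iff mult.commute)
  qed
  moreover have "gap A {} id id = \<bar>avg N {} id (p T1) - avg N {} id (p T2)\<bar>"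
    by (simp add: gap_def p_def[abs_def])
  ultimately show False using small by linarith
qed

end

section \<open>Assembling the counterexample\<close>

text \<open>The fewer than \<open>K\<close> leftover points are fixed, where all relations hold
  trivially; thus every \<open>N\<close> is reached.\<close>

definition copies :: "nat \<Rightarrow> (nat \<Rightarrow> nat \<Rightarrow> nat) \<Rightarrow> nat \<Rightarrow> nat \<Rightarrow> nat \<Rightarrow> nat" where
  "copies K T N i e = (if e < N div K * K then e div K * K + T i (e mod K) else e)"

lemma lookalike_copies:
  assumes K: "0 < K" and T0: "regular_action T0 {..<K}" and T2: "regular_action T2 {..<Suc N}"
    and pat: "pattern R T2 = pattern R T0"
  shows "lookalike (copies K T0 N) T2 N R {..<N div K * K}"
proof -
  interpret C: kms T0 "{..<K}" using T0 by unfold_locales (simp add: regular_action_def)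
  interpret D: kms T2 "{..<Suc N}" using T2 by unfold_locales (simp add: regular_action_def)
  have act: "act (copies K T0 N) w e = (if e < N div K * K then e div K * K + act T0 w (e mod K) else e)"
    if "set w \<subseteq> {..<3}" for w e
    using that
  proof (induction w)
    case Nil then show ?case by simp
  next
    case (Cons i w)
    show ?case
    proof (cases "e < N div K * K")
      case True
      define r where "r = act T0 w (e mod K)"
      have r: "r < K" using C.act_in[of w "e mod K"] Cons.prems K by (simp add: r_def)
      have "e div K < N div K" using True K by (simp add: div_less_iff_less_mult)
      then have "Suc (e div K) * K \<le> N div K * K" by (intro mult_le_mono1) simp
      then have "e div K * K + r < N div K * K" using r by simp
      then show ?thesis using True Cons r by (simp add: copies_def r_def[symmetric])
    next
      case False then show ?thesis using Cons by (simp add: copies_def)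
    qed
  qed
  have NK: "N div K * K \<le> N" by simp
  have "kms_action (copies K T0 N) {..<N}" unfolding kms_action_def
  proof (intro conjI allI impI ballI)
    fix i e assume i: "i < (3 :: nat)" and e: "e \<in> {..<N}"
    show "copies K T0 N i e \<in> {..<N}"
    proof (cases "e < N div K * K")
      case True
      have "T0 i (e mod K) < K" using C.T_in[OF i, of "e mod K"] K by simp
      moreover have "e div K < N div K" using True K by (simp add: div_less_iff_less_mult)
      then have "e div K * K + K \<le> N div K * K"
        using mult_le_mono1[of "Suc (e div K)" "N div K" K] by simp
      ultimately have "e div K * K + T0 i (e mod K) < N" using NK by linarith
      then show ?thesis using True by (simp add: copies_def)
    qed (use e in \<open>simp add: copies_def\<close>)
  next
    fix r assume r: "r \<in> kms_rels"
    obtain w w' where ww: "r = (w, w')" by (cases r)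
    then have s: "set w \<subseteq> {..<3}" "set w' \<subseteq> {..<3}" using kms_rels_words[of w w'] r by (auto simp: words_def)
    have "act (copies K T0 N) w e = act (copies K T0 N) w' e" for e
      using C.rel[of w w' "e mod K"] r ww K by (simp add: act[OF s(1)] act[OF s(2)])
    then show "case r of (w, w') \<Rightarrow> \<forall>x\<in>{..<N}. act (copies K T0 N) w x = act (copies K T0 N) w' x"
      by (simp add: ww)
  qed simp
  moreover have "act (copies K T0 N) w x = x \<longleftrightarrow> act T2 w y = y"
    if x: "x \<in> {..<N div K * K}" and y: "y < Suc N" and w: "w \<in> words R" for x y w
  proof -
    have h0: "act T0 w a = a \<longleftrightarrow> act T0 w 0 = 0" if "a < K" for a
      using T0 that K words_set[OF w] unfolding regular_action_def homogeneous_def by blast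
    have h2: "act T2 w y = y \<longleftrightarrow> act T2 w 0 = 0"
      using T2 y words_set[OF w] unfolding regular_action_def homogeneous_def by blast
    have "act (copies K T0 N) w x = x \<longleftrightarrow> act T0 w (x mod K) = x mod K"
      using x act[OF words_set[OF w], of x] by (simp, metis add_left_cancel div_mult_mod_eq)
    also have "\<dots> \<longleftrightarrow> act T0 w 0 = 0" using h0[of "x mod K"] K by simp
    also have "\<dots> \<longleftrightarrow> act T2 w 0 = 0" using pat w by (auto simp: pattern_def)
    finally show ?thesis using h2 by simp
  qed
  ultimately show ?thesis
    using D.kms NK by unfold_locales auto
qed

text \<open>\<open>K\<close> depends on \<open>R\<close> alone while \<open>N\<close> grows, so the
  proportion of atypical points tends to 0.\<close>

lemma ex_lookalike:
  "\<exists>K. \<forall>m. \<exists>N\<ge>m. \<exists>T1 T2 G. regular_action T2 {..<Suc N} \<and> lookalike T1 T2 N R G \<and> N \<le> card G + K"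
proof -
  obtain K T0 where K: "0 < K" "regular_action T0 {..<K}"
    and ex: "\<And>m. \<exists>N\<ge>m. \<exists>T. regular_action T {..<Suc N} \<and> pattern R T = pattern R T0"
    using ex_regular_actions_same_pattern[of R] by blast
  show ?thesis
  proof (rule exI[of _ K], rule allI)
    fix m
    obtain N T where N: "m \<le> N" "regular_action T {..<Suc N}" "pattern R T = pattern R T0"
      using ex[of m] by blast
    have "N mod K < K" using K by simp
    then have "N \<le> N div K * K + K" using div_mult_mod_eq[of N K] by linarith
    then have "N \<le> card {..<N div K * K} + K" by simp
    then show "\<exists>N\<ge>m. \<exists>T1 T2 G. regular_action T2 {..<Suc N} \<and> lookalike T1 T2 N R G \<and> N \<le> card G + K"
      using lookalike_copies[OF K N(2,3)] N(1,2) by blast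
  qed
qed

lemma not_testable_kms_property: "\<not> testable 9 kms_property"
proof
  assume "testable 9 kms_property"
  then obtain q where q: "\<And>n \<epsilon>. 0 < \<epsilon> \<Longrightarrow> \<epsilon> < 1 \<Longrightarrow>
      \<exists>A. tester 9 \<epsilon> n (of_order kms_property n) A \<and> queries_at_most 9 n A (q \<epsilon>)"
    unfolding testable_def by blast
  define Q where "Q = q far_eps"
  define W where "W = card (words (80 * Q))"
  obtain K where K: "\<And>m. \<exists>N\<ge>m. \<exists>T1 T2 G. regular_action T2 {..<Suc N} \<and>
      lookalike T1 T2 N (20 * Q) G \<and> N \<le> card G + K"
    using ex_lookalike[of "20 * Q"] by blast
  \<comment> \<open>The summands provide \<open>10 ^ 9 \<le> N\<close> for
    \<open>punctured_far\<close>, \<open>2 * Q < N\<close> for \<open>game\<close>, and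
    \<open>Q * \<eta> < 1 / 3\<close>.\<close>
  define m where "m = 10 ^ 9 + 2 * Q + 3 * Q * (K + W * (4 * Q + 1)) + 1"
  obtain N T1 T2 G where N: "m \<le> N" "regular_action T2 {..<Suc N}" "lookalike T1 T2 N (20 * Q) G" "N \<le> card G + K"
    using K[of m] by blast
  interpret lookalike T1 T2 N "20 * Q" G by (rule N(3))
  interpret game T1 T2 N "20 * Q" G Q by unfold_locales (use N(1) in \<open>auto simp: m_def\<close>)
  have e: "0 < far_eps" "far_eps < 1" by (auto simp: far_eps_def)
  obtain A where A: "tester 9 far_eps (10 * N) (of_order kms_property (10 * N)) A" "queries_at_most 9 (10 * N) A Q"
    using q[OF e, of "10 * N"] unfolding Q_def by blast
  have "Q * \<eta> < 1 / 3"
  proof -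
    define c where "c = real (K + W * (4 * Q + 1))"
    have pos: "0 < real (N - 2 * Q)" using QN by simp
    have "\<eta> \<le> c / (N - 2 * Q)"
    proof -
      have "real (N - card G) \<le> real K" using N(4) by simp
      then show ?thesis unfolding \<eta>_def W_def[symmetric] using pos
        by (intro divide_right_mono) (simp_all add: c_def distrib_left)
    qed
    then have "Q * \<eta> \<le> Q * c / (N - 2 * Q)" 
      using mult_left_mono[of \<eta> "c / real (N - 2 * Q)" "real Q"] by simp
    also have "\<dots> < 1 / 3"
    proof -
      have "3 * Q * (K + W * (4 * Q + 1)) + 2 * Q < N" using N(1) by (simp add: m_def)
      then have "3 * (Q * (K + W * (4 * Q + 1))) < N - 2 * Q" by (simp add: mult.assoc)
      then have "real (3 * (Q * (K + W * (4 * Q + 1)))) < real (N - 2 * Q)" by (rule of_nat_less_iff[THEN iffD2])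
      then have "3 * (Q * c) < real (N - 2 * Q)" unfolding c_def by simp
      then show ?thesis using pos by (simp add: divide_less_eq)
    qed
    finally show ?thesis .
  qed
  moreover have "10 ^ 9 \<le> N" using N(1) by (simp add: m_def)
  ultimately show False using no_tester[OF N(2) _ _ A] by blast
qed

text \<open>
  Outside the gadgets near the deleted point, every bounded configuration of the punctured graph
  also occurs in the encoding of \<open>T1\<close>, which is free of all marked graphs defining the property.
\<close>

lemma (in lookalike) embedding_transfer:
  assumes emb: "embedding f F (enc N T2)" and F: "simple_graph F" "card (verts F) \<le> s"
    and R: "R = 21 ^ s * 20" and G: "card (words (4 * R)) * s < card G"
    and avoid: "\<And>e j w. e < N \<Longrightarrow> j < 10 \<Longrightarrow> w \<in> words R \<Longrightarrow> act T2 w e = N \<Longrightarrow> vtx e j \<notin> f ` verts F"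
  shows "\<exists>f'. embedding f' F (enc N T1)"
proof -
  interpret E1: enc_action T1 N N by unfold_locales simp
  interpret E2: enc_action T2 "Suc N" N by unfold_locales simp
  have fV: "f ` verts F \<subseteq> {1..10 * N}"
    using emb by (auto simp: embedding_def verts_enc)
  have finF: "finite (verts F)" using F by (simp add: simple_graph_def)
  define E where "E = (\<lambda>v. (v - 1) div 10) ` f ` verts F"
  have vE: "\<exists>e j. v = vtx e j \<and> e \<in> E \<and> e < N \<and> j < 10" if v: "v \<in> f ` verts F" for v
  proof -
    have "v \<in> {1..10 * N}" using fV v by blast
    then obtain e j where ej: "e < N" "j < 10" "v = vtx e j" by (rule vtxE)
    then have "e = (v - 1) div 10" by (simp add: vtx_def)
    then show ?thesis using ej v unfolding E_def by blast
  qed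
  have Ev: "\<exists>j<10. vtx e j \<in> f ` verts F \<and> e < N" if e: "e \<in> E" for e
  proof -
    obtain v where v: "v \<in> f ` verts F" "e = (v - 1) div 10" using e by (auto simp: E_def)
    have "v \<in> {1..10 * N}" using fV v by blast
    then obtain e' j where ej: "e' < N" "j < 10" "v = vtx e' j" by (rule vtxE)
    then have "e' = e" using v by (simp add: vtx_def)
    then show ?thesis using ej v by blast
  qed
  have cE: "card E \<le> s"
    using card_image_le[of "f ` verts F" "\<lambda>v. (v - 1) div 10"] card_image_le[OF finF, of f] finF F(2)
    unfolding E_def by (meson finite_imageI le_trans)
  have le: "21 ^ card E * 20 \<le> R" unfolding R using cE by (intro mult_le_mono1 power_increasing) auto
  have "\<exists>D. finite D \<and> corr 20 D \<and> snd ` D = E \<and> card D \<le> card E"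
  proof (rule corr_cover[OF _ _ _ le])
    show "finite E" using finF by (simp add: E_def)
    show "E \<subseteq> {..<N}" using Ev by blast
    have "card (words (4 * R)) * card E \<le> card (words (4 * R)) * s" using cE by (rule mult_le_mono2)
    then show "card (words (4 * R)) * card E < card G" by (rule le_less_trans[OF _ G])
    show "act T2 w y \<noteq> N" if "y \<in> E" "w \<in> words (21 ^ card E * 20)" for y w
      using Ev[OF that(1)] avoid[of y _ w] words_mono[OF that(2) le] by blast
  qed
  then obtain D where D: "corr 20 D" "snd ` D = E" by blast
  \<comment> \<open>Port words have length at most 4, so \<open>S\<close> contains all points across
    ports. Radius 20 - 5 * 4 = 0 is left, just enough for \<open>S\<close> to be a partial
    injection.\<close>
  define S where "S = spread 4 D"
  have S: "corr 0 S" unfolding S_def by (rule corr_spread[OF D(1)]) simp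
  have S_inj: "x = x' \<longleftrightarrow> y = y'" if "(x, y) \<in> S" "(x', y') \<in> S" for x y x' y'
    using corrD(4)[OF S that, of "[]"] by simp
  define h where "h y = (THE x. (x, y) \<in> S)" for y
  have h: "h y = x" if "(x, y) \<in> S" for x y
    unfolding h_def using that S_inj by blast
  define Z where "Z = {vtx y j | y j. y \<in> snd ` S \<and> j < 10}"
  define \<Phi> where "\<Phi> v = vtx (h ((v - 1) div 10)) ((v - 1) mod 10)" for v
  have \<Phi>: "\<Phi> (vtx y j) = vtx x j" if "(x, y) \<in> S" "j < 10" for x y j
    using that h by (simp add: \<Phi>_def vtx_def)
  have inj\<Phi>: "inj_on \<Phi> Z"
  proof (rule inj_onI)
    fix v v' assume "v \<in> Z" "v' \<in> Z" and eq: "\<Phi> v = \<Phi> v'"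
    then obtain x y j x' y' j' where v: "v = vtx y j" "(x, y) \<in> S" "j < 10" "v' = vtx y' j'" "(x', y') \<in> S" "j' < 10"
      by (auto simp: Z_def)
    then have "vtx x j = vtx x' j'" using eq \<Phi> by simp
    then show "v = v'" using v S_inj[OF v(2,5)] by simp
  qed
  have key: "p \<in> Z \<and> neighbours (enc N T2) p \<subseteq> Z \<and> \<Phi> p \<in> verts (enc N T1) \<and>
      neighbours (enc N T1) (\<Phi> p) = \<Phi> ` neighbours (enc N T2) p" if p: "p \<in> f ` verts F" for p
  proof -
    obtain y j where yj: "p = vtx y j" "y \<in> E" "y < N" "j < 10" using vE[OF p] by blast
    then obtain x where xy: "(x, y) \<in> D" using D(2) by force
    have xyS: "(x, y) \<in> S" using xy subset_spread by (auto simp: S_def)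
    define w where "w = port_word j"
    have w: "w \<in> words 4" using port_word_set by (simp add: w_def words_def)
    have wS: "(act T1 w x, act T2 w y) \<in> S" unfolding S_def spread_def using xy w by blast
    have lt: "x < N" "act T1 w x < N" "act T2 w y < N" using corrD(1,2)[OF S xyS] corrD(1,2)[OF S wS] by auto
    have n2: "neighbours (enc N T2) p = vtx y ` set (gnb j) \<union>
        (if is_port j then {vtx (act T2 w y) (port_opp j)} else {})"
      using E2.nb_vtx[OF yj(3,4)] lt by (simp add: yj(1) w_def)
    have n1: "neighbours (enc N T1) (vtx x j) = vtx x ` set (gnb j) \<union>
        (if is_port j then {vtx (act T1 w x) (port_opp j)} else {})"
      using E1.nb_vtx[OF lt(1) yj(4)] lt by (simp add: w_def)
    have g10: "k < 10" if "k \<in> set (gnb j)" for k using gnb_facts(2)[OF yj(4)] that by auto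
    have vZ: "vtx b k \<in> Z" if "(a, b) \<in> S" "k < 10" for a b k
      unfolding Z_def using that by force
    have "p \<in> Z" using vZ[OF xyS yj(4)] yj(1) by simp
    moreover have "neighbours (enc N T2) p \<subseteq> Z"
      unfolding n2 using vZ[OF xyS] vZ[OF wS] g10 port_facts(5)[of j] by auto
    moreover have "\<Phi> p = vtx x j" using \<Phi>[OF xyS yj(4)] yj(1) by simp
    moreover have "\<Phi> ` vtx y ` set (gnb j) = vtx x ` set (gnb j)"
      unfolding image_image using \<Phi>[OF xyS] g10 by (intro image_cong) auto
    moreover have "\<Phi> (vtx (act T2 w y) (port_opp j)) = vtx (act T1 w x) (port_opp j)" if "is_port j"
      using \<Phi>[OF wS] port_facts(5)[OF that] by simp
    ultimately show ?thesis using lt yj(4) unfolding n1 n2 by (auto simp: image_Un verts_enc n1)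
  qed
  have "embedding (\<Phi> \<circ> f) F (enc N T1)"
  proof (rule embedding_comp[OF emb inj\<Phi>])
    fix v assume "v \<in> verts F"
    then have "f v \<in> f ` verts F" by simp
    note k = key[OF this]
    show "closed_nbhd (enc N T2) (f v) \<subseteq> Z" "\<Phi> (f v) \<in> verts (enc N T1)"
      "closed_nbhd (enc N T1) (\<Phi> (f v)) = \<Phi> ` closed_nbhd (enc N T2) (f v)"
      using k by (simp_all add: closed_nbhd_def)
  qed
  then show ?thesis by blast
qed

text \<open>The sequence of families is arbitrary; what is known is that the encoding of
  \<open>T1\<close> is free of its member. This excludes embeddings that avoid \<open>B\<close>. As
  \<open>B\<close> has bounded size, its density falls below \<beta> although the graph stays far
  from the property.\<close>

lemma not_non_propagating_kms_property: "\<not> non_propagating 9 kms_property"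
proof
  assume "non_propagating 9 kms_property"
  then obtain \<F> where np: "non_propagating_seq 9 \<F>" and "local_for 9 \<F> kms_property"
    by (auto simp: non_propagating_def)
  then obtain s where \<F>: "\<And>n. \<F> n \<subseteq> marked_graphs 9" "\<And>n F. F \<in> \<F> n \<Longrightarrow> card (verts F) \<le> s"
    and P: "\<And>n. of_order kms_property n = free_graphs 9 (\<F> n) n"
    unfolding local_for_def by blast
  obtain \<tau> :: "real \<Rightarrow> real" where \<tau>: "mono_on {0<..1} \<tau>" "\<forall>\<epsilon>>0. \<exists>\<beta>\<in>{0<..1}. \<tau> \<beta> < \<epsilon>"
    and cov: "\<forall>n. \<forall>G\<in>of_order (bounded_degree_graphs 9) n. \<forall>B.
      B \<subseteq> verts G \<and> B \<noteq> {} \<and> covers B (\<F> n) G \<longrightarrow>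
        eps_close 9 (\<tau> (real (card B) / real n)) G (free_graphs 9 (\<F> n) n) \<or> free_graphs 9 (\<F> n) n = {}"
    using np unfolding non_propagating_seq_def by (elim exE conjE) (rule that, assumption+)
  obtain \<beta> where \<beta>: "0 < \<beta>" "\<beta> \<le> 1" "\<tau> \<beta> < far_eps"
    using \<tau>(2)[rule_format, of far_eps] by (auto simp: far_eps_def)
  define R :: nat where "R = 21 ^ s * 20"
  define W where "W = card (words (4 * R))"
  obtain K where K: "\<And>m. \<exists>N\<ge>m. \<exists>T1 T2 G. regular_action T2 {..<Suc N} \<and>
      lookalike T1 T2 N R G \<and> N \<le> card G + K"
    using ex_lookalike[of R] by blast
  define m where "m = 10 ^ 9 + K + W * s + 1 + nat \<lceil>real (10 * W + 1) / \<beta>\<rceil>"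
  obtain N T1 T2 G where N: "m \<le> N" "regular_action T2 {..<Suc N}" "lookalike T1 T2 N R G" "N \<le> card G + K"
    using K[of m] by blast
  interpret lookalike T1 T2 N R G by (rule N(3))
  interpret E1: enc_action T1 N N by unfold_locales simp
  interpret E2: enc_action T2 "Suc N" N by unfold_locales simp
  have "10 ^ 9 + K + W * s + 1 \<le> N" using N(1) unfolding m_def by linarith
  then have N9: "10 ^ 9 \<le> N" "W * s < card G" using N(4) by linarith+
  \<comment> \<open>The vertex 1 guarantees that \<open>B\<close> is nonempty even if no gadget is
    near the deleted point.\<close>
  define B where "B = insert 1 {vtx e j | e j w. e < N \<and> j < 10 \<and> w \<in> words R \<and> act T2 w e = N}"
  have B: "B \<subseteq> {1..10 * N}" using N9(1) by (auto simp: B_def)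
  have "covers B (\<F> (10 * N)) (enc N T2)"
    unfolding covers_def
  proof (intro ballI allI impI, rule ccontr)
    fix F f assume F: "F \<in> \<F> (10 * N)" and emb: "embedding f F (enc N T2)" and neg: "\<not> (\<exists>v\<in>verts F. f v \<in> B)"
    have "vtx e j \<notin> f ` verts F" if "e < N" "j < 10" "w \<in> words R" "act T2 w e = N" for e j w
    proof -
      have "vtx e j \<in> B" unfolding B_def using that by blast
      then show ?thesis using neg by auto
    qed
    moreover have "simple_graph F" using \<F>(1) F by (auto simp: marked_graphs_def)
    ultimately obtain f' where "embedding f' F (enc N T1)"
      using embedding_transfer[OF emb _ \<F>(2)[OF F] R_def] N9(2) unfolding W_def by blast
    moreover have "enc N T1 \<in> free_graphs 9 (\<F> (10 * N)) (10 * N)"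
      using enc_in_kms_property[OF A.kms] unfolding P[symmetric] by (simp add: of_order_def card_verts_enc)
    ultimately show False using F by (auto simp: free_graphs_def gsf_free_def)
  qed
  moreover have "enc N T2 \<in> of_order (bounded_degree_graphs 9) (10 * N)"
    using E2.enc_bounded by (simp add: of_order_def card_verts_enc)
  moreover have "B \<noteq> {}" by (simp add: B_def)
  \<comment> \<open>This excludes the alternative that no graph of this order is free.\<close>
  moreover have "enc N T1 \<in> free_graphs 9 (\<F> (10 * N)) (10 * N)"
    using enc_in_kms_property[OF A.kms] unfolding P[symmetric] by (simp add: of_order_def card_verts_enc)
  ultimately have close: "eps_close 9 (\<tau> (real (card B) / real (10 * N))) (enc N T2) (of_order kms_property (10 * N))"
    using cov[rule_format, of "enc N T2" "10 * N" B] B unfolding P[symmetric] by (auto simp: verts_enc)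
  have cB: "card B \<le> 10 * W + 1"
  proof -
    \<comment> \<open>Reading words backwards from the deleted point \<open>N\<close>, with
      \<open>4 * R\<close> for the inverses, bounds \<open>B\<close> independently of
      \<open>N\<close>.\<close>
    define B' where "B' = (\<lambda>(w, j). vtx (act T2 w N) j) ` (words (4 * R) \<times> {..<10})"
    have "B \<subseteq> insert 1 B'"
    proof
      fix v assume "v \<in> B"
      then consider "v = 1" | e j w where "v = vtx e j" "e < N" "j < 10" "w \<in> words R" "act T2 w e = N"
        by (auto simp: B_def)
      then show "v \<in> insert 1 B'"
      proof cases
        case (2 e j w)
        have "act T2 (winv w) N = e" using B.act_winv[OF words_set[OF 2(4)], of e] 2 by simp
        then have "v = (\<lambda>(w, j). vtx (act T2 w N) j) (winv w, j)" using 2 by simp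
        moreover have "(winv w, j) \<in> words (4 * R) \<times> {..<10}" using words_winv[OF 2(4)] 2 by simp
        ultimately show ?thesis unfolding B'_def by blast
      qed simp
    qed
    moreover have "finite B'" by (simp add: B'_def)
    ultimately have "card B \<le> card (insert 1 B')" by (intro card_mono) auto
    also have "\<dots> \<le> card B' + 1" using \<open>finite B'\<close> by (simp add: card_insert_if)
    also have "card B' \<le> card (words (4 * R) \<times> {..<10 :: nat})" unfolding B'_def by (rule card_image_le) simp
    also have "\<dots> = 10 * W" by (simp add: W_def card_cartesian_product)
    finally show ?thesis by simp
  qed
  define t where "t = real (card B) / real (10 * N)"
  have "card B > 0" using finite_subset[OF B] by (auto simp: card_gt_0_iff B_def)
  then have "0 < t" using N9(1) by (simp add: t_def)
  moreover have "t \<le> \<beta>"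
  proof -
    have "real (10 * W + 1) / \<beta> \<le> real N" using N(1) unfolding m_def by linarith
    then have "real (10 * W + 1) \<le> real N * \<beta>" using \<beta> by (simp add: divide_le_eq)
    also have "\<dots> \<le> \<beta> * real (10 * N)" using \<beta> by simp
    finally have "real (card B) \<le> \<beta> * real (10 * N)" using cB by linarith
    then show ?thesis using N9(1) by (simp add: t_def divide_le_eq)
  qed
  ultimately have "\<tau> t \<le> \<tau> \<beta>" using \<beta>(1,2) by (intro mono_onD[OF \<tau>(1)]) auto
  then have "\<tau> (real (card B) / real (10 * N)) \<le> far_eps" using \<beta>(3) by (simp add: t_def)
  moreover have "kms_action T2 {..<Suc N}" "transitive_on T2 {..<Suc N}" using N(2) by (auto simp: regular_action_def)
  ultimately show False using punctured_far[OF _ _ N9(1)] close by blast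
qed

theorem theorem1p1:
  shows "(\<exists>d P. graph_property d P \<and> gsf_local d P \<and> \<not> testable d P) \<and>
         (\<exists>d P. graph_property d P \<and> gsf_local d P \<and> \<not> non_propagating d P)"
  using graph_property_kms_property gsf_local_kms_property not_testable_kms_property
    not_non_propagating_kms_property by blast

end
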